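(* Suppose $d\ge2$ and $p=1$, and that $f$ also satisfies (Lip) and (Hilb). Then, for all realizations $\{X_i\}$ in an event of probability $1$, $$\lim_{n\to\infty}\min_{\gamma\in\Omega_n^l(a,b)}L_n(\gamma)=\min_{\gamma\in\Omega(a,b)}F(\gamma).$$ Moreover, suppose now that $f$ in addition satisfies (TrIneq) and (Pythag) for some $1<\alpha<\sqrt2$, and that $\epsilon_n=n^{-\delta}$ where, for some $0<\eta<1$ and this $\alpha$, $$\delta>\max\big\{[(2-\alpha^2)\eta+d]^{-1},\ [\alpha(d-1)+1]^{-1}\big\}.$$ Then, for all realizations $\{X_i\}$ in an event of probability $1$: let $l_{\mathbf v^{(n)}}\in\operatorname{argmin}L_n$ be optimal paths ($n$ large). For any subsequence of $\{l_{\mathbf v^{(n)}}\}$, and correspondingly of the discrete paths $\{\mathbf v^{(n)}\}$, there is a further subsequence along which the linear paths converge uniformly to a limit path $\gamma\in\operatorname{argmin}F$ and the discrete paths converge in the Hausdorff metric to $S_\gamma$. If $F$ has a unique (up to reparametrization) minimizer $\gamma$, the whole sequence of discrete paths converges: $\lim_{n\to\infty}d_{haus}(\mathbf v^{(n)},S_\gamma)=0$.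
   Context: Let $D\subset\mathbb R^d$ be the closure of a nonempty open, bounded, convex set; $|\cdot|$ is the Euclidean norm. The function $f:D\times\mathbb R^d\to[0,\infty)$ satisfies, for some $p\ge1$: (A0) $f$ is continuous on $D\times\mathbb R^d$ and $C^1$ on $D\times(\mathbb R^d\setminus\{0\})$; (A1) $f(x,v)$ is convex in $v$; (A2) $f(x,\lambda v)=\lambda^pf(x,v)$ for $\lambda>0$; (A3) there are $m_1,m_2>0$ with $m_1|v|^p\le f(x,v)\le m_2|v|^p$ for all $x\in D$, $v\in\mathbb R^d$. Fix $a,b\in D$. For $u,v\in D$, $\Omega(u,v)$ is the set of Lipschitz paths $\gamma:[0,1]\to D$ with $\gamma(0)=u$, $\gamma(1)=v$; $F(\gamma)=\int_0^1f(\gamma(t),\dot\gamma(t))\,dt$ (the minimum over $\Omega(a,b)$ is attained; $\operatorname{argmin}F$ refers to $\Omega(a,b)$). Additional conditions on $f$: - (Lip): there is $c$ with $|f(x,v)-f(y,v)|\le c|x-y||v|^p$ for all $x,y\in D$, $v\in\mathbb R^d$. - (Hilb): for each $x\in D$ and all $u,v\in D$, $\inf_{\gamma\in\Omega(u,v)}\int_0^1f(x,\dot\gamma(t))\,dt=f(x,v-u)$. - (TrIneq): for each $x\in D$ and all $u,v,w\in\mathbb R^d$, $f(x,v-w)\le f(x,v-u)+f(x,u-w)$. - (Pythag) with exponent $\alpha>1$: for every $c>0$ there is $C=C(\alpha,f,c)>0$ such that, whenever $0<r<1$ and $u,v,w$ are points with $|u-w|,|v-w|,|u-v|<\eta'$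 for some $\eta'<1$, with distance from $w$ to the line segment between $u$ and $v$ at least $r$, and with $|u-v|\le c\,r^{1/\alpha}$, one has $f(x,w-u)+f(x,v-w)\ge f(x,v-u)+Cr^\alpha$ for all $x\in D$. Let $X_1,X_2,\dots$ be i.i.d. points in $D$ whose law has Lebesgue density $\rho$ satisfying $c_0\le\rho(x)\le c_0^{-1}$ for all $x\in D$ and some $c_0>0$. Put $\mathcal X_n=\{X_1,\dots,X_n\}$. Throughout (including in the second part), $\epsilon_n>0$ satisfies $\lim_n\epsilon_n=0$ and $\limsup_{n\to\infty}\frac{(\log n)^{1/d}}{n^{1/d}}\frac1{\epsilon_n}=0$. The graph $\mathcal G_n(a,b)$ has vertex set $\mathcal X_n\cup\{a,b\}$, with an edge between $u,v$ iff $0<|u-v|<\epsilon_n$. $V_n(a,b)$ is the set of paths $\mathbf v=(v_0,\dots,v_m)$ ($m\ge1$ steps, $m$ arbitrary) of vertices with $v_0=a$, $v_m=b$ and an edge between $v_i$ and $v_{i+1}$ for $0\le i<m$; almost surely $V_n(a,b)\neq\emptyset$ for all large $n$. For $\mathbf v=(v_0,\dots,v_m)\in V_n(a,b)$ let $l_{\mathbf v}\in\Omega(a,b)$ be the piecewise linear path $l_{\mathbf v}(t)=(1-(mt-i))v_i+(mt-i)v_{i+1}$ for $i/m\le t\le(i+1)/m$. Put $\Omega_n^l(a,b)=\{l_{\mathbf v}:\mathbf v\in V_n(a,b)\}$ and let $L_n$ be the restriction of $F$ to $\Omega_n^l(a,b)$. For $\gamma\in\Omega(a,b)$, $S_\gamma=\{\gamma(t):0\le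 t\le1\}$. For compact $A,B\subset D$, the Hausdorff metric is $d_{haus}(A,B)=\max\{\sup_{x\in A}\inf_{y\in B}|x-y|,\ \sup_{y\in B}\inf_{x\in A}|x-y|\}$; a discrete path $(v_0,\dots,v_m)$ is identified with the set $\{v_0,\dots,v_m\}$ in Hausdorff statements. "$F$ has a unique (up to reparametrization) minimizer $\gamma$" means that $\gamma\in\operatorname{argmin}F$ and every element of $\operatorname{argmin}F$ is of the form $\gamma\circ s$ with $s:[0,1]\to[0,1]$ nondecreasing, Lipschitz, $s(0)=0$, $s(1)=1$. *)

theory Defs
  imports "HOL-Probability.Probability"
begin

definition convex_body :: "'a::euclidean_space set \<Rightarrow> bool" where
  "convex_body D \<longleftrightarrow>
     (\<exists>U. open U \<and> U \<noteq> {} \<and> bounded U \<and> convex U \<and> D = closure U)"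

text \<open>Paths are total functions on the reals of which only the values on \<open>{0..1}\<close> matter.\<close>

definition lip_paths :: "'a::euclidean_space set \<Rightarrow> 'a \<Rightarrow> 'a \<Rightarrow> (real \<Rightarrow> 'a) set" where
  "lip_paths D u v =
     {\<gamma>. (\<exists>C. C-lipschitz_on {0..1} \<gamma>) \<and> path_image \<gamma> \<subseteq> D \<and> pathstart \<gamma> = u \<and> pathfinish \<gamma> = v}"

text \<open>A Lipschitz path is differentiable almost everywhere; on the exceptional null set
  \<^const>\<open>vector_derivative\<close> is unspecified, which does not affect the integral.\<close>

definition velocity :: "(real \<Rightarrow> 'a::euclidean_space) \<Rightarrow> real \<Rightarrow> 'a" where
  "velocity \<gamma> t = vector_derivative \<gamma> (at t within {0..1})"

definition cost :: "('a::euclidean_space \<Rightarrow> 'a \<Rightarrow> real) \<Rightarrow> (real \<Rightarrow> 'a) \<Rightarrow> real" where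
  "cost f \<gamma> = integral {0..1} (\<lambda>t. f (\<gamma> t) (velocity \<gamma> t))"

definition cond_A0 :: "'a::euclidean_space set \<Rightarrow> ('a \<Rightarrow> 'a \<Rightarrow> real) \<Rightarrow> bool" where
  "cond_A0 D f \<longleftrightarrow>
     continuous_on (D \<times> UNIV) (\<lambda>(x, v). f x v) \<and>
     (\<exists>f' :: 'a \<times> 'a \<Rightarrow> ('a \<times> 'a) \<Rightarrow>\<^sub>L real.
        (\<forall>z \<in> D \<times> (- {0}).
           ((\<lambda>(x, v). f x v) has_derivative blinfun_apply (f' z)) (at z within D \<times> (- {0}))) \<and>
        continuous_on (D \<times> (- {0})) f')"

definition cond_A1 :: "'a::euclidean_space set \<Rightarrow> ('a \<Rightarrow> 'a \<Rightarrow> real) \<Rightarrow> bool" where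
  "cond_A1 D f \<longleftrightarrow> (\<forall>x\<in>D. convex_on UNIV (f x))"

definition cond_A2 :: "real \<Rightarrow> 'a::euclidean_space set \<Rightarrow> ('a \<Rightarrow> 'a \<Rightarrow> real) \<Rightarrow> bool" where
  "cond_A2 p D f \<longleftrightarrow> (\<forall>x\<in>D. \<forall>v. \<forall>s>0. f x (s *\<^sub>R v) = s powr p * f x v)"

definition cond_A3 :: "real \<Rightarrow> 'a::euclidean_space set \<Rightarrow> ('a \<Rightarrow> 'a \<Rightarrow> real) \<Rightarrow> bool" where
  "cond_A3 p D f \<longleftrightarrow>
     (\<exists>m1>0. \<exists>m2>0. \<forall>x\<in>D. \<forall>v.
        m1 * norm v powr p \<le> f x v \<and> f x v \<le> m2 * norm v powr p)"

definition cost_integrand :: "real \<Rightarrow> 'a::euclidean_space set \<Rightarrow> ('a \<Rightarrow> 'a \<Rightarrow> real) \<Rightarrow> bool" where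
  "cost_integrand p D f \<longleftrightarrow>
     (\<forall>x\<in>D. \<forall>v. 0 \<le> f x v) \<and> cond_A0 D f \<and> cond_A1 D f \<and> cond_A2 p D f \<and> cond_A3 p D f"

definition cond_Lip :: "real \<Rightarrow> 'a::euclidean_space set \<Rightarrow> ('a \<Rightarrow> 'a \<Rightarrow> real) \<Rightarrow> bool" where
  "cond_Lip p D f \<longleftrightarrow>
     (\<exists>c. \<forall>x\<in>D. \<forall>y\<in>D. \<forall>v. \<bar>f x v - f y v\<bar> \<le> c * norm (x - y) * norm v powr p)"

definition cond_Hilb :: "'a::euclidean_space set \<Rightarrow> ('a \<Rightarrow> 'a \<Rightarrow> real) \<Rightarrow> bool" where
  "cond_Hilb D f \<longleftrightarrow>
     (\<forall>x\<in>D. \<forall>u\<in>D. \<forall>v\<in>D.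
        (INF \<gamma>\<in>lip_paths D u v. integral {0..1} (\<lambda>t. f x (velocity \<gamma> t))) = f x (v - u))"

definition cond_TrIneq :: "'a::euclidean_space set \<Rightarrow> ('a \<Rightarrow> 'a \<Rightarrow> real) \<Rightarrow> bool" where
  "cond_TrIneq D f \<longleftrightarrow>
     (\<forall>x\<in>D. \<forall>u v w. f x (v - w) \<le> f x (v - u) + f x (u - w))"

definition cond_Pythag :: "real \<Rightarrow> 'a::euclidean_space set \<Rightarrow> ('a \<Rightarrow> 'a \<Rightarrow> real) \<Rightarrow> bool" where
  "cond_Pythag \<alpha> D f \<longleftrightarrow>
     (\<forall>c>0. \<exists>C>0. \<forall>r u v w.
        0 < r \<and> r < 1 \<and>
        (\<exists>\<eta>'<1. norm (u - w) < \<eta>' \<and> norm (v - w) < \<eta>' \<and> norm (u - v) < \<eta>') \<and>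
        r \<le> infdist w (closed_segment u v) \<and>
        norm (u - v) \<le> c * r powr (1 / \<alpha>)
        \<longrightarrow> (\<forall>x\<in>D. f x (w - u) + f x (v - w) \<ge> f x (v - u) + C * r powr \<alpha>))"

text \<open>A path \<open>(v\<^sub>0, \<dots>, v\<^sub>m)\<close> in the \<open>\<epsilon>\<close>-random geometric graph on the vertex set \<open>V\<close> is the list
  of its \<open>m + 1 \<ge> 2\<close> vertices.\<close>

definition geo_edge :: "real \<Rightarrow> 'a::euclidean_space \<Rightarrow> 'a \<Rightarrow> bool" where
  "geo_edge \<epsilon> u v \<longleftrightarrow> 0 < norm (u - v) \<and> norm (u - v) < \<epsilon>"

definition graph_paths :: "'a::euclidean_space set \<Rightarrow> real \<Rightarrow> 'a \<Rightarrow> 'a \<Rightarrow> 'a list set" where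
  "graph_paths V \<epsilon> a b =
     {vs. 2 \<le> length vs \<and> set vs \<subseteq> V \<and> hd vs = a \<and> last vs = b \<and>
          (\<forall>i. Suc i < length vs \<longrightarrow> geo_edge \<epsilon> (vs ! i) (vs ! Suc i))}"

definition linear_path :: "'a::euclidean_space list \<Rightarrow> real \<Rightarrow> 'a" where
  "linear_path vs t =
     (let m = length vs - 1;
          i = min (nat \<lfloor>real m * t\<rfloor>) (m - 1)
      in (1 - (real m * t - real i)) *\<^sub>R vs ! i + (real m * t - real i) *\<^sub>R vs ! Suc i)"

lemma linear_path_eq:
  fixes vs :: "'a::euclidean_space list"
  assumes m: "length vs = Suc m" and i: "i < m"
    and t: "real i / real m \<le> t" "t \<le> real (Suc i) / real m"
  shows "linear_path vs t =
    (1 - (real m * t - real i)) *\<^sub>R vs ! i + (real m * t - real i) *\<^sub>R vs ! Suc i"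
proof -
  have mt: "real i \<le> real m * t" "real m * t \<le> real i + 1"
    using i t by (auto simp: field_simps)
  show ?thesis
  proof (cases "real m * t = real i + 1")
    case False
    then have "\<lfloor>real m * t\<rfloor> = int i"
      using mt by (intro floor_unique) auto
    moreover have "min i (m - 1) = i" using i by auto
    ultimately show ?thesis using m by (simp add: linear_path_def)
  next
    case True
    then have "\<lfloor>real m * t\<rfloor> = int (Suc i)" by (intro floor_unique) auto
    then have fl: "nat \<lfloor>real m * t\<rfloor> = Suc i" by simp
    show ?thesis
    proof (cases "Suc i = m")
      case True
      then have "min (nat \<lfloor>real m * t\<rfloor>) (m - 1) = i" using fl by auto
      then show ?thesis using m by (simp add: linear_path_def Let_def)
    next
      case neq: False
      then have "min (nat \<lfloor>real m * t\<rfloor>) (m - 1) = Suc i" using fl i by auto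
      then show ?thesis using m True by (simp add: linear_path_def Let_def)
    qed
  qed
qed

definition linear_paths :: "'a::euclidean_space set \<Rightarrow> real \<Rightarrow> 'a \<Rightarrow> 'a \<Rightarrow> (real \<Rightarrow> 'a) set" where
  "linear_paths V \<epsilon> a b = linear_path ` graph_paths V \<epsilon> a b"

text \<open>The discrete problem minimizes the restriction of \<^const>\<open>cost\<close> to \<^const>\<open>linear_paths\<close>,
  so both problems are expressed by giving the set over which \<^const>\<open>cost\<close> is minimized.\<close>

definition argmin_on :: "('b \<Rightarrow> real) \<Rightarrow> 'b set \<Rightarrow> 'b set" where
  "argmin_on G S = {x. is_arg_min G (\<lambda>y. y \<in> S) x}"

text \<open>Meaningful only if \<open>argmin_on G S \<noteq> {}\<close>.\<close>

definition min_on :: "('b \<Rightarrow> real) \<Rightarrow> 'b set \<Rightarrow> real" where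
  "min_on G S = (LEAST y. y \<in> G ` S)"

lemma min_on_eq: "x \<in> argmin_on G S \<Longrightarrow> min_on G S = G x"
  unfolding min_on_def argmin_on_def is_arg_min_def
  by (intro Least_equality) (auto simp: not_less)

definition unique_minimizer ::
  "('a::euclidean_space \<Rightarrow> 'a \<Rightarrow> real) \<Rightarrow> 'a set \<Rightarrow> 'a \<Rightarrow> 'a \<Rightarrow> (real \<Rightarrow> 'a) \<Rightarrow> bool" where
  "unique_minimizer f D a b \<gamma> \<longleftrightarrow>
     \<gamma> \<in> argmin_on (cost f) (lip_paths D a b) \<and>
     (\<forall>\<beta> \<in> argmin_on (cost f) (lip_paths D a b).
        \<exists>s :: real \<Rightarrow> real. s ` {0..1} \<subseteq> {0..1} \<and> mono_on {0..1} s \<and>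
          (\<exists>C. C-lipschitz_on {0..1} s) \<and> s 0 = 0 \<and> s 1 = 1 \<and>
          (\<forall>t\<in>{0..1}. \<beta> t = \<gamma> (s t)))"

text \<open>Hausdorff distance, for nonempty compact sets.\<close>

definition haus_dist :: "'a::euclidean_space set \<Rightarrow> 'a set \<Rightarrow> real" where
  "haus_dist A B = max (SUP x\<in>A. INF y\<in>B. norm (x - y)) (SUP y\<in>B. INF x\<in>A. norm (x - y))"

text \<open>The points \<open>X\<^sub>1, X\<^sub>2, \<dots>\<close>; the value of \<open>X\<close> at index \<open>0\<close> plays no role.\<close>

definition iid_sample ::
  "'w measure \<Rightarrow> 'a::euclidean_space set \<Rightarrow> ('a \<Rightarrow> real) \<Rightarrow> (nat \<Rightarrow> 'w \<Rightarrow> 'a) \<Rightarrow> bool" where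
  "iid_sample M D \<rho> X \<longleftrightarrow>
     prob_space.indep_vars M (\<lambda>_. borel) X {1..} \<and>
     (\<forall>i\<ge>1. distributed M lborel (X i) (\<lambda>x. ennreal (\<rho> x) * indicator D x))"

definition vertices :: "(nat \<Rightarrow> 'w \<Rightarrow> 'a) \<Rightarrow> 'a \<Rightarrow> 'a \<Rightarrow> nat \<Rightarrow> 'w \<Rightarrow> 'a set" where
  "vertices X a b n \<omega> = (\<lambda>i. X i \<omega>) ` {1..n} \<union> {a, b}"

end

theory Submission
  imports Defs "HOL-Complex_Analysis.Great_Picard" "HOL-Real_Asymp.Real_Asymp"
begin

text \<open>
  The theorem compares a variational problem over Lipschitz curves with its discretization on a
  random graph.  The link between the two is a Riemann sum.  For a Lipschitz curve \<open>\<gamma>\<close> let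
  \<open>riemann \<gamma> N\<close> be the cost of the \<open>N\<close> chords between the points \<open>\<gamma> (i / N)\<close>, where the first argument of
  \<open>f\<close> is frozen at the left end of each chord.  It converges to \<open>cost f \<gamma>\<close>
  (\<open>riemann_tendsto_cost\<close>), because Lipschitz curves are differentiable almost everywhere and the
  difference quotients are bounded.  Since \<open>f x\<close> is sublinear for \<open>p = 1\<close> and Lipschitz in \<open>x\<close>, the
  sum exceeds \<open>cost f \<gamma>\<close> by at most \<open>c L\<^sup>2 / N\<close> (\<open>riemann_le_cost\<close>), an error that depends on \<open>\<gamma>\<close> only
  through its Lipschitz constant \<open>L\<close>.  As Riemann sums see finitely many values of the curve, the
  cost is therefore lower semicontinuous on families with a common Lipschitz constant; with the
  theorem of Arzela and Ascoli this is the compactness statement \<open>uniform_subsequence\<close>.  Minimizers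
  exist because every curve can be replaced, at almost no cost, by a polygon whose Lipschitz constant
  is bounded in terms of its cost (\<open>polygon_approximation\<close>).

  Convergence of the minima.  Every path in the graph is a Lipschitz path, so the discrete minimum is
  never below the continuous one.  Conversely, mark \<open>N\<close> points on a minimizer, with \<open>N\<close> of the order
  of \<open>1 / \<epsilon>\<close>, and move each to a sample point at distance at most \<open>\<kappa> \<epsilon>\<close>.  This costs
  \<open>O(N (\<kappa> \<epsilon> + \<epsilon>\<^sup>2)) = O(\<kappa> + \<epsilon>)\<close>.  For each fixed \<open>\<kappa> > 0\<close> such sample points exist almost surely for all
  large \<open>n\<close>: a given ball of radius \<open>\<kappa> \<epsilon> / 2\<close> is missed with probability at most
  \<open>exp (- q n \<epsilon>\<^sup>d)\<close>, and \<open>n \<epsilon>\<^sup>d\<close> grows faster than \<open>ln n\<close> (\<open>AE_sample_dense\<close>).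

  Convergence of the minimizers.  By compactness it suffices to bound the Lipschitz constants of the
  optimal piecewise linear paths, and as each of the \<open>m\<close> steps takes time \<open>1 / m\<close>, this means
  \<open>m \<epsilon> = O(1)\<close>.  Suppose that two vertices of an optimal path that are \<open>k\<close> steps apart have distance
  less than \<open>\<epsilon>\<close>.  They are joined by an edge, so the part of the path between them is at most as
  expensive as this edge.  The Pythagorean condition then forces this part into the tube of radius
  \<open>\<epsilon>\<^sup>\<alpha>\<close> around the edge: leaving the tube costs a multiple of \<open>(\<epsilon>\<^sup>\<alpha>)\<^sup>\<alpha>\<close>, which for
  \<open>\<alpha>\<^sup>2 < 2\<close> exceeds the freezing error \<open>O(\<epsilon>\<^sup>2)\<close> (\<open>shortcut_window_flat\<close>).  Such tubes have volume
  \<open>O(\<epsilon> powr (1 + \<alpha> (d - 1)))\<close>, and the lower bound on \<open>\<delta>\<close> makes the expected number of sample points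
  in one of them a negative power of \<open>n\<close>.  Hence, almost surely for all large \<open>n\<close>, no tube contains
  more than a fixed number of them (\<open>AE_tubes_sparse\<close>).  So if \<open>k\<close> is larger than this number, any
  \<open>k\<close> consecutive steps have total length at least \<open>\<epsilon>\<close>, and since the length of the path is at most a
  constant times its cost, \<open>m \<epsilon>\<close> is bounded (\<open>hop_bound\<close>).
\<close>

section \<open>Differentiability of Lipschitz curves almost everywhere\<close>

text \<open>Vitali's covering theorem in the form used below.  Because \<open>G\<close> is open, discarding the intervals
  that leave \<open>G\<close> keeps the family fine at every point of \<open>E\<close>.\<close>
lemma vitali_intervals:
  fixes E G :: "real set"
  assumes G: "open G" "E \<subseteq> G"
    and small: "\<And>t d. t \<in> E \<Longrightarrow> 0 < d \<Longrightarrow> \<exists>s u. s < t \<and> t < u \<and> u - s < d \<and> P s u"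
  obtains C :: "(real \<times> real) set" where "countable C"
    "\<And>s u. (s, u) \<in> C \<Longrightarrow> s < u \<and> P s u \<and> {s<..<u} \<subseteq> G"
    "disjoint_family_on (\<lambda>(s, u). {s<..<u}) C"
    "negligible (E - (\<Union>(s, u)\<in>C. {s<..<u}))"
proof -
  define K where "K = {(s, u). s < u \<and> P s u \<and> {s<..<u} \<subseteq> G}"
  define a where "a = (\<lambda>(s, u). (s + u) / (2::real))"
  define r where "r = (\<lambda>(s, u). (u - s) / (2::real))"
  have ball: "ball (a i) (r i) = (\<lambda>(s, u). {s<..<u}) i" for i
    by (cases i) (auto simp: a_def r_def ball_eq_greaterThanLessThan field_simps)
  have cov: "\<exists>i. i \<in> K \<and> t \<in> ball (a i) (r i) \<and> r i < d" if t: "t \<in> E" "0 < d" for t d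
  proof -
    have "t \<in> G" using t G by auto
    then obtain e where e: "e > 0" "ball t e \<subseteq> G" using G(1) openE by blast
    obtain s u where su: "s < t" "t < u" "u - s < min d e" "P s u"
      using small[OF t(1), of "min d e"] t(2) e(1) by fastforce
    have "{s<..<u} \<subseteq> ball t e"
      using su by (auto simp: dist_real_def)
    then have "(s, u) \<in> K" using su e by (auto simp: K_def)
    then show ?thesis using su by (intro exI[of _ "(s, u)"]) (auto simp: ball, simp add: r_def)
  qed
  obtain C where C: "countable C" "C \<subseteq> K"
     "pairwise (\<lambda>i j. disjnt (ball (a i) (r i)) (ball (a j) (r j))) C"
     "negligible (E - (\<Union>i \<in> C. ball (a i) (r i)))"
    using Vitali_covering_theorem_balls[of E K a r, OF cov] by blast
  show ?thesis
  proof
    show "countable C" by fact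
    show "s < u \<and> P s u \<and> {s<..<u} \<subseteq> G" if "(s, u) \<in> C" for s u
      using that C(2) by (auto simp: K_def)
    show "disjoint_family_on (\<lambda>(s, u). {s<..<u}) C"
      using C(3) unfolding ball by (simp add: disjoint_family_on_def pairwise_def disjnt_def)
    show "negligible (E - (\<Union>(s, u)\<in>C. {s<..<u}))"
      using C(4) unfolding ball .
  qed
qed

text \<open>Vitali's argument for monotone functions, phrased with the Stieltjes measure \<open>\<mu>\<close> of \<open>h\<close>.  Take an
  open \<open>G \<supseteq> E\<close> of almost minimal measure \<open>m\<close>.  Intervals of slope at most \<open>p\<close> inside \<open>G\<close> fill, up to a
  null set of \<open>E\<close>, an open set \<open>W\<close> with \<open>\<mu> W \<le> p m\<close> approximately.  Intervals of slope at least \<open>q\<close>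
  inside \<open>W\<close> still cover almost all of \<open>E\<close>, which gives \<open>q m \<le> \<mu> W\<close> approximately.  Hence
  \<open>(q - p) m = 0\<close>.  Working with the infimum \<open>m\<close> over open sets avoids the question whether \<open>E\<close> is
  measurable.\<close>
lemma slope_gap_negligible:
  fixes h :: "real \<Rightarrow> real"
  assumes mono: "\<And>x y. x \<le> y \<Longrightarrow> h x \<le> h y" and cont: "continuous_on UNIV h"
    and pq: "0 \<le> p" "p < q" and E: "E \<subseteq> {0<..<1}"
    and low: "\<And>t d. t \<in> E \<Longrightarrow> 0 < d \<Longrightarrow> \<exists>s u. s < t \<and> t < u \<and> u - s < d \<and> h u - h s \<le> p * (u - s)"
    and high: "\<And>t d. t \<in> E \<Longrightarrow> 0 < d \<Longrightarrow> \<exists>s u. s < t \<and> t < u \<and> u - s < d \<and> q * (u - s) \<le> h u - h s"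
  shows "negligible E"
proof -
  define \<mu> where "\<mu> = interval_measure h"
  have rc: "continuous (at_right a) h" for a
    using cont by (metis UNIV_I continuous_at_imp_continuous_within continuous_on_eq_continuous_at open_UNIV)
  have atoms: "emeasure \<mu> {x} = 0" for x
    using emeasure_interval_measure_Icc[of x x h] mono cont by (simp add: \<mu>_def)
  have \<mu>: "emeasure \<mu> {s<..<u} = ennreal (h u - h s)" if "s < u" for s u
  proof -
    have "emeasure \<mu> {s<..u} = emeasure \<mu> {s<..<u} + emeasure \<mu> {u}"
      using that by (subst plus_emeasure) (auto simp: \<mu>_def intro!: arg_cong[of _ _ "emeasure _"])
    then show ?thesis
      using emeasure_interval_measure_Ioc[of s u h] that mono rc atoms by (simp add: \<mu>_def)
  qed
  define \<G> where "\<G> = {G. open G \<and> E \<subseteq> G}"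
  define m where "m = (INF G\<in>\<G>. emeasure lborel G)"
  have m1: "m \<le> 1"
  proof -
    have "m \<le> emeasure lborel {0<..<(1::real)}"
      unfolding m_def \<G>_def using E by (intro INF_lower) auto
    then show ?thesis by simp
  qed
  have key: "ennreal q * m \<le> ennreal p * m + ennreal (e * (p + q))" if e: "e > 0" for e
  proof -
    have "m \<noteq> \<top>" using m1 by (auto simp: top_unique)
    then have "m < m + ennreal e" using e by (cases m) (auto simp: ennreal_plus[symmetric] ennreal_less_iff simp del: ennreal_plus)
    then obtain G where G: "open G" "E \<subseteq> G" "emeasure lborel G < m + ennreal e"
      unfolding m_def INF_less_iff \<G>_def by blast
    obtain C where C: "countable C"
      "\<And>s u. (s, u) \<in> C \<Longrightarrow> s < u \<and> h u - h s \<le> p * (u - s) \<and> {s<..<u} \<subseteq> G"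
      "disjoint_family_on (\<lambda>(s, u). {s<..<u}) C"
      "negligible (E - (\<Union>(s, u)\<in>C. {s<..<u}))"
      using vitali_intervals[OF G(1,2) low] by metis
    define W where "W = (\<Union>(s, u)\<in>C. {s<..<u})"
    have W: "open W" "W \<subseteq> G" unfolding W_def using C(2) by auto
    have "emeasure \<mu> W = (\<integral>\<^sup>+i. emeasure \<mu> (case i of (s, u) \<Rightarrow> {s<..<u}) \<partial>count_space C)"
      unfolding W_def by (rule emeasure_UN_countable) (use C in \<open>auto simp: \<mu>_def\<close>)
    also have "\<dots> \<le> (\<integral>\<^sup>+i. ennreal p * emeasure lborel (case i of (s, u) \<Rightarrow> {s<..<u}) \<partial>count_space C)"
    proof (intro nn_integral_mono, clarsimp)
      fix s u assume "(s, u) \<in> C"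
      then have "s < u" "h u - h s \<le> p * (u - s)" using C(2) by auto
      then show "emeasure \<mu> {s<..<u} \<le> ennreal p * emeasure lborel {s<..<u}"
        using pq by (simp add: \<mu> ennreal_mult' [symmetric] ennreal_leI)
    qed
    also have "\<dots> = ennreal p * (\<integral>\<^sup>+i. emeasure lborel (case i of (s, u) \<Rightarrow> {s<..<u}) \<partial>count_space C)"
      by (rule nn_integral_cmult) auto
    also have "\<dots> = ennreal p * emeasure lborel W"
      unfolding W_def by (subst emeasure_UN_countable) (use C in auto)
    also have "\<dots> \<le> ennreal p * emeasure lborel G"
      using W G by (intro mult_left_mono emeasure_mono) auto
    also have "\<dots> \<le> ennreal p * (m + ennreal e)"
      using G(3) by (intro mult_left_mono) auto
    finally have 1: "emeasure \<mu> W \<le> ennreal p * (m + ennreal e)" .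
    obtain C' where C': "countable C'"
      "\<And>s u. (s, u) \<in> C' \<Longrightarrow> s < u \<and> q * (u - s) \<le> h u - h s \<and> {s<..<u} \<subseteq> W"
      "disjoint_family_on (\<lambda>(s, u). {s<..<u}) C'"
      "negligible (E \<inter> W - (\<Union>(s, u)\<in>C'. {s<..<u}))"
    proof -
      have "\<And>t d. t \<in> E \<inter> W \<Longrightarrow> 0 < d \<Longrightarrow> \<exists>s u. s < t \<and> t < u \<and> u - s < d \<and> q * (u - s) \<le> h u - h s"
        using high by auto
      from vitali_intervals[OF W(1) _ this, of "E \<inter> W"] show thesis using that by auto
    qed
    define W' where "W' = (\<Union>(s, u)\<in>C'. {s<..<u})"
    have W': "open W'" "W' \<subseteq> W" unfolding W'_def using C'(2) by auto
    have "ennreal q * emeasure lborel W' = ennreal q * (\<integral>\<^sup>+i. emeasure lborel (case i of (s, u) \<Rightarrow> {s<..<u}) \<partial>count_space C')"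
      unfolding W'_def by (subst emeasure_UN_countable) (use C' in auto)
    also have "\<dots> = (\<integral>\<^sup>+i. ennreal q * emeasure lborel (case i of (s, u) \<Rightarrow> {s<..<u}) \<partial>count_space C')"
      by (rule nn_integral_cmult[symmetric]) auto
    also have "\<dots> \<le> (\<integral>\<^sup>+i. emeasure \<mu> (case i of (s, u) \<Rightarrow> {s<..<u}) \<partial>count_space C')"
    proof (intro nn_integral_mono, clarsimp)
      fix s u assume "(s, u) \<in> C'"
      then have "s < u" "q * (u - s) \<le> h u - h s" using C'(2) by auto
      then show "ennreal q * emeasure lborel {s<..<u} \<le> emeasure \<mu> {s<..<u}"
        using pq by (simp add: \<mu> ennreal_mult' [symmetric] ennreal_leI)
    qed
    also have "\<dots> = emeasure \<mu> W'"
      unfolding W'_def by (rule emeasure_UN_countable[symmetric]) (use C' in \<open>auto simp: \<mu>_def\<close>)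
    also have "\<dots> \<le> emeasure \<mu> W"
      using W' W by (intro emeasure_mono) (auto simp: \<mu>_def)
    finally have 2: "ennreal q * emeasure lborel W' \<le> emeasure \<mu> W" .
    have neg: "negligible (E - W')"
    proof (rule negligible_subset)
      show "negligible ((E - W) \<union> (E \<inter> W - W'))"
        using C(4) C'(4) unfolding W_def W'_def by (intro negligible_Un) auto
    qed auto
    obtain T where T: "open T" "E - W' \<subseteq> T" "emeasure lborel T \<le> ennreal e"
    proof -
      have s: "E - W' \<in> sets lebesgue" using neg by (rule negligible_imp_sets)
      obtain T where T: "open T" "E - W' \<subseteq> T" "emeasure lebesgue (T - (E - W')) < ennreal e"
        using sets_lebesgue_outer_open[OF s e] by metis
      have "T = (T - (E - W')) \<union> (E - W')" using T(2) by blast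
      moreover have "emeasure lebesgue ((T - (E - W')) \<union> (E - W')) \<le> emeasure lebesgue (T - (E - W')) + emeasure lebesgue (E - W')"
        using T(1) s by (intro emeasure_subadditive) auto
      ultimately have "emeasure lebesgue T \<le> emeasure lebesgue (T - (E - W')) + emeasure lebesgue (E - W')"
        by simp
      moreover have "emeasure lebesgue (E - W') = 0"
        using neg negligible_iff_emeasure0 s by blast
      ultimately have "emeasure lebesgue T \<le> ennreal e" using T(3) by (simp add: order.strict_implies_order order_le_less_trans)
      then show thesis using that T by simp
    qed
    have "m \<le> emeasure lborel (W' \<union> T)"
      unfolding m_def \<G>_def using W' T by (intro INF_lower) auto
    also have "\<dots> \<le> emeasure lborel W' + emeasure lborel T"
      using W' T by (intro emeasure_subadditive) auto
    also have "\<dots> \<le> emeasure lborel W' + ennreal e" using T by (intro add_left_mono)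
    finally have "ennreal q * m \<le> ennreal q * (emeasure lborel W' + ennreal e)"
      by (intro mult_left_mono) auto
    also have "\<dots> \<le> ennreal p * (m + ennreal e) + ennreal q * ennreal e"
      using order_trans[OF 2 1] by (simp add: distrib_left add_right_mono)
    also have "\<dots> = ennreal p * m + ennreal (e * (p + q))"
      using pq e by (simp add: distrib_left ennreal_mult[symmetric] ennreal_plus[symmetric] mult.commute add.assoc del: ennreal_plus)
    finally show ?thesis .
  qed
  obtain m' where m': "m = ennreal m'" "0 \<le> m'"
    using m1 by (cases m) (auto simp: top_unique)
  have key': "q * m' \<le> p * m' + e * (p + q)" if "e > 0" for e
    using key[OF that] pq that m' by (simp add: ennreal_mult[symmetric] ennreal_plus[symmetric] del: ennreal_plus)
  have "m' = 0"
  proof (rule ccontr)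
    assume "m' \<noteq> 0"
    then have "m' > 0" using m' by simp
    have "(q - p) * m' \<le> e * (p + q)" if "e > 0" for e
      using key'[OF that] by (simp add: algebra_simps)
    from this[of "(q - p) * m' / (2 * (p + q))"]
    have "(q - p) * m' \<le> (q - p) * m' / (2 * (p + q)) * (p + q)"
      using pq \<open>m' > 0\<close> by simp
    also have "\<dots> = (q - p) * m' / 2" using pq by (simp add: divide_simps) 
    finally have "(q - p) * m' \<le> (q - p) * m' / 2" .
    then show False using pq \<open>m' > 0\<close> by simp
  qed
  show ?thesis
    unfolding negligible_outer
  proof (intro allI impI)
    fix e :: real assume "e > 0"
    then have "m < ennreal e" using m' \<open>m' = 0\<close> by simp
    then obtain G where G: "open G" "E \<subseteq> G" "emeasure lborel G < ennreal e"
      unfolding m_def INF_less_iff \<G>_def by blast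
    have "G \<in> lmeasurable"
      using G by (intro fmeasurableI) (auto intro: less_trans)
    moreover have "measure lebesgue G < e"
      using G \<open>e > 0\<close> by (cases "emeasure lborel G") (auto simp: measure_def ennreal_less_iff)
    ultimately show "\<exists>T. E \<subseteq> T \<and> T \<in> lmeasurable \<and> measure lebesgue T < e" using G by auto
  qed
qed

text \<open>Where the lower and the upper limit of the difference quotients differ, two rational slopes
  \<open>p < q\<close> fit between them, so the exceptional set is a countable union of the null sets above.\<close>
lemma monotone_lipschitz_differentiable_ae:
  fixes h :: "real \<Rightarrow> real"
  assumes mono: "\<And>x y. x \<le> y \<Longrightarrow> h x \<le> h y" and lip: "L-lipschitz_on UNIV h"
  shows "negligible {t \<in> {0<..<1}. \<not> h differentiable at t}"
proof -
  have cont: "continuous_on UNIV h" using lip by (rule lipschitz_on_continuous_on)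
  define R where "R = (\<lambda>s u. (h u - h s) / (u - s))"
  have R_sym: "R s u = R u s" for s u
    unfolding R_def by (metis minus_diff_eq minus_divide_divide)
  have R_nonneg: "0 \<le> R s u" for s u
    unfolding R_def using mono[of s u] mono[of u s] by (cases "s \<le> u") (auto intro: divide_nonneg_nonneg divide_nonpos_nonpos)
  have R_le: "R s u \<le> L" for s u
  proof -
    have "\<bar>h u - h s\<bar> \<le> L * \<bar>u - s\<bar>" using lipschitz_onD[OF lip, of u s] by (simp add: dist_real_def)
    then have "\<bar>R s u\<bar> \<le> L" using lipschitz_on_nonneg[OF lip] unfolding R_def by (cases "u = s") (auto simp: abs_div field_simps)
    then show ?thesis by simp
  qed
  define E where "E = (\<lambda>p q. {t \<in> {0<..<1}.
    (\<forall>d>0. \<exists>s u. s < t \<and> t < u \<and> u - s < d \<and> h u - h s \<le> p * (u - s)) \<and>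
    (\<forall>d>0. \<exists>s u. s < t \<and> t < u \<and> u - s < d \<and> q * (u - s) \<le> h u - h s)})"
  have E: "negligible (E p q)" if "0 \<le> p" "p < q" for p q
    by (rule slope_gap_negligible[OF mono cont that]) (auto simp: E_def)
  \<comment> \<open>A one-sided interval at \<open>t\<close> with a strict slope bound may be enlarged to contain \<open>t\<close> in its
    interior, because the slope is continuous in the end points.\<close>
  have enlarge: "\<exists>s u. s < t \<and> t < u \<and> u - s < d \<and> Q (R s u)"
    if op: "open {r. Q r}" and d: "0 < d" and fr: "\<exists>\<^sub>F u in at t. Q (R t u)" for t d Q
  proof -
    obtain w where w: "w \<noteq> t" "Q (R t w)" "dist w t < d / 2"
      using fr d unfolding frequently_def eventually_at by (metis UNIV_I half_gt_zero)
    have ct: "((\<lambda>x. R x w) \<longlongrightarrow> R t w) (at t)"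
      unfolding R_def using w(1) cont
      by (intro tendsto_intros) (auto simp: continuous_on_eq_continuous_at isCont_def)
    then have "\<forall>\<^sub>F x in at t. Q (R x w)"
      using topological_tendstoD[OF ct op] w(2) by simp
    then obtain e where e: "e > 0" "\<And>x. x \<noteq> t \<Longrightarrow> dist x t < e \<Longrightarrow> Q (R x w)"
      unfolding eventually_at by auto
    define k where "k = min e (d / 2) / 2"
    have k: "k > 0" "k < e" "k < d / 2" using e(1) d by (auto simp: k_def min_def)
    show ?thesis
    proof (cases "t < w")
      case True
      then show ?thesis using w k e(2)[of "t - k"]
        by (intro exI[of _ "t - k"] exI[of _ w]) (auto simp: dist_real_def)
    next
      case False
      then show ?thesis using w k e(2)[of "t + k"]
        by (intro exI[of _ w] exI[of _ "t + k"]) (auto simp: dist_real_def R_sym)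
    qed
  qed
  have "{t \<in> {0<..<1}. \<not> h differentiable at t} \<subseteq> (\<Union>p\<in>\<rat> \<inter> {0..}. \<Union>q\<in>\<rat> \<inter> {p<..}. E p q)"
  proof clarify
    fix t assume t: "t \<in> {0<..<1}" and nd: "\<not> h differentiable at t"
    define A where "A = Liminf (at t) (\<lambda>u. ereal (R t u))"
    define B where "B = Limsup (at t) (\<lambda>u. ereal (R t u))"
    have A0: "0 \<le> A" unfolding A_def
      by (intro Liminf_bounded always_eventually) (auto simp: R_nonneg)
    have AB: "A \<le> B" unfolding A_def B_def by (rule Liminf_le_Limsup) simp
    have BL: "B \<le> ereal L" unfolding B_def
      by (intro Limsup_bounded always_eventually) (auto simp: R_le)
    have "A \<noteq> B"
    proof
      assume "A = B"
      then obtain D where D: "A = ereal D" "B = ereal D" using A0 BL by (cases A) auto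
      then have "((\<lambda>u. ereal (R t u)) \<longlongrightarrow> ereal D) (at t)"
        unfolding A_def B_def by (intro Liminf_eq_Limsup) auto
      then have "((\<lambda>u. R t u) \<longlongrightarrow> D) (at t)" by simp
      then have "(h has_field_derivative D) (at t)"
        unfolding has_field_derivative_iff R_def .
      then show False using nd by (auto simp: real_differentiable_def)
    qed
    with AB have "A < B" by simp
    then obtain p' where p': "A < ereal p'" "ereal p' < B" by (metis ereal_dense2)
    then obtain q' where q': "ereal p' < ereal q'" "ereal q' < B" by (metis ereal_dense2)
    obtain p where p: "p \<in> \<rat>" "p' < p" "p < (p' + q') / 2"
      using Rats_dense_in_real[of p' "(p' + q') / 2"] q' by auto
    obtain q where q: "q \<in> \<rat>" "(p' + q') / 2 < q" "q < q'"
      using Rats_dense_in_real[of "(p' + q') / 2" q'] q' by auto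
    have "0 \<le> p" using A0 p' p by (metis ereal_less_eq(3) less_eq_real_def less_le_trans order_less_imp_le zero_ereal_def order_le_less_trans)
    have "\<exists>\<^sub>F u in at t. R t u < p"
    proof (rule ccontr)
      assume "\<not> ?thesis"
      then have "\<forall>\<^sub>F u in at t. ereal p \<le> ereal (R t u)" by (simp add: not_frequently not_less)
      then have "ereal p \<le> A" unfolding A_def by (rule Liminf_bounded)
      then show False using p' p by (metis ereal_less_eq(3) leD less_eq_real_def order_trans)
    qed
    from enlarge[OF _ _ this]
    have low: "\<exists>s u. s < t \<and> t < u \<and> u - s < d \<and> h u - h s \<le> p * (u - s)" if "d > 0" for d
      using that open_lessThan[of p] unfolding lessThan_def R_def
      by (force simp: divide_less_eq)
    have "\<exists>\<^sub>F u in at t. q < R t u"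
    proof (rule ccontr)
      assume "\<not> ?thesis"
      then have "\<forall>\<^sub>F u in at t. ereal (R t u) \<le> ereal q" by (simp add: not_frequently not_less)
      then have "B \<le> ereal q" unfolding B_def by (rule Limsup_bounded)
      then show False using q' q by (metis ereal_less_eq(3) leD less_eq_real_def order_trans)
    qed
    from enlarge[OF _ _ this]
    have high: "\<exists>s u. s < t \<and> t < u \<and> u - s < d \<and> q * (u - s) \<le> h u - h s" if "d > 0" for d
      using that open_greaterThan[of q] unfolding greaterThan_def R_def
      by (force simp: less_divide_eq)
    have "t \<in> E p q" unfolding E_def using t low high by auto
    then show "t \<in> (\<Union>p\<in>\<rat> \<inter> {0..}. \<Union>q\<in>\<rat> \<inter> {p<..}. E p q)"
      using \<open>0 \<le> p\<close> p q by force
  qed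
  moreover have "negligible (\<Union>p\<in>\<rat> \<inter> {0..}. \<Union>q\<in>\<rat> \<inter> {p<..}. E p q)"
    using E by (intro negligible_countable_Union countable_image) (auto intro!: negligible_countable_Union countable_image countable_Int1 countable_rat)
  ultimately show ?thesis by (rule negligible_subset[rotated])
qed

text \<open>Rademacher's theorem for paths.  Adding a linear function with a large slope makes each
  coordinate monotone; the values outside \<open>{0..1}\<close> are supplied by clamping.\<close>

lemma lipschitz_path_differentiable_ae:
  fixes \<gamma> :: "real \<Rightarrow> 'a::euclidean_space"
  assumes lip: "L-lipschitz_on {0..1} \<gamma>"
  shows "negligible {t \<in> {0..1}. \<not> (\<gamma> has_vector_derivative velocity \<gamma> t) (at t within {0..1})}"
proof -
  define K where "K = (\<lambda>t::real. max 0 (min 1 t))"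
  have L0: "0 \<le> L" using lip by (rule lipschitz_on_nonneg)
  define h where "h = (\<lambda>i t. \<gamma> (K t) \<bullet> i + L * t)"
  have b: "\<bar>\<gamma> (K x) \<bullet> i - \<gamma> (K y) \<bullet> i\<bar> \<le> L * \<bar>x - y\<bar>" if "i \<in> Basis" for i x y
  proof -
    have "\<bar>(\<gamma> (K x) - \<gamma> (K y)) \<bullet> i\<bar> \<le> norm (\<gamma> (K x) - \<gamma> (K y))" using that by (rule Basis_le_norm)
    also have "\<dots> \<le> L * \<bar>K x - K y\<bar>"
      using lipschitz_onD[OF lip, of "K x" "K y"] by (auto simp: K_def dist_norm)
    also have "\<dots> \<le> L * \<bar>x - y\<bar>" using L0 by (intro mult_left_mono) (auto simp: K_def)
    finally show ?thesis by (simp add: inner_diff_left)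
  qed
  have neg: "negligible {t \<in> {0<..<1}. \<not> h i differentiable at t}" if i: "i \<in> Basis" for i
  proof (rule monotone_lipschitz_differentiable_ae)
    show "h i x \<le> h i y" if "x \<le> y" for x y
      using b[OF i, of x y] that by (auto simp: h_def algebra_simps abs_le_iff)
    show "(2 * L)-lipschitz_on UNIV (h i)"
    proof (rule lipschitz_onI)
      fix x y :: real
      have "\<bar>h i x - h i y\<bar> \<le> \<bar>\<gamma> (K x) \<bullet> i - \<gamma> (K y) \<bullet> i\<bar> + \<bar>L * (x - y)\<bar>"
        by (simp add: h_def algebra_simps)
      also have "\<dots> \<le> L * \<bar>x - y\<bar> + L * \<bar>x - y\<bar>" using b[OF i, of x y] L0 by (simp add: abs_mult)
      finally show "dist (h i x) (h i y) \<le> 2 * L * dist x y" by (simp add: dist_real_def)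
    qed (use L0 in auto)
  qed
  have "{t \<in> {0..1}. \<not> (\<gamma> has_vector_derivative velocity \<gamma> t) (at t within {0..1})}
      \<subseteq> {0, 1} \<union> (\<Union>i\<in>Basis. {t \<in> {0<..<1}. \<not> h i differentiable at t})"
  proof (rule subsetI, rule ccontr)
    fix t assume t: "t \<in> {t \<in> {0..1}. \<not> (\<gamma> has_vector_derivative velocity \<gamma> t) (at t within {0..1})}"
      and nt: "t \<notin> {0, 1} \<union> (\<Union>i\<in>Basis. {t \<in> {0<..<1}. \<not> h i differentiable at t})"
    then have t01: "0 < t" "t < 1" by auto
    have "(\<lambda>x. \<gamma> x \<bullet> i) differentiable (at t within {0..1})" if i: "i \<in> Basis" for i
    proof -
      have "h i differentiable at t" using nt t01 i by auto
      then have "(\<lambda>x. h i x - L * x) differentiable at t"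
        by (intro differentiable_diff differentiable_mult differentiable_const differentiable_ident)
      then have "(\<lambda>x. \<gamma> (K x) \<bullet> i) differentiable (at t within {0..1})"
        by (simp add: h_def differentiable_at_withinI)
      then show ?thesis
        by (rule differentiable_transform_within[of _ _ _ 1]) (use t01 in \<open>auto simp: K_def\<close>)
    qed
    then have "\<gamma> differentiable (at t within {0..1})"
      by (subst differentiable_componentwise_within) auto
    then show False using t by (auto simp: velocity_def vector_derivative_works)
  qed
  moreover have "negligible ({0, 1} \<union> (\<Union>i\<in>Basis. {t \<in> {0<..<1}. \<not> h i differentiable at t}))"
    using neg by (intro negligible_Un negligible_Union) auto
  ultimately show ?thesis by (rule negligible_subset[rotated])
qed

section \<open>Sums along lists and piecewise linear paths\<close>
fun chain :: "('a \<Rightarrow> 'a \<Rightarrow> real) \<Rightarrow> 'a list \<Rightarrow> real" where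
  "chain e (x # y # zs) = e x y + chain e (y # zs)"
| "chain e _ = 0"

lemma chain_conv_sum:
  "length xs = Suc m \<Longrightarrow> chain e xs = (\<Sum>i<m. e (xs ! i) (xs ! Suc i))"
proof (induction e xs arbitrary: m rule: chain.induct)
  case (1 e x y zs)
  then obtain k where k: "m = Suc k" "length (y # zs) = Suc k" by (cases m) auto
  show ?case using 1(1)[OF k(2)] k(1) by (simp add: sum.lessThan_Suc_shift del: sum.lessThan_Suc)
qed auto

lemma chain_append: "chain e (xs @ y # zs) = chain e (xs @ [y]) + chain e (y # zs)"
proof (induction xs)
  case (Cons x xs)
  then show ?case by (cases xs) auto
qed simp

lemma chain_mono:
  assumes "\<And>x y. x \<in> set xs \<Longrightarrow> y \<in> set xs \<Longrightarrow> e x y \<le> e' x y"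
  shows "chain e xs \<le> chain e' xs"
  using assms by (induction e xs rule: chain.induct) (auto intro!: add_mono)

lemma chain_nonneg:
  assumes "\<And>x y. x \<in> set xs \<Longrightarrow> y \<in> set xs \<Longrightarrow> 0 \<le> e x y"
  shows "0 \<le> chain e xs"
  using assms by (induction e xs rule: chain.induct) (auto intro!: add_nonneg_nonneg)

lemma chain_cmult: "chain (\<lambda>x y. k * e x y) xs = k * chain e xs"
  by (induction e xs rule: chain.induct) (auto simp: distrib_left)

lemma chain_add: "chain (\<lambda>x y. e x y + e' x y) xs = chain e xs + chain e' xs"
  by (induction e xs rule: chain.induct) auto

lemma chain_remdups_adj:
  assumes "\<And>x. e x x = 0"
  shows "chain e (remdups_adj xs) = chain e xs"
proof (induction xs rule: remdups_adj.induct)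
  case (3 x y xs)
  obtain zs where zs: "remdups_adj (y # xs) = y # zs" by (metis remdups_adj_Cons_alt)
  show ?case
  proof (cases "x = y")
    case True
    then show ?thesis using 3 assms by simp
  next
    case False
    then show ?thesis using 3(2)[OF False] zs by simp
  qed
qed auto

lemma chain_triangle:
  assumes "\<And>x y z. x \<in> set xs \<Longrightarrow> y \<in> set xs \<Longrightarrow> z \<in> set xs \<Longrightarrow> e x z \<le> e x y + e y z"
    and "\<And>x. e x x = 0" and "xs \<noteq> []"
  shows "e (hd xs) (last xs) \<le> chain e xs"
  using assms
proof (induction e xs rule: chain.induct)
  case (1 e x y zs)
  have "e y (last (y # zs)) \<le> chain e (y # zs)"
    using 1(1) 1(2,3) by (metis list.sel(1) list.set_intros(2) list.distinct(1))
  moreover have "e x (last (y # zs)) \<le> e x y + e y (last (y # zs))"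
    using 1(2)[of x y "last (y # zs)"] last_in_set[of "y # zs"] by auto
  ultimately show ?case by simp
qed auto

lemma has_integral_unit_partition:
  fixes g :: "real \<Rightarrow> real"
  assumes N: "0 < N"
    and g: "\<And>i. i < N \<Longrightarrow> (g has_integral I i) {real i / real N..real (Suc i) / real N}"
  shows "(g has_integral (\<Sum>i<N. I i)) {0..1}"
proof -
  have "(g has_integral (\<Sum>i<k. I i)) {0..real k / real N}" if "k \<le> N" for k
    using that
  proof (induction k)
    case (Suc k)
    have "(g has_integral ((\<Sum>i<k. I i) + I k)) {0..real (Suc k) / real N}"
      by (rule has_integral_combine[of _ "real k / real N"]) (use Suc g N in \<open>auto simp: divide_right_mono\<close>)
    then show ?case by simp
  qed (simp add: has_integral_refl)
  from this[of N] show ?thesis using N by simp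
qed

lemma sum_blocks:
  fixes g :: "nat \<Rightarrow> 'b::comm_monoid_add"
  shows "(\<Sum>k<N * M. g k) = (\<Sum>i<N. \<Sum>j<M. g (i * M + j))"
proof -
  have "sum g {i * M..<i * M + M} = (\<Sum>j<M. g (i * M + j))" for i
    using sum.shift_bounds_nat_ivl[of g 0 "i * M" M] by (simp add: atLeast0LessThan add.commute)
  then show ?thesis using sum.nat_group[of g M N] by simp
qed

lemma unit_interval_cell:
  assumes "0 < m" "0 \<le> t" "t \<le> 1"
  obtains i where "i < m" "real i / real m \<le> t" "t \<le> real (Suc i) / real m"
proof -
  define i where "i = min (nat \<lfloor>real m * t\<rfloor>) (m - 1)"
  have "i < m" using assms by (auto simp: i_def)
  moreover have "real i \<le> real m * t"
    using assms by (auto simp: i_def min_def) linarith+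
  moreover have "real m * t \<le> real (Suc i)"
  proof (cases "nat \<lfloor>real m * t\<rfloor> \<le> m - 1")
    case True
    then show ?thesis using assms by (simp add: i_def) linarith
  next
    case False
    then have "real (Suc i) = real m" using assms by (simp add: i_def)
    then show ?thesis using assms by (simp add: mult_left_le)
  qed
  ultimately show thesis using that[of i] assms by (auto simp: field_simps)
qed

lemma linear_path_in_segment:
  assumes m: "length vs = Suc m" and i: "i < m"
    and t: "real i / real m \<le> t" "t \<le> real (Suc i) / real m"
  shows "linear_path vs t \<in> closed_segment (vs ! i) (vs ! Suc i)"
proof -
  have "real i \<le> real m * t" "real m * t \<le> real i + 1"
    using i t by (auto simp: field_simps)
  then show ?thesis unfolding closed_segment_def linear_path_eq[OF m i t]
    by (intro CollectI exI[of _ "real m * t - real i"]) auto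
qed

lemma linear_path_node:
  assumes m: "length vs = Suc m" and "0 < m" and i: "i \<le> m"
  shows "linear_path vs (real i / real m) = vs ! i"
proof (cases "i = m")
  case True
  then show ?thesis using assms by (subst linear_path_eq[OF m, of "m - 1"]) (auto simp: field_simps of_nat_diff)
next
  case False
  then show ?thesis using assms by (subst linear_path_eq[OF m, of i]) (auto simp: field_simps)
qed

lemma linear_path_lipschitz:
  fixes vs :: "'a::euclidean_space list"
  assumes m: "length vs = Suc m" "0 < m" and h: "0 \<le> h"
    and step: "\<And>i. i < m \<Longrightarrow> dist (vs ! i) (vs ! Suc i) \<le> h"
  shows "(real m * h)-lipschitz_on {0..1} (linear_path vs)"
proof (rule lipschitz_on_closed_Union[where I = "{..<m}" and U = "\<lambda>i. {real i / real m..real (Suc i) / real m}"])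
  fix i assume i: "i \<in> {..<m}"
  show "(real m * h)-lipschitz_on {real i / real m..real (Suc i) / real m} (linear_path vs)"
  proof (rule lipschitz_onI)
    fix x y assume xy: "x \<in> {real i / real m..real (Suc i) / real m}" "y \<in> {real i / real m..real (Suc i) / real m}"
    have "linear_path vs x - linear_path vs y = (real m * (x - y)) *\<^sub>R (vs ! Suc i - vs ! i)"
      using xy i m by (simp add: linear_path_eq[OF m(1), of i]) (simp add: algebra_simps)
    then have "dist (linear_path vs x) (linear_path vs y) = real m * dist x y * dist (vs ! i) (vs ! Suc i)"
      by (simp add: dist_norm abs_mult norm_minus_commute)
    also have "\<dots> \<le> real m * dist x y * h" using step[of i] i by (intro mult_left_mono) auto
    finally show "dist (linear_path vs x) (linear_path vs y) \<le> real m * h * dist x y" by (simp add: mult_ac)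
  qed (use h in auto)
next
  show "{0..1} \<subseteq> (\<Union>i\<in>{..<m}. {real i / real m..real (Suc i) / real m})"
  proof
    fix t :: real assume "t \<in> {0..1}"
    then show "t \<in> (\<Union>i\<in>{..<m}. {real i / real m..real (Suc i) / real m})"
      using unit_interval_cell[OF m(2), of t] by (metis UN_I atLeastAtMost_iff lessThan_iff)
  qed
qed (use h in auto)

lemma linear_path_in_lip_paths:
  assumes "convex D" "2 \<le> length vs" "set vs \<subseteq> D"
  shows "linear_path vs \<in> lip_paths D (hd vs) (last vs)"
proof -
  obtain m where m: "length vs = Suc m" "0 < m"
    using assms(2) by (cases "length vs") auto
  have ne: "vs \<noteq> []" using m by auto
  have "\<exists>C. C-lipschitz_on {0..1} (linear_path vs)"
  proof
    show "(real m * chain dist vs)-lipschitz_on {0..1} (linear_path vs)"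
    proof (rule linear_path_lipschitz[OF m])
      show "dist (vs ! i) (vs ! Suc i) \<le> chain dist vs" if "i < m" for i
        unfolding chain_conv_sum[OF m(1)] using that by (intro member_le_sum) auto
    qed (auto intro: chain_nonneg)
  qed
  moreover have "path_image (linear_path vs) \<subseteq> D"
  proof (clarsimp simp: path_image_def)
    fix t :: real assume "0 \<le> t" "t \<le> 1"
    then obtain i where i: "i < m" "real i / real m \<le> t" "t \<le> real (Suc i) / real m"
      using unit_interval_cell[OF m(2)] by metis
    have "vs ! i \<in> D" "vs ! Suc i \<in> D" using assms(3) i m by auto
    then show "linear_path vs t \<in> D"
      using linear_path_in_segment[OF m(1) i] assms(1) closed_segment_subset by blast
  qed
  moreover have "pathstart (linear_path vs) = hd vs"
    using linear_path_node[OF m, of 0] ne by (simp add: pathstart_def hd_conv_nth)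
  moreover have "pathfinish (linear_path vs) = last vs"
    using linear_path_node[OF m, of m] ne m by (simp add: pathfinish_def last_conv_nth)
  ultimately show ?thesis by (simp add: lip_paths_def)
qed

section \<open>Riemann sums of the cost\<close>

text \<open>What the conditions on the integrand amount to for \<open>p = 1\<close>: in the second variable \<open>f\<close> is sublinear
  and comparable to the norm.  The constants are parameters because the estimates below must be
  uniform over curves.\<close>
locale finsler_integrand =
  fixes D :: "'a::euclidean_space set" and f :: "'a \<Rightarrow> 'a \<Rightarrow> real" and m1 m2 c :: real
  assumes convex_D: "convex D" and compact_D: "compact D"
    and f_cont: "continuous_on (D \<times> UNIV) (\<lambda>(x, v). f x v)"
    and f_add: "\<And>x u v. x \<in> D \<Longrightarrow> f x (u + v) \<le> f x u + f x v"
    and f_hom: "\<And>x s v. x \<in> D \<Longrightarrow> 0 \<le> s \<Longrightarrow> f x (s *\<^sub>R v) = s * f x v"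
    and f_lower: "\<And>x v. x \<in> D \<Longrightarrow> m1 * norm v \<le> f x v"
    and f_upper: "\<And>x v. x \<in> D \<Longrightarrow> f x v \<le> m2 * norm v"
    and f_lip: "\<And>x y v. x \<in> D \<Longrightarrow> y \<in> D \<Longrightarrow> \<bar>f x v - f y v\<bar> \<le> c * norm (x - y) * norm v"
    and m1_pos: "0 < m1" and m2_pos: "0 < m2" and c_nonneg: "0 \<le> c"
begin

lemma f_nonneg: "x \<in> D \<Longrightarrow> 0 \<le> f x v"
  using f_lower[of x v] m1_pos by (meson mult_nonneg_nonneg norm_ge_zero order.strict_implies_order order_trans)

lemma f_zero [simp]: "x \<in> D \<Longrightarrow> f x 0 = 0"
  using f_hom[of x 0 0] by simp

lemma f_sum: "x \<in> D \<Longrightarrow> f x (\<Sum>j<(n::nat). v j) \<le> (\<Sum>j<n. f x (v j))"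
proof (induction n)
  case (Suc n)
  then show ?case using f_add[of x "\<Sum>j<n. v j" "v n"] by simp
qed simp

lemma f_tendsto:
  assumes "(x \<longlongrightarrow> x0) F" "(v \<longlongrightarrow> v0) F" "x0 \<in> D" "\<And>i. x i \<in> D"
  shows "((\<lambda>i. f (x i) (v i)) \<longlongrightarrow> f x0 v0) F"
proof -
  have "((\<lambda>i. case (x i, v i) of (x, v) \<Rightarrow> f x v) \<longlongrightarrow> (case (x0, v0) of (x, v) \<Rightarrow> f x v)) F"
    by (rule continuous_on_tendsto_compose[OF f_cont]) (use assms in \<open>auto intro: tendsto_Pair\<close>)
  then show ?thesis by simp
qed

text \<open>Unlike \<^const>\<open>cost\<close>, this quantity involves only point values of the curve.\<close>

definition riemann :: "(real \<Rightarrow> 'a) \<Rightarrow> nat \<Rightarrow> real" where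
  "riemann \<gamma> N = (\<Sum>i<N. f (\<gamma> (real i / real N)) (\<gamma> (real (Suc i) / real N) - \<gamma> (real i / real N)))"

text \<open>By homogeneity the Riemann sum is the integral of \<open>G N\<close>, which evaluates \<open>f\<close> at a difference
  quotient of \<open>\<gamma>\<close> over the cell \<open>[s, u]\<close> of length \<open>1 / N\<close> around \<open>t\<close>.  At points of differentiability
  these quotients converge to the velocity, and they are bounded by the Lipschitz constant, so
  dominated convergence applies.\<close>
lemma riemann_tendsto_cost:
  assumes lip: "L-lipschitz_on {0..1} \<gamma>" and im: "\<gamma> ` {0..1} \<subseteq> D"
  shows "riemann \<gamma> \<longlonglongrightarrow> cost f \<gamma>"
proof -
  \<comment> \<open>The cell of \<open>t = 1\<close> would reach beyond the interval.\<close>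
  define B where "B = insert 1 {t \<in> {0..1}. \<not> (\<gamma> has_vector_derivative velocity \<gamma> t) (at t within {0..1})}"
  have B: "negligible B"
    unfolding B_def using lipschitz_path_differentiable_ae[OF lip] by simp
  define s where "s = (\<lambda>N t. real_of_int \<lfloor>real N * t\<rfloor> / real N)"
  define u where "u = (\<lambda>N t. (real_of_int \<lfloor>real N * t\<rfloor> + 1) / real N)"
  define G where "G = (\<lambda>N t. f (\<gamma> (s N t)) (real N *\<^sub>R (\<gamma> (u N t) - \<gamma> (s N t))))"
  have su: "0 \<le> s N t" "s N t \<le> t" "t \<le> u N t" "u N t \<le> 1" "u N t - s N t = 1 / real N"
    if "0 \<le> t" "t < 1" "0 < N" for N t
  proof -
    show "0 \<le> s N t" using that by (simp add: s_def)
    have "real_of_int \<lfloor>real N * t\<rfloor> \<le> real N * t" "real N * t \<le> real_of_int \<lfloor>real N * t\<rfloor> + 1" by linarith+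
    then show "s N t \<le> t" "t \<le> u N t" using that by (auto simp: s_def u_def field_simps)
    have "real N * t < real N" using that by simp
    then have "\<lfloor>real N * t\<rfloor> < int N" by (simp add: floor_less_iff)
    then have "real_of_int \<lfloor>real N * t\<rfloor> + 1 \<le> real N" by linarith
    then show "u N t \<le> 1" using that by (simp add: u_def)
    show "u N t - s N t = 1 / real N" by (simp add: s_def u_def diff_divide_distrib[symmetric])
  qed
  have stepint: "(G N has_integral riemann \<gamma> N) {0..1}" if N: "0 < N" for N
    unfolding riemann_def
  proof (rule has_integral_unit_partition[OF N])
    fix i assume i: "i < N"
    define a where "a = \<gamma> (real i / real N)"
    define d where "d = \<gamma> (real (Suc i) / real N) - a"
    have aD: "a \<in> D" using im i unfolding a_def by auto
    have "((\<lambda>_. f a (real N *\<^sub>R d)) has_integral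
        (measure lborel {real i / real N..real (Suc i) / real N} *\<^sub>R f a (real N *\<^sub>R d))) {real i / real N..real (Suc i) / real N}"
      by (rule has_integral_const_real)
    also have "measure lborel {real i / real N..real (Suc i) / real N} *\<^sub>R f a (real N *\<^sub>R d) = f a d"
      using N f_hom[OF aD, of "real N" d] by (simp add: divide_right_mono diff_divide_distrib[symmetric])
    finally have "((\<lambda>_. f a (real N *\<^sub>R d)) has_integral f a d) {real i / real N..real (Suc i) / real N}" .
    then have "(G N has_integral f a d) {real i / real N..real (Suc i) / real N}"
    proof (rule has_integral_spike_finite[of "{real (Suc i) / real N}", rotated 2])
      fix t assume t: "t \<in> {real i / real N..real (Suc i) / real N} - {real (Suc i) / real N}"
      then have "real i \<le> real N * t" "real N * t < real i + 1" using N by (auto simp: field_simps)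
      then have "\<lfloor>real N * t\<rfloor> = int i" by (intro floor_unique) auto
      then show "G N t = f a (real N *\<^sub>R d)" by (simp add: G_def s_def u_def a_def d_def add.commute)
    qed auto
    then show "(G N has_integral f (\<gamma> (real i / real N)) (\<gamma> (real (Suc i) / real N) - \<gamma> (real i / real N)))
      {real i / real N..real (Suc i) / real N}" by (simp add: a_def d_def)
  qed
  define G' where "G' = (\<lambda>N t. if t \<in> B then 0 else G (Suc N) t)"
  define g where "g = (\<lambda>t. if t \<in> B then 0 else f (\<gamma> t) (velocity \<gamma> t))"
  have int': "(G' N has_integral riemann \<gamma> (Suc N)) {0..1}" for N
    by (rule has_integral_spike[OF B _ stepint[of "Suc N"]]) (auto simp: G'_def)
  have bound: "norm (G' N t) \<le> m2 * L" if "t \<in> {0..1}" for N t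
  proof (cases "t \<in> B")
    case True
    then show ?thesis using m2_pos lipschitz_on_nonneg[OF lip] by (simp add: G'_def)
  next
    case False
    then have t: "0 \<le> t" "t < 1" using that by (auto simp: B_def)
    note su = su[OF t, of "Suc N"]
    have sD: "\<gamma> (s (Suc N) t) \<in> D" using im su t by auto
    have "norm (\<gamma> (u (Suc N) t) - \<gamma> (s (Suc N) t)) \<le> L * (1 / real (Suc N))"
      using lipschitz_onD[OF lip, of "u (Suc N) t" "s (Suc N) t"] su t by (auto simp: dist_norm)
    then have nb: "norm (real (Suc N) *\<^sub>R (\<gamma> (u (Suc N) t) - \<gamma> (s (Suc N) t))) \<le> L"
      by (simp add: pos_le_divide_eq mult.commute del: of_nat_Suc)
    have "G (Suc N) t \<le> m2 * norm (real (Suc N) *\<^sub>R (\<gamma> (u (Suc N) t) - \<gamma> (s (Suc N) t)))"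
      unfolding G_def by (rule f_upper[OF sD])
    also have "\<dots> \<le> m2 * L" using nb m2_pos by (intro mult_left_mono) auto
    finally show ?thesis using False f_nonneg[OF sD] by (simp add: G'_def G_def)
  qed
  have conv: "(\<lambda>N. G' N t) \<longlonglongrightarrow> g t" if "t \<in> {0..1}" for t
  proof (cases "t \<in> B")
    case False
    then have t: "0 \<le> t" "t < 1" and der: "(\<gamma> has_vector_derivative velocity \<gamma> t) (at t within {0..1})"
      using that by (auto simp: B_def)
    note su = su[OF t]
    have s01: "s (Suc N) t \<in> {0..1}" for N using su(1,2)[of "Suc N"] t by auto
    have inv: "(\<lambda>N. 1 / real (Suc N)) \<longlonglongrightarrow> 0" by (rule LIMSEQ_Suc) (simp add: lim_1_over_n)
    have "(\<lambda>N. s (Suc N) t) \<longlonglongrightarrow> t"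
    proof (rule tendsto_sandwich[OF _ _ _ tendsto_const])
      show "(\<lambda>N. t - 1 / real (Suc N)) \<longlonglongrightarrow> t" using tendsto_diff[OF tendsto_const inv, of t] by simp
      show "\<forall>\<^sub>F N in sequentially. t - 1 / real (Suc N) \<le> s (Suc N) t"
      proof (rule always_eventually, rule allI)
        show "t - 1 / real (Suc N) \<le> s (Suc N) t" for N using su(3,5)[of "Suc N"] by simp
      qed
      show "\<forall>\<^sub>F N in sequentially. s (Suc N) t \<le> t" using su(2) by (intro always_eventually) auto
    qed
    then have cs: "(\<lambda>N. \<gamma> (s (Suc N) t)) \<longlonglongrightarrow> \<gamma> t"
      by (rule continuous_on_tendsto_compose[OF lipschitz_on_continuous_on[OF lip]])
        (use t s01 in \<open>auto intro!: always_eventually\<close>)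
    have cv: "(\<lambda>N. real (Suc N) *\<^sub>R (\<gamma> (u (Suc N) t) - \<gamma> (s (Suc N) t))) \<longlonglongrightarrow> velocity \<gamma> t"
    proof (rule metric_LIMSEQ_I)
      fix e :: real assume e: "e > 0"
      define v where "v = velocity \<gamma> t"
      obtain d where d: "d > 0" "\<And>y. y \<in> {0..1} \<Longrightarrow> norm (y - t) < d \<Longrightarrow>
          norm (\<gamma> y - \<gamma> t - (y - t) *\<^sub>R v) \<le> e / 2 * norm (y - t)"
        using der e unfolding has_vector_derivative_def has_derivative_within_alt v_def
        by (metis half_gt_zero)
      obtain N0 where N0: "1 / real (Suc N0) < d" using d(1) nat_approx_posE by (metis inverse_eq_divide)
      show "\<exists>no. \<forall>n\<ge>no. dist (real (Suc n) *\<^sub>R (\<gamma> (u (Suc n) t) - \<gamma> (s (Suc n) t))) (velocity \<gamma> t) < e"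
      proof (intro exI allI impI)
        fix n assume "n \<ge> N0"
        then have "1 / real (Suc n) \<le> 1 / real (Suc N0)" by (intro divide_left_mono) auto
        then have nd: "1 / real (Suc n) < d" using N0 by simp
        define p q where "p = u (Suc n) t" and "q = s (Suc n) t"
        have pq: "0 \<le> q" "q \<le> t" "t \<le> p" "p \<le> 1" "p - q = 1 / real (Suc n)"
          unfolding p_def q_def using su[of "Suc n"] by auto
        have P: "norm (\<gamma> p - \<gamma> t - (p - t) *\<^sub>R v) \<le> e / 2 * (p - t)"
          using d(2)[of p] pq nd t by simp
        have Q: "norm (\<gamma> q - \<gamma> t - (q - t) *\<^sub>R v) \<le> e / 2 * (t - q)"
          using d(2)[of q] pq nd t by simp
        have "norm ((\<gamma> p - \<gamma> q) - (p - q) *\<^sub>R v)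
            = norm ((\<gamma> p - \<gamma> t - (p - t) *\<^sub>R v) - (\<gamma> q - \<gamma> t - (q - t) *\<^sub>R v))"
          by (simp add: algebra_simps)
        also have "\<dots> \<le> e / 2 * (p - t) + e / 2 * (t - q)"
          using norm_triangle_ineq4 P Q by (meson add_mono order_trans)
        also have "\<dots> = e / 2 * (p - q)" by (simp add: field_simps)
        also have "\<dots> = e / 2 * (1 / real (Suc n))" by (simp only: pq(5))
        finally have "norm ((\<gamma> p - \<gamma> q) - (1 / real (Suc n)) *\<^sub>R v) \<le> e / 2 * (1 / real (Suc n))"
          using pq(5) by simp
        then have "real (Suc n) * norm ((\<gamma> p - \<gamma> q) - (1 / real (Suc n)) *\<^sub>R v) \<le> e / 2"
          by (simp add: pos_le_divide_eq mult.commute del: of_nat_Suc)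
        moreover have "real (Suc n) *\<^sub>R (\<gamma> p - \<gamma> q) - v = real (Suc n) *\<^sub>R ((\<gamma> p - \<gamma> q) - (1 / real (Suc n)) *\<^sub>R v)"
          by (simp add: scaleR_diff_right del: of_nat_Suc)
        ultimately have "norm (real (Suc n) *\<^sub>R (\<gamma> p - \<gamma> q) - v) \<le> e / 2"
          by (simp del: of_nat_Suc)
        then show "dist (real (Suc n) *\<^sub>R (\<gamma> (u (Suc n) t) - \<gamma> (s (Suc n) t))) (velocity \<gamma> t) < e"
          using e unfolding dist_norm v_def p_def q_def by linarith
      qed
    qed
    have "(\<lambda>N. G (Suc N) t) \<longlonglongrightarrow> f (\<gamma> t) (velocity \<gamma> t)"
      unfolding G_def
      by (rule f_tendsto[OF cs cv]) (use t s01 im in \<open>auto simp: image_subset_iff\<close>)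
    then show ?thesis using False by (simp add: G'_def g_def)
  qed (simp add: G'_def g_def)
  have "\<And>N. G' N integrable_on {0..1}" using int' by (auto simp: has_integral_iff)
  then have lim: "(\<lambda>N. integral {0..1} (G' N)) \<longlonglongrightarrow> integral {0..1} g"
    by (rule dominated_convergence(2)[of G' "{0..1}" "\<lambda>_. m2 * L" g])
      (use bound conv in \<open>auto intro: integrable_const_ivl\<close>)
  have "integral {0..1} g = cost f \<gamma>"
    unfolding cost_def by (rule integral_spike[OF B]) (auto simp: g_def)
  moreover have "integral {0..1} (G' N) = riemann \<gamma> (Suc N)" for N
    using int' by (rule integral_unique)
  ultimately have "(\<lambda>N. riemann \<gamma> (Suc N)) \<longlonglongrightarrow> cost f \<gamma>"
    using lim by simp
  then show ?thesis by (rule LIMSEQ_imp_Suc)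
qed


text \<open>Refining the partition can lower the sum only through the change of the frozen argument:
  for a fixed first argument, sublinearity makes one long chord cheaper than the many short ones.\<close>
lemma riemann_refine:
  assumes lip: "L-lipschitz_on {0..1} \<gamma>" and im: "\<gamma> ` {0..1} \<subseteq> D" and N: "0 < N" and M: "0 < M"
  shows "riemann \<gamma> N \<le> riemann \<gamma> (N * M) + c * L\<^sup>2 / N"
proof -
  have L0: "0 \<le> L" using lip by (rule lipschitz_on_nonneg)
  define p where "p = (\<lambda>i j. \<gamma> (real (i * M + j) / real (N * M)))"
  have p0: "p i 0 = \<gamma> (real i / real N)" for i using M by (simp add: p_def)
  have pM: "p i M = \<gamma> (real (Suc i) / real N)" for i
  proof -
    have "real (i * M + M) / real (N * M) = real (Suc i) / real N"
      using M by (simp add: divide_simps) (simp add: algebra_simps)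
    then show ?thesis unfolding p_def by simp
  qed
  have in01: "real (i * M + j) / real (N * M) \<in> {0..1}" if "i < N" "j \<le> M" for i j
  proof -
    have "i * M + j \<le> (N - 1) * M + M" using that by (intro add_mono mult_right_mono) auto
    also have "\<dots> = N * M" using N by (metis Suc_diff_1 add.commute mult_Suc)
    finally have "real (i * M + j) \<le> real (N * M)" by (simp only: of_nat_le_iff)
    then show ?thesis using N M by simp
  qed
  have pD: "p i j \<in> D" if "i < N" "j \<le> M" for i j
    using in01[OF that] im unfolding p_def by auto
  have dist_p: "norm (p i j - p i k) \<le> L * (\<bar>real j - real k\<bar> / real (N * M))" if "i < N" "j \<le> M" "k \<le> M" for i j k
  proof -
    have "dist (p i j) (p i k) \<le> L * dist (real (i * M + j) / real (N * M)) (real (i * M + k) / real (N * M))"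
      unfolding p_def by (rule lipschitz_onD[OF lip]) (use in01 that in blast)+
    also have "dist (real (i * M + j) / real (N * M)) (real (i * M + k) / real (N * M)) = \<bar>real j - real k\<bar> / real (N * M)"
      using N M by (simp add: dist_real_def diff_divide_distrib[symmetric] abs_div del: of_nat_mult)
    finally show ?thesis by (simp add: dist_norm)
  qed
  have cell: "f (p i 0) (p i M - p i 0) \<le> (\<Sum>j<M. f (p i j) (p i (Suc j) - p i j)) + c * L\<^sup>2 / (real N)\<^sup>2"
    if i: "i < N" for i
  proof -
    have tele: "p i M - p i 0 = (\<Sum>j<M. p i (Suc j) - p i j)"
      by (rule sum_lessThan_telescope[symmetric])
    have "f (p i 0) (p i M - p i 0) \<le> (\<Sum>j<M. f (p i 0) (p i (Suc j) - p i j))"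
      unfolding tele using pD i by (intro f_sum) auto
    also have "\<dots> \<le> (\<Sum>j<M. f (p i j) (p i (Suc j) - p i j) + c * (L / N) * (L / (real N * real M)))"
    proof (rule sum_mono)
      fix j assume j: "j \<in> {..<M}"
      have "f (p i 0) (p i (Suc j) - p i j) \<le> f (p i j) (p i (Suc j) - p i j) + c * norm (p i 0 - p i j) * norm (p i (Suc j) - p i j)"
        using f_lip[of "p i 0" "p i j" "p i (Suc j) - p i j"] pD i j by auto
      moreover have "norm (p i 0 - p i j) \<le> L / N"
      proof -
        have "norm (p i 0 - p i j) \<le> L * (\<bar>real 0 - real j\<bar> / real (N * M))"
          using i j by (intro dist_p) auto
        also have "\<dots> \<le> L * (real M / real (N * M))"
          using j L0 by (intro mult_left_mono divide_right_mono) auto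
        also have "\<dots> = L / N" using M by simp
        finally show ?thesis .
      qed
      moreover have "norm (p i (Suc j) - p i j) \<le> L / (real N * real M)"
        using dist_p[of i "Suc j" j] i j by simp
      ultimately show "f (p i 0) (p i (Suc j) - p i j) \<le> f (p i j) (p i (Suc j) - p i j) + c * (L / N) * (L / (real N * real M))"
        using c_nonneg L0 by (smt (verit) mult_mono mult_left_mono norm_ge_zero mult_nonneg_nonneg)
    qed
    also have "\<dots> = (\<Sum>j<M. f (p i j) (p i (Suc j) - p i j)) + c * L\<^sup>2 / (real N)\<^sup>2"
    proof -
      have "real M * (c * (L / N) * (L / (real N * real M))) = c * L\<^sup>2 / (real N)\<^sup>2"
        using M N by (simp add: power2_eq_square)
      then show ?thesis by (simp add: sum.distrib)
    qed
    finally show ?thesis .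
  qed
  have "riemann \<gamma> N = (\<Sum>i<N. f (p i 0) (p i M - p i 0))"
    unfolding riemann_def p0 pM ..
  also have "\<dots> \<le> (\<Sum>i<N. (\<Sum>j<M. f (p i j) (p i (Suc j) - p i j)) + c * L\<^sup>2 / (real N)\<^sup>2)"
    using cell by (intro sum_mono) auto
  also have "\<dots> = (\<Sum>i<N. \<Sum>j<M. f (p i j) (p i (Suc j) - p i j)) + c * L\<^sup>2 / N"
    using N by (simp add: sum.distrib power2_eq_square)
  also have "(\<Sum>i<N. \<Sum>j<M. f (p i j) (p i (Suc j) - p i j)) = riemann \<gamma> (N * M)"
    unfolding riemann_def sum_blocks p_def by simp
  finally show ?thesis .
qed

lemma riemann_le_cost:
  assumes lip: "L-lipschitz_on {0..1} \<gamma>" and im: "\<gamma> ` {0..1} \<subseteq> D" and N: "0 < N"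
  shows "riemann \<gamma> N \<le> cost f \<gamma> + c * L\<^sup>2 / N"
proof (rule LIMSEQ_le_const)
  have "strict_mono (\<lambda>M. N * Suc M)" using N by (simp add: strict_mono_def)
  from LIMSEQ_subseq_LIMSEQ[OF riemann_tendsto_cost[OF lip im] this]
  show "(\<lambda>M. riemann \<gamma> (N * Suc M) + c * L\<^sup>2 / N) \<longlonglongrightarrow> cost f \<gamma> + c * L\<^sup>2 / N"
    by (intro tendsto_intros) (simp add: o_def)
  show "\<exists>k. \<forall>M\<ge>k. riemann \<gamma> N \<le> riemann \<gamma> (N * Suc M) + c * L\<^sup>2 / N"
    using riemann_refine[OF lip im N] by blast
qed

section \<open>Lower semicontinuity and compactness\<close>
lemma riemann_nonneg:
  assumes "\<gamma> ` {0..1} \<subseteq> D"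
  shows "0 \<le> riemann \<gamma> N"
  unfolding riemann_def
proof (rule sum_nonneg)
  fix i assume "i \<in> {..<N}"
  then have "real i / real N \<in> {0..1}" by auto
  then show "0 \<le> f (\<gamma> (real i / real N)) (\<gamma> (real (Suc i) / real N) - \<gamma> (real i / real N))"
    using assms by (intro f_nonneg) auto
qed

lemma lipschitz_limit:
  fixes \<gamma> :: "real \<Rightarrow> 'a"
  assumes lip: "\<And>k::nat. L-lipschitz_on {0..1} (\<gamma>s k)" and im: "\<And>k. \<gamma>s k ` {0..1} \<subseteq> D"
    and lim: "\<And>t. t \<in> {0..1} \<Longrightarrow> (\<lambda>k. \<gamma>s k t) \<longlonglongrightarrow> \<gamma> t"
  shows "L-lipschitz_on {0..1} \<gamma>" "\<gamma> ` {0..1} \<subseteq> D"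
proof -
  show "L-lipschitz_on {0..1} \<gamma>"
  proof (rule lipschitz_onI)
    fix x y :: real assume "x \<in> {0..1}" "y \<in> {0..1}"
    then show "dist (\<gamma> x) (\<gamma> y) \<le> L * dist x y"
      using lipschitz_onD[OF lip] by (intro tendsto_upperbound[OF tendsto_dist[OF lim lim]]) auto
  qed (use lip lipschitz_on_nonneg in blast)
  show "\<gamma> ` {0..1} \<subseteq> D"
  proof clarify
    fix t :: real assume "t \<in> {0..1}"
    then have "\<gamma>s k t \<in> D" for k using im[of k] by blast
    then show "\<gamma> t \<in> D" using \<open>t \<in> {0..1}\<close>
      by (intro Lim_in_closed_set[OF compact_imp_closed[OF compact_D] _ _ lim]) auto
  qed
qed

text \<open>For fixed \<open>N\<close> the Riemann sum depends continuously on finitely many values of the curve, and it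
  bounds the cost from below up to an error that is uniform in \<open>k\<close>.  So one may first let the curves
  converge and then refine the partition.\<close>
lemma cost_lower_semicontinuous:
  assumes lip: "\<And>k::nat. L-lipschitz_on {0..1} (\<gamma>s k)" and im: "\<And>k. \<gamma>s k ` {0..1} \<subseteq> D"
    and lim: "\<And>t. t \<in> {0..1} \<Longrightarrow> (\<lambda>k. \<gamma>s k t) \<longlonglongrightarrow> \<gamma> t"
    and costs: "(\<lambda>k. cost f (\<gamma>s k)) \<longlonglongrightarrow> z"
  shows "cost f \<gamma> \<le> z"
proof -
  note \<gamma> = lipschitz_limit[OF lip im lim]
  have R: "riemann \<gamma> N \<le> z + c * L\<^sup>2 / N" if N: "0 < N" for N
  proof (rule LIMSEQ_le)
    show "(\<lambda>k. riemann (\<gamma>s k) N) \<longlonglongrightarrow> riemann \<gamma> N"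
      unfolding riemann_def
    proof (rule tendsto_sum)
      fix i assume "i \<in> {..<N}"
      then have i: "real i / real N \<in> {0..1}" "real (Suc i) / real N \<in> {0..1}" by auto
      show "(\<lambda>k. f (\<gamma>s k (real i / real N)) (\<gamma>s k (real (Suc i) / real N) - \<gamma>s k (real i / real N)))
        \<longlonglongrightarrow> f (\<gamma> (real i / real N)) (\<gamma> (real (Suc i) / real N) - \<gamma> (real i / real N))"
        using i \<gamma>(2) im by (intro f_tendsto tendsto_diff lim) (simp_all add: image_subset_iff)
    qed
    show "(\<lambda>k. cost f (\<gamma>s k) + c * L\<^sup>2 / N) \<longlonglongrightarrow> z + c * L\<^sup>2 / N"
      by (intro tendsto_intros costs)
    show "\<exists>K. \<forall>k\<ge>K. riemann (\<gamma>s k) N \<le> cost f (\<gamma>s k) + c * L\<^sup>2 / N"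
      using riemann_le_cost[OF lip im N] by blast
  qed
  show ?thesis
  proof (rule LIMSEQ_le)
    show "riemann \<gamma> \<longlonglongrightarrow> cost f \<gamma>" by (rule riemann_tendsto_cost[OF \<gamma>])
    have "(\<lambda>N. z + c * L\<^sup>2 * (1 / real N)) \<longlonglongrightarrow> z + c * L\<^sup>2 * 0"
      by (intro tendsto_intros lim_1_over_n)
    then show "(\<lambda>N. z + c * L\<^sup>2 / real N) \<longlonglongrightarrow> z" by simp
    show "\<exists>K. \<forall>k\<ge>K. riemann \<gamma> k \<le> z + c * L\<^sup>2 / real k"
      using R by (intro exI[of _ 1]) auto
  qed
qed

lemma uniform_subsequence:
  assumes lip: "\<And>k::nat. L-lipschitz_on {0..1} (\<gamma>s k)" and mem: "\<And>k. \<gamma>s k \<in> lip_paths D a b"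
    and costs: "(\<lambda>k. cost f (\<gamma>s k)) \<longlonglongrightarrow> z"
  obtains s \<gamma> where "strict_mono (s :: nat \<Rightarrow> nat)" "\<gamma> \<in> lip_paths D a b" "L-lipschitz_on {0..1} \<gamma>"
    "uniform_limit {0..1} (\<lambda>k. \<gamma>s (s k)) \<gamma> sequentially" "cost f \<gamma> \<le> z"
proof -
  have im: "\<gamma>s k ` {0..1} \<subseteq> D" for k using mem by (auto simp: lip_paths_def path_image_def)
  have L0: "0 \<le> L" using lip lipschitz_on_nonneg by blast
  obtain B where B: "\<And>x. x \<in> D \<Longrightarrow> norm x \<le> B"
    using compact_imp_bounded[OF compact_D] by (auto simp: bounded_iff)
  obtain \<gamma> s where s: "strict_mono (s :: nat \<Rightarrow> nat)"
    and u: "\<And>e. 0 < e \<Longrightarrow> \<exists>N. \<forall>n x. n \<ge> N \<and> x \<in> {0..1} \<longrightarrow> norm (\<gamma>s (s n) x - \<gamma> x) < e"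
  proof (rule Arzela_Ascoli[of "{0..1::real}" \<gamma>s B])
    show "norm (\<gamma>s n x) \<le> B" if "x \<in> {0..1}" for n x using B[of "\<gamma>s n x"] im[of n] that by (simp add: image_subset_iff)
    show "\<exists>d>0. \<forall>n y. y \<in> {0..1} \<and> norm (x - y) < d \<longrightarrow> norm (\<gamma>s n x - \<gamma>s n y) < e"
      if x: "x \<in> {0..1}" and e: "0 < e" for x e :: real
    proof (intro exI conjI allI impI)
      show "0 < e / (L + 1)" using e L0 by simp
      fix n y assume y: "y \<in> {0..1} \<and> norm (x - y) < e / (L + 1)"
      have "norm (\<gamma>s n x - \<gamma>s n y) \<le> L * norm (x - y)"
        using lipschitz_onD[OF lip, of x y n] x y by (simp add: dist_norm)
      also have "\<dots> \<le> L * (e / (L + 1))" using y L0 by (intro mult_left_mono) auto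
      also have "\<dots> < e" using e L0 by (simp add: field_simps)
      finally show "norm (\<gamma>s n x - \<gamma>s n y) < e" .
    qed
  qed (use that in auto)
  have ul: "uniform_limit {0..1} (\<lambda>k. \<gamma>s (s k)) \<gamma> sequentially"
    unfolding uniform_limit_sequentially_iff dist_norm using u by blast
  have lim: "(\<lambda>k. \<gamma>s (s k) t) \<longlonglongrightarrow> \<gamma> t" if "t \<in> {0..1}" for t
    by (rule tendsto_uniform_limitI[OF ul that])
  note \<gamma> = lipschitz_limit[of L "\<lambda>k. \<gamma>s (s k)", OF lip im lim]
  have "\<gamma> 0 = a"
    using LIMSEQ_unique[OF lim[of 0], of a] mem by (simp add: lip_paths_def pathstart_def)
  moreover have "\<gamma> 1 = b"
    using LIMSEQ_unique[OF lim[of 1], of b] mem by (simp add: lip_paths_def pathfinish_def)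
  ultimately have "\<gamma> \<in> lip_paths D a b"
    using \<gamma> by (auto simp: lip_paths_def path_image_def pathstart_def pathfinish_def)
  moreover have "cost f \<gamma> \<le> z"
    by (rule cost_lower_semicontinuous[of L "\<lambda>k. \<gamma>s (s k)", OF lip im lim])
      (use LIMSEQ_subseq_LIMSEQ[OF costs s] in \<open>simp_all add: o_def\<close>)
  ultimately show thesis using that s ul \<gamma>(1) by blast
qed

section \<open>The cost of piecewise linear paths\<close>
definition seg_cost :: "'a \<Rightarrow> 'a \<Rightarrow> real" where
  "seg_cost u w = integral {0..1} (\<lambda>s. f (u + s *\<^sub>R (w - u)) (w - u))"

lemma segment_point_in_D:
  assumes "u \<in> D" "w \<in> D" "s \<in> {0..1}"
  shows "u + s *\<^sub>R (w - u) \<in> D"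
proof -
  have "u + s *\<^sub>R (w - u) = (1 - s) *\<^sub>R u + s *\<^sub>R w" by (simp add: algebra_simps)
  then show ?thesis using convexD_alt[OF convex_D assms(1,2)] assms(3) by simp
qed

lemma seg_cost_has_integral:
  assumes "u \<in> D" "w \<in> D"
  shows "((\<lambda>s. f (u + s *\<^sub>R (w - u)) (w - u)) has_integral seg_cost u w) {0..1}"
  unfolding seg_cost_def
proof (intro integrable_integral integrable_continuous_real)
  have "continuous_on {0..1} (\<lambda>s. (\<lambda>(x, v). f x v) (u + s *\<^sub>R (w - u), w - u))"
    by (rule continuous_on_compose2[OF f_cont])
      (use segment_point_in_D[OF assms] in \<open>auto intro!: continuous_intros\<close>)
  then show "continuous_on {0..1} (\<lambda>s. f (u + s *\<^sub>R (w - u)) (w - u))" by simp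
qed

text \<open>The basic estimate for all comparisons of polygons: freezing the first argument at a point
  \<open>x\<close> near the segment changes its cost only to second order in the distances.\<close>
lemma seg_cost_frozen:
  assumes "u \<in> D" "w \<in> D" "x \<in> D"
  shows "\<bar>seg_cost u w - f x (w - u)\<bar> \<le> c * (dist x u + dist u w) * dist u w"
proof -
  have "((\<lambda>s. f (u + s *\<^sub>R (w - u)) (w - u) - f x (w - u)) has_integral seg_cost u w - f x (w - u)) {0..1}"
    using has_integral_diff[OF seg_cost_has_integral[OF assms(1,2)], of "\<lambda>_. f x (w - u)" "f x (w - u)"]
      has_integral_const_real[of "f x (w - u)" 0 1] by simp
  moreover have "\<bar>f (u + s *\<^sub>R (w - u)) (w - u) - f x (w - u)\<bar> \<le> c * (dist x u + dist u w) * dist u w"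
    if s: "s \<in> {0..1}" for s
  proof -
    have "norm (u + s *\<^sub>R (w - u) - x) \<le> dist x u + dist u w"
    proof -
      have "norm (u + s *\<^sub>R (w - u) - x) \<le> norm (u - x) + norm (s *\<^sub>R (w - u))"
        by (metis add.commute add_diff_eq norm_triangle_ineq)
      also have "norm (s *\<^sub>R (w - u)) \<le> norm (w - u)" using s by (simp add: mult_left_le_one_le)
      finally show ?thesis by (simp add: dist_norm norm_minus_commute)
    qed
    then have "c * norm (u + s *\<^sub>R (w - u) - x) * norm (w - u) \<le> c * (dist x u + dist u w) * dist u w"
      using c_nonneg by (intro mult_mono) (auto simp: dist_norm norm_minus_commute)
    then show ?thesis
      using f_lip[OF segment_point_in_D[OF assms(1,2) s] assms(3), of "w - u"] by linarith
  qed
  ultimately have "norm (seg_cost u w - f x (w - u)) \<le> c * (dist x u + dist u w) * dist u w * measure lborel {0..1::real}"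
    using c_nonneg by (intro has_integral_bound_real[of _ "{}"]) auto
  then show ?thesis by simp
qed

lemma seg_cost_bounds:
  assumes "u \<in> D" "w \<in> D"
  shows "m1 * dist u w \<le> seg_cost u w" "seg_cost u w \<le> m2 * dist u w"
proof -
  note I = seg_cost_has_integral[OF assms]
  have "m1 * norm (w - u) \<le> seg_cost u w"
    using has_integral_le[OF has_integral_const_real[of "m1 * norm (w - u)" 0 1] I]
      f_lower segment_point_in_D[OF assms] by auto
  then show "m1 * dist u w \<le> seg_cost u w" by (simp add: dist_norm norm_minus_commute)
  have "seg_cost u w \<le> m2 * norm (w - u)"
    using has_integral_le[OF I has_integral_const_real[of "m2 * norm (w - u)" 0 1]]
      f_upper segment_point_in_D[OF assms] by auto
  then show "seg_cost u w \<le> m2 * dist u w" by (simp add: dist_norm norm_minus_commute)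
qed

lemma seg_cost_self [simp]: "u \<in> D \<Longrightarrow> seg_cost u u = 0"
  using seg_cost_bounds[of u u] by simp

text \<open>By homogeneity of degree one the parametrization of a polygon is irrelevant for its cost, so the
  discrete problem is additive over edges.\<close>
lemma cost_linear_path:
  assumes len: "2 \<le> length vs" and D: "set vs \<subseteq> D"
  shows "cost f (linear_path vs) = chain seg_cost vs"
proof -
  obtain m where m: "length vs = Suc m" "0 < m" using len by (cases "length vs") auto
  have "((\<lambda>t. f (linear_path vs t) (velocity (linear_path vs) t)) has_integral
      (\<Sum>i<m. seg_cost (vs ! i) (vs ! Suc i))) {0..1}"
  proof (rule has_integral_unit_partition[OF m(2)])
    fix i assume i: "i < m"
    define u w where "u = vs ! i" and "w = vs ! Suc i"
    have uw: "u \<in> D" "w \<in> D" using D i m by (auto simp: u_def w_def)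
    define J where "J = {real i / real m..real (Suc i) / real m}"
    have "((\<lambda>t. f (u + (real m * t + (- real i)) *\<^sub>R (w - u)) (w - u)) has_integral
        (1 / \<bar>real m\<bar> ^ DIM(real)) *\<^sub>R seg_cost u w) ((\<lambda>x. (1 / real m) *\<^sub>R x + - ((1 / real m) *\<^sub>R (- real i))) ` cbox 0 1)"
      using has_integral_affinity[of "\<lambda>s. f (u + s *\<^sub>R (w - u)) (w - u)" "seg_cost u w" 0 1 "real m" "- real i"]
        seg_cost_has_integral[OF uw] m by simp
    also have "(\<lambda>x. (1 / real m) *\<^sub>R x + - ((1 / real m) *\<^sub>R (- real i))) ` cbox 0 1 = J"
      using m image_affinity_atLeastAtMost[of "1 / real m" "real i / real m" 0 1]
      by (simp add: J_def add_divide_distrib)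
    finally have "((\<lambda>t. f (u + (real m * t - real i) *\<^sub>R (w - u)) (w - u)) has_integral seg_cost u w / real m) J"
      by simp
    from has_integral_mult_right[OF this, of "real m"]
    have I: "((\<lambda>t. real m * f (u + (real m * t - real i) *\<^sub>R (w - u)) (w - u)) has_integral seg_cost u w) J"
      using m by simp
    show "((\<lambda>t. f (linear_path vs t) (velocity (linear_path vs) t)) has_integral seg_cost (vs ! i) (vs ! Suc i))
        {real i / real m..real (Suc i) / real m}"
      unfolding u_def[symmetric] w_def[symmetric] J_def[symmetric]
    proof (rule has_integral_spike_finite[OF _ _ I, of "{real i / real m, real (Suc i) / real m}"])
      fix t assume "t \<in> J - {real i / real m, real (Suc i) / real m}"
      then have t: "real i / real m < t" "t < real (Suc i) / real m" by (auto simp: J_def)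
      have sub: "{real i / real m<..<real (Suc i) / real m} \<subseteq> {0..1}"
      proof
        fix x assume x: "x \<in> {real i / real m<..<real (Suc i) / real m}"
        have "real (Suc i) / real m \<le> 1" using i by simp
        moreover have "0 \<le> real i / real m" by simp
        ultimately show "x \<in> {0..1}" using x unfolding greaterThanLessThan_iff atLeastAtMost_iff by linarith
      qed
      have lp: "linear_path vs x = u + (real m * x - real i) *\<^sub>R (w - u)"
        if "x \<in> {real i / real m<..<real (Suc i) / real m}" for x
        using that by (subst linear_path_eq[OF m(1) i]) (auto simp: u_def w_def algebra_simps)
      have "((\<lambda>x. u + (real m * x - real i) *\<^sub>R (w - u)) has_vector_derivative (real m) *\<^sub>R (w - u)) (at t)"
        by (auto intro!: derivative_eq_intros)
      then have "(linear_path vs has_vector_derivative (real m) *\<^sub>R (w - u)) (at t)"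
        by (rule has_vector_derivative_transform_within_open[of _ _ _ "{real i / real m<..<real (Suc i) / real m}"])
          (use t lp in auto)
      moreover have "at t within {0..1} = at t"
        using t sub by (intro at_within_interior) (meson greaterThanLessThan_iff interior_maximal open_greaterThanLessThan subsetD)
      ultimately have "velocity (linear_path vs) t = real m *\<^sub>R (w - u)"
        unfolding velocity_def by (simp add: vector_derivative_at)
      moreover have "linear_path vs t \<in> D"
        using linear_path_in_segment[OF m(1) i, of t] t closed_segment_subset[OF uw convex_D] by (auto simp: u_def w_def)
      ultimately show "f (linear_path vs t) (velocity (linear_path vs) t) = real m * f (u + (real m * t - real i) *\<^sub>R (w - u)) (w - u)"
        using lp[of t] t f_hom[of "linear_path vs t" "real m" "w - u"] by auto
    qed auto
  qed
  then show ?thesis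
    unfolding cost_def chain_conv_sum[OF m(1)] by (simp add: integral_unique)
qed

end

section \<open>Polygonal approximation and existence of minimizers\<close>
lemma chain_mono_successively:
  "successively (\<lambda>x y. e x y \<le> e' x y) xs \<Longrightarrow> chain e xs \<le> chain e' xs"
  by (induction e xs rule: chain.induct) (auto intro: add_mono)

text \<open>A polygon inscribed in a curve may have many more steps than its length warrants, and then
  \<^const>\<open>linear_path\<close> has a large Lipschitz constant.  Greedy thinning repairs this: starting from the
  last kept vertex \<open>x\<close>, a vertex is skipped as long as its successor is still within distance \<open>h\<close>.\<close>
fun thin :: "real \<Rightarrow> 'a::metric_space \<Rightarrow> 'a list \<Rightarrow> 'a list" where
  "thin h x [] = [x]"
| "thin h x [y] = [x, y]"
| "thin h x (y # z # zs) = (if dist x z \<le> h then thin h x (z # zs) else x # thin h y (z # zs))"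

lemma hd_thin [simp]: "hd (thin h x ys) = x"
  by (induction h x ys rule: thin.induct) auto

lemma thin_not_Nil [simp]: "thin h x ys \<noteq> []"
  by (induction h x ys rule: thin.induct) auto

lemma last_thin [simp]: "ys \<noteq> [] \<Longrightarrow> last (thin h x ys) = last ys"
  by (induction h x ys rule: thin.induct) auto

lemma set_thin: "set (thin h x ys) \<subseteq> insert x (set ys)"
  by (induction h x ys rule: thin.induct) auto

lemma length_thin: "ys \<noteq> [] \<Longrightarrow> 2 \<le> length (thin h x ys)"
  by (induction h x ys rule: thin.induct) auto

lemma chain_Cons: "ys \<noteq> [] \<Longrightarrow> chain e (x # ys) = e x (hd ys) + chain e ys"
  by (cases ys) auto

lemma successively_thin:
  assumes "dist x (hd ys) \<le> h" "successively (\<lambda>u v. dist u v \<le> h) ys" "ys \<noteq> []"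
  shows "successively (\<lambda>u v. dist u v \<le> h) (thin h x ys)"
  using assms by (induction h x ys rule: thin.induct) (auto simp: successively_Cons)

text \<open>Whenever a vertex \<open>y\<close> is kept, the two steps that meet there have total length more than \<open>h\<close>.
  Every step is counted at most twice in this way.\<close>
lemma thin_step_count:
  assumes "0 \<le> h" "ys \<noteq> []"
  shows "h * (real (length (thin h x ys)) - 2) \<le> dist x (hd ys) + 2 * chain dist ys"
  using assms
proof (induction h x ys rule: thin.induct)
  case (3 h x y z zs)
  show ?case
  proof (cases "dist x z \<le> h")
    case True
    then have "h * (real (length (thin h x (z # zs))) - 2) \<le> dist x z + 2 * chain dist (z # zs)"
      using 3 by simp
    also have "\<dots> \<le> dist x y + 2 * (dist y z + chain dist (z # zs))"
      using dist_triangle[of x z y] zero_le_dist[of y z] unfolding distrib_left by linarith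
    finally show ?thesis using True by simp
  next
    case False
    then have "h * (real (length (thin h y (z # zs))) - 2) \<le> dist y z + 2 * chain dist (z # zs)"
      using 3 by simp
    then show ?thesis using False dist_triangle[of x z y] by (simp add: algebra_simps)
  qed
qed auto

context finsler_integrand
begin

definition frozen :: "'a \<Rightarrow> 'a \<Rightarrow> real" where
  "frozen u w = f u (w - u)"

text \<open>Skipping a vertex is free by subadditivity, except that the frozen argument moves by at most \<open>h\<close>.\<close>
lemma chain_frozen_thin:
  assumes "0 \<le> h" "ys \<noteq> []" "dist x (hd ys) \<le> h" "successively (\<lambda>u v. dist u v \<le> h) ys"
    and "x \<in> D" "set ys \<subseteq> D"
  shows "chain frozen (thin h x ys) \<le> frozen x (hd ys) + chain (\<lambda>u v. frozen u v + c * h * dist u v) ys"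
  using assms
proof (induction h x ys rule: thin.induct)
  case (3 h x y z zs)
  let ?g = "\<lambda>u v. frozen u v + c * h * dist u v"
  show ?case
  proof (cases "dist x z \<le> h")
    case True
    then have IH: "chain frozen (thin h x (z # zs)) \<le> frozen x z + chain ?g (z # zs)"
      using 3 by (simp add: successively_Cons)
    have "frozen x z \<le> f x (y - x) + f x (z - y)"
      using f_add[of x "y - x" "z - y"] 3 by (simp add: frozen_def)
    also have "f x (z - y) \<le> f y (z - y) + c * norm (x - y) * norm (z - y)"
      using f_lip[of x y "z - y"] 3 by simp
    also have "c * norm (x - y) * norm (z - y) \<le> c * h * dist y z"
      using 3 c_nonneg by (simp add: dist_norm norm_minus_commute mult_mono)
    finally have "frozen x z \<le> frozen x y + ?g y z" by (simp add: frozen_def)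
    then show ?thesis using True IH by simp
  next
    case False
    then have "chain frozen (thin h y (z # zs)) \<le> frozen y z + chain ?g (z # zs)"
      using 3 by (simp add: successively_Cons)
    moreover have "chain frozen (x # thin h y (z # zs)) = frozen x y + chain frozen (thin h y (z # zs))"
      by (simp add: chain_Cons)
    moreover have "0 \<le> c * h * dist y z" using c_nonneg 3 by simp
    ultimately show ?thesis using False by simp
  qed
qed (auto simp: frozen_def)

lemma cost_nonneg:
  assumes "\<gamma> \<in> lip_paths D a b"
  shows "0 \<le> cost f \<gamma>"
proof -
  obtain L where L: "L-lipschitz_on {0..1} \<gamma>" and im: "\<gamma> ` {0..1} \<subseteq> D"
    using assms by (auto simp: lip_paths_def path_image_def)
  show ?thesis
    using riemann_nonneg[OF im] by (intro LIMSEQ_le_const[OF riemann_tendsto_cost[OF L im]]) auto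
qed

text \<open>This replaces reparametrization by arc length: the Lipschitz constant of the approximating path is
  controlled by the cost of \<open>\<gamma>\<close> and not by the Lipschitz constant of \<open>\<gamma>\<close>, so minimizing sequences
  become equicontinuous.\<close>
lemma polygon_approximation:
  assumes \<gamma>: "\<gamma> \<in> lip_paths D a b" and e: "0 < e"
  obtains vs where "2 \<le> length vs" "set vs \<subseteq> D" "hd vs = a" "last vs = b"
    "(2 * ((cost f \<gamma> + e) / m1) + e)-lipschitz_on {0..1} (linear_path vs)"
    "cost f (linear_path vs) \<le> cost f \<gamma> + e"
proof -
  obtain L0 where L0: "L0-lipschitz_on {0..1} \<gamma>" and im: "\<gamma> ` {0..1} \<subseteq> D"
    and ends: "\<gamma> 0 = a" "\<gamma> 1 = b"
    using \<gamma> by (auto simp: lip_paths_def path_image_def pathstart_def pathfinish_def)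
  define L where "L = L0 + 1"
  have L: "L-lipschitz_on {0..1} \<gamma>" unfolding L_def by (rule lipschitz_on_mono[OF L0]) auto
  have Lpos: "0 < L" using lipschitz_on_nonneg[OF L0] by (simp add: L_def)
  define \<Lambda> where "\<Lambda> = (cost f \<gamma> + e) / m1"
  have \<Lambda>: "0 \<le> \<Lambda>" using cost_nonneg[OF \<gamma>] e m1_pos by (simp add: \<Lambda>_def)
  \<comment> \<open>With this step size each of the two freezing errors, bounded by \<open>c h \<Lambda>\<close>, is at most \<open>e / 4\<close>.\<close>
  define h where "h = min e (e / (4 * (c * \<Lambda> + 1)))"
  have c\<Lambda>: "0 \<le> c * \<Lambda>" using c_nonneg \<Lambda> by simp
  have h: "0 < h" "h \<le> e" using e c\<Lambda> by (auto simp: h_def)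
  have ch: "c * h * \<Lambda> \<le> e / 4"
  proof -
    have "h * (c * \<Lambda> + 1) \<le> e / (4 * (c * \<Lambda> + 1)) * (c * \<Lambda> + 1)"
      using c\<Lambda> by (intro mult_right_mono) (auto simp: h_def)
    also have "\<dots> = e / 4" using c\<Lambda> by (simp add: divide_simps)
    finally show ?thesis using h by (simp add: algebra_simps)
  qed
  have "\<forall>\<^sub>F N in sequentially. riemann \<gamma> N < cost f \<gamma> + e / 2"
    using order_tendstoD(2)[OF riemann_tendsto_cost[OF L im]] e by simp
  moreover have "\<forall>\<^sub>F N in sequentially. L / real N < h"
    using order_tendstoD(2)[OF lim_const_over_n[of L]] h by simp
  ultimately have "\<forall>\<^sub>F N in sequentially. riemann \<gamma> N < cost f \<gamma> + e / 2 \<and> L / real N < h \<and> 0 < N"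
    using eventually_gt_at_top[of 0] by eventually_elim auto
  then obtain N where N: "riemann \<gamma> N < cost f \<gamma> + e / 2" "L / real N < h" "0 < N"
    using eventually_happens by fastforce
  define us where "us = map (\<lambda>i. \<gamma> (real i / real N)) [0..<Suc N]"
  have lus: "length us = Suc N" by (simp add: us_def)
  have nus: "us ! i = \<gamma> (real i / real N)" if "i \<le> N" for i
    using that unfolding us_def by (subst nth_map) (auto simp del: upt_Suc)
  have usD: "set us \<subseteq> D" using im by (auto simp: us_def)
  have R: "chain frozen us = riemann \<gamma> N"
    unfolding chain_conv_sum[OF lus] riemann_def by (intro sum.cong) (auto simp: nus frozen_def)
  have steps: "successively (\<lambda>u v. dist u v \<le> h) us"
    unfolding successively_conv_nth
  proof (intro allI impI)
    fix i assume "Suc i < length us"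
    then have i: "Suc i \<le> N" using lus by simp
    have "dist (us ! i) (us ! Suc i) \<le> L * dist (real i / real N) (real (Suc i) / real N)"
      using i nus by (simp, intro lipschitz_onD[OF L]) auto
    also have "\<dots> = L / N" using N by (simp add: dist_real_def diff_divide_distrib[symmetric])
    finally show "dist (us ! i) (us ! Suc i) \<le> h" using N by linarith
  qed
  define ys where "ys = tl us"
  have us: "us = a # ys" and ys: "ys \<noteq> []" "last ys = b"
  proof -
    have "us \<noteq> []" using lus by auto
    then have "hd us = a" "last us = b" using nus[of 0] nus[of N] lus N ends
      by (auto simp: hd_conv_nth last_conv_nth)
    moreover show "us = a # ys" unfolding ys_def using \<open>us \<noteq> []\<close> \<open>hd us = a\<close> by (metis list.collapse)
    moreover show "ys \<noteq> []" using lus N unfolding ys_def by (cases us) auto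
    ultimately show "last ys = b" by simp
  qed
  have dist_le: "chain dist xs \<le> chain frozen xs / m1" if "set xs \<subseteq> D" for xs
  proof -
    have "chain (\<lambda>u v. m1 * dist u v) xs \<le> chain frozen xs"
      using f_lower that by (intro chain_mono) (metis frozen_def dist_norm norm_minus_commute subsetD)
    then show ?thesis using m1_pos by (simp add: chain_cmult field_simps)
  qed
  have dus: "chain dist us \<le> \<Lambda>"
  proof -
    have "chain dist us \<le> (cost f \<gamma> + e / 2) / m1"
      using N(1) R m1_pos by (intro order_trans[OF dist_le[OF usD]] divide_right_mono) auto
    also have "\<dots> \<le> \<Lambda>" using e m1_pos by (simp add: \<Lambda>_def divide_right_mono)
    finally show ?thesis .
  qed
  define vs where "vs = thin h a ys"
  have vsD: "set vs \<subseteq> D" using set_thin[of h a ys] usD us by (auto simp: vs_def)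
  have st: "successively (\<lambda>u v. dist u v \<le> h) vs"
    unfolding vs_def using steps ys us by (intro successively_thin) (auto simp: successively_Cons)
  have "chain frozen vs \<le> frozen a (hd ys) + chain (\<lambda>u v. frozen u v + c * h * dist u v) ys"
    unfolding vs_def using steps ys us usD h by (intro chain_frozen_thin) (auto simp: successively_Cons)
  also have "\<dots> \<le> chain frozen us + c * h * chain dist us"
    using ys c_nonneg h by (simp add: us chain_Cons chain_add chain_cmult distrib_left)
  also have "\<dots> \<le> cost f \<gamma> + e / 2 + e / 4"
  proof -
    have "c * h * chain dist us \<le> c * h * \<Lambda>" using dus c_nonneg h by (intro mult_left_mono) auto
    then show ?thesis using N(1) R ch by linarith
  qed
  finally have fz: "chain frozen vs \<le> cost f \<gamma> + e / 2 + e / 4" .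
  have dvs: "chain dist vs \<le> \<Lambda>"
  proof -
    have "chain dist vs \<le> (cost f \<gamma> + e) / m1"
      using fz e m1_pos by (intro order_trans[OF dist_le[OF vsD]] divide_right_mono) auto
    then show ?thesis by (simp add: \<Lambda>_def)
  qed
  have len: "2 \<le> length vs" unfolding vs_def by (rule length_thin[OF ys(1)])
  have "chain seg_cost vs \<le> chain (\<lambda>u v. frozen u v + c * h * dist u v) vs"
  proof (rule chain_mono_successively, rule successively_mono[OF st])
    fix u v assume uv: "u \<in> set vs" "v \<in> set vs" "dist u v \<le> h"
    have "\<bar>seg_cost u v - f u (v - u)\<bar> \<le> c * (dist u u + dist u v) * dist u v"
      using uv vsD by (intro seg_cost_frozen) auto
    moreover have "c * (dist u u + dist u v) * dist u v \<le> c * h * dist u v"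
      using uv c_nonneg by (intro mult_right_mono mult_left_mono) auto
    ultimately show "seg_cost u v \<le> frozen u v + c * h * dist u v" unfolding frozen_def by linarith
  qed
  also have "\<dots> = chain frozen vs + c * h * chain dist vs" by (simp add: chain_add chain_cmult)
  also have "\<dots> \<le> cost f \<gamma> + e"
  proof -
    have "c * h * chain dist vs \<le> c * h * \<Lambda>" using dvs c_nonneg h by (intro mult_left_mono) auto
    then show ?thesis using fz ch by linarith
  qed
  finally have costle: "cost f (linear_path vs) \<le> cost f \<gamma> + e"
    using cost_linear_path[OF len vsD] by simp
  obtain m where m: "length vs = Suc m" "0 < m" using len by (cases "length vs") auto
  have "h * (real (length vs) - 2) \<le> dist a (hd ys) + 2 * chain dist ys"
    unfolding vs_def using h ys by (intro thin_step_count) auto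
  also have "\<dots> \<le> 2 * chain dist us" using ys by (simp add: us chain_Cons)
  finally have "real m * h \<le> 2 * \<Lambda> + e" using dus h m by (simp add: algebra_simps)
  moreover have "(real m * h)-lipschitz_on {0..1} (linear_path vs)"
    by (rule linear_path_lipschitz[OF m]) (use h st m in \<open>auto simp: successively_conv_nth\<close>)
  ultimately have "(2 * \<Lambda> + e)-lipschitz_on {0..1} (linear_path vs)"
    by (rule lipschitz_on_mono[rotated 2]) auto
  then show thesis
    using that[of vs] len vsD costle ys by (simp add: \<Lambda>_def vs_def)
qed

lemma minimizer_exists:
  assumes ab: "a \<in> D" "b \<in> D"
  shows "argmin_on (cost f) (lip_paths D a b) \<noteq> {}"
proof -
  define S where "S = cost f ` lip_paths D a b"
  have "linear_path [a, b] \<in> lip_paths D a b"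
    using linear_path_in_lip_paths[OF convex_D, of "[a, b]"] ab by simp
  then have ne: "S \<noteq> {}" by (auto simp: S_def)
  have bdd: "bdd_below S" using cost_nonneg by (auto simp: S_def intro!: bdd_belowI[of _ 0])
  define z where "z = Inf S"
  have "\<exists>vs. linear_path vs \<in> lip_paths D a b \<and>
      (2 * ((z + 2) / m1) + 1)-lipschitz_on {0..1} (linear_path vs) \<and>
      cost f (linear_path vs) \<le> z + 2 / real (Suc k)" for k
  proof -
    define e where "e = 1 / real (Suc k)"
    have e: "0 < e" "e \<le> 1" by (auto simp: e_def)
    have "\<exists>x\<in>S. x < z + e" using cInf_less_iff[OF ne bdd, of "z + e"] e by (simp add: z_def)
    then obtain \<gamma> where \<gamma>: "\<gamma> \<in> lip_paths D a b" "cost f \<gamma> < z + e" by (auto simp: S_def)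
    obtain vs where vs: "2 \<le> length vs" "set vs \<subseteq> D" "hd vs = a" "last vs = b"
      "(2 * ((cost f \<gamma> + e) / m1) + e)-lipschitz_on {0..1} (linear_path vs)"
      "cost f (linear_path vs) \<le> cost f \<gamma> + e"
      using polygon_approximation[OF \<gamma>(1) e(1)] by metis
    have "(2 * ((z + 2) / m1) + 1)-lipschitz_on {0..1} (linear_path vs)"
    proof (rule lipschitz_on_mono[OF vs(5)])
      have "cost f \<gamma> + e \<le> z + 2" using \<gamma>(2) e by linarith
      then show "2 * ((cost f \<gamma> + e) / m1) + e \<le> 2 * ((z + 2) / m1) + 1"
        using e m1_pos by (intro add_mono[OF mult_left_mono[OF divide_right_mono]]) auto
    qed auto
    moreover have "cost f (linear_path vs) \<le> z + 2 / real (Suc k)"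
      using vs(6) \<gamma>(2) by (simp add: e_def)
    ultimately show ?thesis
      using linear_path_in_lip_paths[OF convex_D vs(1,2)] vs(3,4) by blast
  qed
  then obtain vs where vs: "\<And>k. linear_path (vs k) \<in> lip_paths D a b"
      "\<And>k. (2 * ((z + 2) / m1) + 1)-lipschitz_on {0..1} (linear_path (vs k))"
      "\<And>k. cost f (linear_path (vs k)) \<le> z + 2 / real (Suc k)" by metis
  have zl: "z \<le> cost f \<gamma>" if "\<gamma> \<in> lip_paths D a b" for \<gamma>
    unfolding z_def using that bdd by (intro cInf_lower) (auto simp: S_def)
  have "(\<lambda>k. cost f (linear_path (vs k))) \<longlonglongrightarrow> z"
  proof (rule tendsto_sandwich[OF _ _ tendsto_const])
    show "\<forall>\<^sub>F k in sequentially. z \<le> cost f (linear_path (vs k))" using zl vs(1) by simp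
    show "\<forall>\<^sub>F k in sequentially. cost f (linear_path (vs k)) \<le> z + 2 / real (Suc k)" using vs(3) by simp
    show "(\<lambda>k. z + 2 / real (Suc k)) \<longlonglongrightarrow> z"
      using tendsto_add[OF tendsto_const LIMSEQ_Suc[OF lim_const_over_n[of 2]], of z] by simp
  qed
  from uniform_subsequence[OF vs(2,1) this]
  obtain \<gamma> where \<gamma>: "\<gamma> \<in> lip_paths D a b" "cost f \<gamma> \<le> z" by metis
  then have "\<gamma> \<in> argmin_on (cost f) (lip_paths D a b)"
    unfolding argmin_on_def is_arg_min_def using zl by (auto simp: not_less intro: order_trans)
  then show ?thesis by blast
qed

end

section \<open>Optimal paths in geometric graphs\<close>
lemma graph_paths_iff:
  "vs \<in> graph_paths V \<epsilon> a b \<longleftrightarrow>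
     2 \<le> length vs \<and> set vs \<subseteq> V \<and> hd vs = a \<and> last vs = b \<and> successively (geo_edge \<epsilon>) vs"
  by (simp add: graph_paths_def successively_conv_nth)

lemma dist_hd_le_chain:
  assumes "x \<in> set xs"
  shows "dist (hd xs) x \<le> chain dist xs"
proof -
  obtain A B where xs: "xs = A @ x # B" using assms split_list by metis
  have "dist (hd (A @ [x])) (last (A @ [x])) \<le> chain dist (A @ [x])"
    by (rule chain_triangle) (auto simp: dist_triangle)
  moreover have "hd xs = hd (A @ [x])" unfolding xs by (cases A) auto
  moreover have "0 \<le> chain dist (x # B)" by (rule chain_nonneg) simp
  ultimately show ?thesis unfolding xs using chain_append[of dist A x B] by simp
qed

context finsler_integrand
begin

lemma chain_seg_cost_lower: "set vs \<subseteq> D \<Longrightarrow> m1 * chain dist vs \<le> chain seg_cost vs"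
  unfolding chain_cmult[symmetric] using seg_cost_bounds(1) by (intro chain_mono) auto

text \<open>Paths may revisit vertices, so there are infinitely many of them.  However, edges between points of
  a finite set have lengths bounded below, hence only finitely many paths do not exceed a given cost.\<close>
lemma graph_minimizer_exists:
  assumes V: "finite V" "V \<subseteq> D" and ne: "graph_paths V \<epsilon> a b \<noteq> {}"
  shows "argmin_on (cost f) (linear_paths V \<epsilon> a b) \<noteq> {}"
proof -
  obtain vs0 where vs0: "vs0 \<in> graph_paths V \<epsilon> a b" using ne by blast
  define P where "P = {(u, w). u \<in> V \<and> w \<in> V \<and> u \<noteq> w}"
  \<comment> \<open>The number \<open>1\<close> is inserted because \<open>P\<close> may be empty.\<close>
  define d where "d = Min (insert 1 ((\<lambda>(u, w). dist u w) ` P))"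
  have finP: "finite P" by (rule finite_subset[of _ "V \<times> V"]) (auto simp: P_def V)
  have d: "0 < d" unfolding d_def using finP by (subst Min_gr_iff) (auto simp: P_def)
  have d_le: "d \<le> dist u w" if "u \<in> V" "w \<in> V" "u \<noteq> w" for u w
    unfolding d_def using finP that by (intro Min_le) (auto simp: P_def intro!: image_eqI[of _ _ "(u, w)"])
  define C where "C = cost f (linear_path vs0)"
  define \<F> where "\<F> = {vs \<in> graph_paths V \<epsilon> a b. cost f (linear_path vs) \<le> C}"
  obtain n where n: "C / (m1 * d) \<le> real n" using real_arch_simple by blast
  have "\<F> \<subseteq> {xs. set xs \<subseteq> V \<and> length xs \<le> Suc n}"
  proof clarify
    fix vs assume vs: "vs \<in> \<F>"
    then have g: "2 \<le> length vs" "set vs \<subseteq> V" "successively (geo_edge \<epsilon>) vs"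
      by (auto simp: \<F>_def graph_paths_iff)
    obtain m where m: "length vs = Suc m" using g(1) by (cases "length vs") auto
    have "real m * (m1 * d) = (\<Sum>i<m. m1 * d)" by simp
    also have "\<dots> \<le> (\<Sum>i<m. m1 * dist (vs ! i) (vs ! Suc i))"
    proof (intro sum_mono mult_left_mono d_le)
      fix i assume "i \<in> {..<m}"
      then have i: "Suc i < length vs" using m by simp
      show "vs ! i \<in> V" "vs ! Suc i \<in> V" using g(2) i by auto
      show "vs ! i \<noteq> vs ! Suc i" using successively_nth[OF g(3) i] by (auto simp: geo_edge_def)
    qed (use m1_pos in auto)
    also have "\<dots> \<le> chain seg_cost vs"
      using chain_seg_cost_lower[of vs] g(2) V(2) unfolding chain_conv_sum[OF m] by (simp add: sum_distrib_left)
    also have "\<dots> \<le> C" using vs cost_linear_path[of vs] g V by (auto simp: \<F>_def)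
    finally have "real m \<le> C / (m1 * d)" using m1_pos d by (simp add: pos_le_divide_eq)
    then have "m \<le> n" using n by linarith
    then show "set vs \<subseteq> V \<and> length vs \<le> Suc n" using g m by simp
  qed
  then have fin: "finite \<F>" using finite_lists_length_le[OF V(1)] finite_subset by blast
  have "vs0 \<in> \<F>" using vs0 by (simp add: \<F>_def C_def)
  then obtain vs where vs: "vs \<in> \<F>" "\<And>ws. ws \<in> \<F> \<Longrightarrow> cost f (linear_path vs) \<le> cost f (linear_path ws)"
    using ex_is_arg_min_if_finite[OF fin, of "\<lambda>vs. cost f (linear_path vs)"]
    by (auto simp: is_arg_min_linorder)
  have "cost f (linear_path vs) \<le> cost f (linear_path ws)" if "ws \<in> graph_paths V \<epsilon> a b" for ws
  proof (cases "ws \<in> \<F>")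
    case False
    then show ?thesis using that vs(1) by (auto simp: \<F>_def)
  qed (use vs in blast)
  then have "linear_path vs \<in> argmin_on (cost f) (linear_paths V \<epsilon> a b)"
    using vs(1) by (auto simp: argmin_on_def is_arg_min_linorder linear_paths_def \<F>_def)
  then show ?thesis by blast
qed

lemma graph_paths_in_lip_paths:
  assumes "V \<subseteq> D"
  shows "linear_paths V \<epsilon> a b \<subseteq> lip_paths D a b"
  using linear_path_in_lip_paths[OF convex_D] assms by (fastforce simp: linear_paths_def graph_paths_iff)

lemma graph_min_optimal:
  assumes V: "V \<subseteq> D" and vs: "vs \<in> graph_paths V \<epsilon> a b"
    and opt: "linear_path vs \<in> argmin_on (cost f) (linear_paths V \<epsilon> a b)"
    and ws: "ws \<in> graph_paths V \<epsilon> a b"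
  shows "chain seg_cost vs \<le> chain seg_cost ws"
proof -
  have "cost f (linear_path vs) \<le> cost f (linear_path ws)"
    using opt ws by (auto simp: argmin_on_def is_arg_min_linorder linear_paths_def)
  then show ?thesis using cost_linear_path vs ws V by (auto simp: graph_paths_iff subset_trans)
qed

text \<open>The points \<open>\<gamma> (i / N)\<close> are replaced by nearby points of \<open>V\<close>.  Neighbouring points may be replaced
  by the same one; as this is not an edge, repetitions are removed afterwards.  At least two vertices
  remain because the end points differ.\<close>
lemma graph_path_near_curve:
  assumes \<gamma>: "\<gamma> \<in> lip_paths D a b" "L-lipschitz_on {0..1} \<gamma>"
    and V: "V \<subseteq> D" "a \<in> V" "b \<in> V" and net: "\<And>x. x \<in> D \<Longrightarrow> \<exists>y\<in>V. dist x y \<le> \<kappa> * \<epsilon>"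
    and \<kappa>: "0 < \<kappa>" "\<kappa> \<le> 1/8" and \<epsilon>: "0 < \<epsilon>" and ab: "a \<noteq> b" and N: "0 < N" "L / N \<le> \<epsilon> / 4"
  shows "\<exists>vs\<in>graph_paths V \<epsilon> a b. chain seg_cost vs \<le> riemann \<gamma> N + N * (2 * m2 * \<kappa> * \<epsilon> + c * \<epsilon>\<^sup>2)"
proof -
  have im: "\<gamma> ` {0..1} \<subseteq> D" and ends: "\<gamma> 0 = a" "\<gamma> 1 = b"
    using \<gamma> by (auto simp: lip_paths_def path_image_def pathstart_def pathfinish_def)
  define p where "p = (\<lambda>i. \<gamma> (real i / real N))"
  have pD: "p i \<in> D" if "i \<le> N" for i using that im N by (auto simp: p_def)
  define q where "q = (\<lambda>i. if i = 0 then a else if i = N then b else (SOME y. y \<in> V \<and> dist (p i) y \<le> \<kappa> * \<epsilon>))"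
  have q: "q i \<in> V \<and> dist (p i) (q i) \<le> \<kappa> * \<epsilon>" if "i \<le> N" for i
  proof -
    consider "i = 0" | "i = N" "i \<noteq> 0" | "i \<noteq> 0" "i \<noteq> N" by blast
    then show ?thesis
    proof cases
      case 3
      have "\<exists>y. y \<in> V \<and> dist (p i) y \<le> \<kappa> * \<epsilon>" using net[OF pD[OF that]] by blast
      from someI_ex[OF this] show ?thesis using 3 by (simp add: q_def)
    qed (use V ends N \<kappa> \<epsilon> in \<open>auto simp: q_def p_def\<close>)
  qed
  have qD: "q i \<in> D" if "i \<le> N" for i using q[OF that] V by auto
  have pp: "dist (p i) (p (Suc i)) \<le> \<epsilon> / 4" if "Suc i \<le> N" for i
  proof -
    have "dist (p i) (p (Suc i)) \<le> L * dist (real i / real N) (real (Suc i) / real N)"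
      unfolding p_def using that by (intro lipschitz_onD[OF \<gamma>(2)]) auto
    also have "\<dots> = L / N" using N by (simp add: dist_real_def diff_divide_distrib[symmetric])
    finally show ?thesis using N by linarith
  qed
  have \<kappa>\<epsilon>: "\<kappa> * \<epsilon> \<le> \<epsilon> / 8" using \<kappa> \<epsilon> by simp
  have qq: "dist (q i) (q (Suc i)) \<le> \<epsilon> / 2" if "Suc i \<le> N" for i
  proof -
    have "dist (q i) (q (Suc i)) \<le> dist (p i) (q i) + dist (p i) (p (Suc i)) + dist (p (Suc i)) (q (Suc i))"
      by (smt (verit) dist_commute dist_triangle)
    then show ?thesis using pp[OF that] q[of i] q[of "Suc i"] that \<kappa>\<epsilon> by linarith
  qed
  define us where "us = map q [0..<Suc N]"
  have lus: "length us = Suc N" by (simp add: us_def)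
  have nus: "us ! i = q i" if "i \<le> N" for i using that unfolding us_def by (subst nth_map) (auto simp del: upt_Suc)
  have "us \<noteq> []" using lus by auto
  then have ends_us: "hd us = a" "last us = b"
    using nus[of 0] nus[of N] lus N by (auto simp: hd_conv_nth last_conv_nth q_def)
  define vs where "vs = remdups_adj us"
  have vsne: "vs \<noteq> []" using \<open>us \<noteq> []\<close> by (simp add: vs_def)
  have ends_vs: "hd vs = a" "last vs = b" using ends_us by (auto simp: vs_def)
  have "2 \<le> length vs"
  proof (rule ccontr)
    assume "\<not> 2 \<le> length vs"
    then obtain x where "vs = [x]" using vsne by (cases vs; cases "tl vs") auto
    then show False using ends_vs ab by simp
  qed
  moreover have "set vs \<subseteq> V" using q by (auto simp: vs_def us_def)
  moreover have "successively (geo_edge \<epsilon>) vs"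
  proof -
    have "successively (\<lambda>x y. dist x y < \<epsilon>) us"
      unfolding successively_conv_nth
    proof (intro allI impI)
      fix i assume "Suc i < length us"
      then show "dist (us ! i) (us ! Suc i) < \<epsilon>" using qq[of i] nus lus \<epsilon> by simp
    qed
    then have 1: "successively (\<lambda>x y. dist x y < \<epsilon>) vs"
      unfolding vs_def by (rule successively_remdups_adjI)
    show ?thesis unfolding successively_conv_nth
    proof (intro allI impI)
      fix i assume i: "Suc i < length vs"
      have "vs ! i \<noteq> vs ! Suc i" using remdups_adj_adjacent[of i us] i by (simp add: vs_def)
      then show "geo_edge \<epsilon> (vs ! i) (vs ! Suc i)"
        using successively_nth[OF 1 i] by (simp add: geo_edge_def dist_norm)
    qed
  qed
  ultimately have g: "vs \<in> graph_paths V \<epsilon> a b" using ends_vs by (simp add: graph_paths_iff)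
  \<comment> \<open>Removing repetitions requires an edge function that vanishes on the diagonal of the whole space,
    not only on \<open>D\<close>.\<close>
  define e where "e = (\<lambda>u w. if u = w then 0 else seg_cost u w)"
  have "chain seg_cost vs = chain e vs"
    using \<open>set vs \<subseteq> V\<close> V by (intro antisym chain_mono) (auto simp: e_def subset_iff)
  also have "\<dots> = chain e us" unfolding vs_def by (rule chain_remdups_adj) (simp add: e_def)
  also have "\<dots> = (\<Sum>i<N. e (q i) (q (Suc i)))"
    unfolding chain_conv_sum[OF lus] by (intro sum.cong) (auto simp: nus)
  also have "\<dots> \<le> (\<Sum>i<N. f (p i) (p (Suc i) - p i) + (2 * m2 * \<kappa> * \<epsilon> + c * \<epsilon>\<^sup>2))"
  proof (rule sum_mono)
    fix i assume "i \<in> {..<N}"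
    then have i: "i \<le> N" "Suc i \<le> N" by auto
    have "e (q i) (q (Suc i)) = seg_cost (q i) (q (Suc i))" using qD[OF i(1)] qD[OF i(2)] by (simp add: e_def)
    also have "\<dots> \<le> f (p i) (q (Suc i) - q i) + c * (dist (p i) (q i) + dist (q i) (q (Suc i))) * dist (q i) (q (Suc i))"
      using seg_cost_frozen[OF qD[OF i(1)] qD[OF i(2)] pD[OF i(1)]] by linarith
    also have "c * (dist (p i) (q i) + dist (q i) (q (Suc i))) * dist (q i) (q (Suc i)) \<le> c * \<epsilon> * \<epsilon>"
    proof -
      have "dist (p i) (q i) + dist (q i) (q (Suc i)) \<le> \<epsilon>" "dist (q i) (q (Suc i)) \<le> \<epsilon>"
        using q[OF i(1)] qq[OF i(2)] \<kappa>\<epsilon> \<epsilon> by linarith+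
      then show ?thesis using c_nonneg \<epsilon> by (intro mult_mono mult_left_mono) auto
    qed
    also have "f (p i) (q (Suc i) - q i) \<le> f (p i) (p (Suc i) - p i) + f (p i) ((q (Suc i) - p (Suc i)) + (p i - q i))"
      using f_add[OF pD[OF i(1)], of "p (Suc i) - p i" "(q (Suc i) - p (Suc i)) + (p i - q i)"] by simp
    also have "f (p i) ((q (Suc i) - p (Suc i)) + (p i - q i)) \<le> m2 * norm ((q (Suc i) - p (Suc i)) + (p i - q i))"
      by (rule f_upper[OF pD[OF i(1)]])
    also have "m2 * norm ((q (Suc i) - p (Suc i)) + (p i - q i)) \<le> m2 * (\<kappa> * \<epsilon> + \<kappa> * \<epsilon>)"
      using q[OF i(1)] q[OF i(2)] m2_pos
      by (intro mult_left_mono norm_triangle_le add_mono) (auto simp: dist_norm norm_minus_commute)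
    finally show "e (q i) (q (Suc i)) \<le> f (p i) (p (Suc i) - p i) + (2 * m2 * \<kappa> * \<epsilon> + c * \<epsilon>\<^sup>2)"
      by (simp add: power2_eq_square algebra_simps)
  qed
  also have "\<dots> = riemann \<gamma> N + N * (2 * m2 * \<kappa> * \<epsilon> + c * \<epsilon>\<^sup>2)"
    by (simp add: sum.distrib riemann_def p_def)
  finally show ?thesis using g by blast
qed

text \<open>The case of equal end points: a path needs an edge and hence a vertex different from \<open>a\<close>.\<close>
lemma graph_loop_near_point:
  assumes V: "V \<subseteq> D" "a \<in> V" and x: "x \<in> V" "x \<noteq> a" "dist a x < \<epsilon>"
  shows "\<exists>vs\<in>graph_paths V \<epsilon> a a. chain seg_cost vs \<le> 2 * m2 * dist a x"
proof
  show "[a, x, a] \<in> graph_paths V \<epsilon> a a"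
    using assms by (simp add: graph_paths_iff geo_edge_def dist_norm norm_minus_commute)
  show "chain seg_cost [a, x, a] \<le> 2 * m2 * dist a x"
  proof -
    have "a \<in> D" "x \<in> D" using V x by auto
    then show ?thesis
      using seg_cost_bounds(2)[of a x] seg_cost_bounds(2)[of x a] by (simp add: dist_commute)
  qed
qed

text \<open>Cutting out a loop saves a positive amount.  The exception is a loop that is the whole path: it
  cannot be cut out because paths have at least one edge.\<close>
lemma optimal_path_no_repeat:
  assumes V: "V \<subseteq> D" and vs: "A @ x # B @ x # C \<in> graph_paths V \<epsilon> a b"
    and opt: "\<And>ws. ws \<in> graph_paths V \<epsilon> a b \<Longrightarrow> chain seg_cost (A @ x # B @ x # C) \<le> chain seg_cost ws"
  shows "A = []" "C = []"
proof -
  have *: "A = [] \<and> C = []"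
  proof (rule ccontr)
    assume ne: "\<not> (A = [] \<and> C = [])"
    have ws: "A @ x # C \<in> graph_paths V \<epsilon> a b"
      using vs ne by (cases A) (auto simp: graph_paths_iff successively_append_iff successively_Cons last_append hd_append Suc_le_eq split: if_splits)
    have BD: "set (x # B @ [x]) \<subseteq> D" using vs V by (auto simp: graph_paths_iff)
    have "B \<noteq> []" using vs by (auto simp: graph_paths_iff successively_append_iff geo_edge_def)
    then obtain y B' where B: "B = y # B'" by (cases B) auto
    have "x \<noteq> y" using vs B by (auto simp: graph_paths_iff successively_append_iff geo_edge_def)
    then have "0 < m1 * chain dist (x # B @ [x])"
      using m1_pos B by (simp add: add_pos_nonneg chain_nonneg)
    also have "\<dots> \<le> chain seg_cost (x # B @ [x])" by (rule chain_seg_cost_lower[OF BD])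
    finally have pos: "0 < chain seg_cost (x # B @ [x])" .
    have "chain seg_cost (A @ x # B @ x # C) = chain seg_cost (A @ [x]) + (chain seg_cost (x # B @ [x]) + chain seg_cost (x # C))"
      using chain_append[of seg_cost A x "B @ x # C"] chain_append[of seg_cost "x # B" x C] by simp
    moreover have "chain seg_cost (A @ x # C) = chain seg_cost (A @ [x]) + chain seg_cost (x # C)"
      by (rule chain_append)
    ultimately show False using opt[OF ws] pos by linarith
  qed
  then show "A = []" "C = []" by auto
qed

lemma optimal_path_no_shortcut:
  assumes vs: "A @ u # B @ w # C \<in> graph_paths V \<epsilon> a b"
    and opt: "\<And>ws. ws \<in> graph_paths V \<epsilon> a b \<Longrightarrow> chain seg_cost (A @ u # B @ w # C) \<le> chain seg_cost ws"
    and uw: "geo_edge \<epsilon> u w"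
  shows "chain seg_cost (u # B @ [w]) \<le> seg_cost u w"
proof -
  have ws: "A @ u # w # C \<in> graph_paths V \<epsilon> a b"
    using vs uw by (cases A) (auto simp: graph_paths_iff successively_append_iff successively_Cons last_append hd_append split: if_splits)
  have "chain seg_cost (A @ u # B @ w # C) = chain seg_cost (A @ [u]) + (chain seg_cost (u # B @ [w]) + chain seg_cost (w # C))"
    using chain_append[of seg_cost A u "B @ w # C"] chain_append[of seg_cost "u # B" w C] by simp
  moreover have "chain seg_cost (A @ u # w # C) = chain seg_cost (A @ [u]) + (seg_cost u w + chain seg_cost (w # C))"
    using chain_append[of seg_cost A u "w # C"] by simp
  ultimately show ?thesis using opt[OF ws] by linarith
qed

lemma list_two_point_split:
  assumes "i < j" "j < length vs"
  shows "vs = take i vs @ vs ! i # take (j - Suc i) (drop (Suc i) vs) @ vs ! j # drop (Suc j) vs"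
proof -
  have "drop (Suc i) vs = take (j - Suc i) (drop (Suc i) vs) @ drop (j - Suc i) (drop (Suc i) vs)"
    by (rule append_take_drop_id[symmetric])
  also have "drop (j - Suc i) (drop (Suc i) vs) = drop j vs" using assms by simp
  also have "drop j vs = vs ! j # drop (Suc j) vs" using assms by (simp add: Cons_nth_drop_Suc)
  finally have "drop (Suc i) vs = take (j - Suc i) (drop (Suc i) vs) @ vs ! j # drop (Suc j) vs" .
  moreover have "vs = take i vs @ vs ! i # drop (Suc i) vs" using assms by (intro id_take_nth_drop) auto
  ultimately show ?thesis by simp
qed

text \<open>If two vertices \<open>k\<close> steps apart were at distance less than \<open>\<epsilon>\<close>, the \<open>k + 1\<close> distinct vertices of
  this window would lie in one tube, more than it contains.  So every window of \<open>k\<close> steps has length at least \<open>\<epsilon>\<close>.  Summing over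
  all windows counts each step at most \<open>k\<close> times.  In the assumption \<open>flat\<close>, \<open>B\<close> stands for the vertices
  strictly between the ends of a window.\<close>
lemma hop_bound:
  assumes V: "finite V" "V \<subseteq> D" and vs: "vs \<in> graph_paths V \<epsilon> a b" and \<epsilon>: "0 < \<epsilon>" and k: "0 < k"
    and opt: "\<And>ws. ws \<in> graph_paths V \<epsilon> a b \<Longrightarrow> chain seg_cost vs \<le> chain seg_cost ws"
    and flat: "\<And>u B w x. set (u # B @ [w]) \<subseteq> D \<Longrightarrow> dist u w < \<epsilon> \<Longrightarrow>
       chain seg_cost (u # B @ [w]) \<le> seg_cost u w \<Longrightarrow> x \<in> set B \<Longrightarrow> infdist x (closed_segment u w) \<le> r"
    and r: "0 \<le> r"
    and tube: "\<And>u w. u \<in> D \<Longrightarrow> w \<in> D \<Longrightarrow> dist u w < \<epsilon> \<Longrightarrow>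
       card {x \<in> V. infdist x (closed_segment u w) \<le> r} \<le> k"
  shows "real (length vs - 1) * \<epsilon> \<le> real k * chain dist vs + real k * \<epsilon>"
proof -
  have g: "2 \<le> length vs" "set vs \<subseteq> V" using vs by (auto simp: graph_paths_iff)
  obtain m where m: "length vs = Suc m" using g(1) by (cases "length vs") auto
  have cd0: "0 \<le> chain dist vs" by (rule chain_nonneg) auto
  have norepeat: "vs ! i \<noteq> vs ! j" if "i < j" "j \<le> m" "0 < i \<or> j < m" for i j
  proof
    assume eq: "vs ! i = vs ! j"
    note split = list_two_point_split[OF that(1), of vs]
    have "vs = take i vs @ vs ! i # take (j - Suc i) (drop (Suc i) vs) @ vs ! i # drop (Suc j) vs"
      using split that m eq by simp
    then have "take i vs = []" "drop (Suc j) vs = []"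
      using optimal_path_no_repeat[OF V(2), of "take i vs" "vs ! i" "take (j - Suc i) (drop (Suc i) vs)" "drop (Suc j) vs"] vs opt
      by metis+
    then show False using that m by auto
  qed
  show ?thesis
  proof (cases "m \<le> k")
    case True
    then have "real m * \<epsilon> \<le> real k * \<epsilon>" using \<epsilon> by simp
    then show ?thesis using cd0 m by (simp add: add_increasing)
  next
    case False
    have far: "\<epsilon> \<le> dist (vs ! j) (vs ! (j + k))" if j: "j + k \<le> m" for j
    proof (rule ccontr)
      assume "\<not> ?thesis"
      then have near: "dist (vs ! j) (vs ! (j + k)) < \<epsilon>" by simp
      define u w where "u = vs ! j" and "w = vs ! (j + k)"
      define B where "B = take (j + k - Suc j) (drop (Suc j) vs)"
      have split: "vs = take j vs @ u # B @ w # drop (Suc (j + k)) vs"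
        unfolding u_def w_def B_def using k j m by (intro list_two_point_split) auto
      have uwne: "u \<noteq> w" unfolding u_def w_def using norepeat[of j "j + k"] j k False by linarith
      have uwD: "set (u # B @ [w]) \<subseteq> D"
      proof -
        have "set (u # B @ [w]) \<subseteq> set vs" by (subst split) auto
        then show ?thesis using g(2) V(2) by blast
      qed
      have edge: "geo_edge \<epsilon> u w" using near uwne by (simp add: geo_edge_def dist_norm u_def w_def)
      have short: "chain seg_cost (u # B @ [w]) \<le> seg_cost u w"
        using optimal_path_no_shortcut[of "take j vs" u B w "drop (Suc (j + k)) vs" V \<epsilon> a b] split vs opt edge by metis
      have Bin: "infdist x (closed_segment u w) \<le> r" if "x \<in> set B" for x
        using flat[OF uwD _ short that] near by (simp add: u_def w_def)
      have "(\<lambda>i. vs ! i) ` {j..j + k} \<subseteq> {x \<in> V. infdist x (closed_segment u w) \<le> r}"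
      proof (rule image_subsetI)
        fix i assume i: "i \<in> {j..j + k}"
        then have iV: "vs ! i \<in> V" using g(2) j m by (auto simp: subset_iff)
        consider "i = j" | "i = j + k" | "j < i" "i < j + k" using i by fastforce
        then have "infdist (vs ! i) (closed_segment u w) \<le> r"
        proof cases
          case 3
          have "B ! (i - Suc j) = vs ! i" "i - Suc j < length B" using 3 j m by (auto simp: B_def)
          then have "vs ! i \<in> set B" by (metis nth_mem)
          then show ?thesis by (rule Bin)
        qed (use r in \<open>auto simp: u_def w_def\<close>)
        then show "vs ! i \<in> {x \<in> V. infdist x (closed_segment u w) \<le> r}" using iV by simp
      qed
      then have "card ((\<lambda>i. vs ! i) ` {j..j + k}) \<le> card {x \<in> V. infdist x (closed_segment u w) \<le> r}"
        using V(1) by (intro card_mono) auto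
      also have "\<dots> \<le> k" using uwD near by (intro tube) (auto simp: u_def w_def)
      finally have "card ((\<lambda>i. vs ! i) ` {j..j + k}) \<le> k" .
      moreover have "inj_on (\<lambda>i. vs ! i) {j..j + k}"
      proof (rule linorder_inj_onI')
        fix p q assume "p \<in> {j..j + k}" "q \<in> {j..j + k}" "p < q"
        then have "j \<le> p" "q \<le> j + k" "p < q" by auto
        then have "q \<le> m" "0 < p \<or> q < m" using j False by linarith+
        then show "vs ! p \<noteq> vs ! q" using norepeat[OF \<open>p < q\<close>] by simp
      qed
      ultimately show False by (simp add: card_image)
    qed
    have "real (Suc (m - k)) * \<epsilon> = (\<Sum>j<Suc (m - k). \<epsilon>)" by simp
    also have "\<dots> \<le> (\<Sum>j<Suc (m - k). \<Sum>i<k. dist (vs ! (j + i)) (vs ! Suc (j + i)))"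
    proof (rule sum_mono)
      fix j assume j: "j \<in> {..<Suc (m - k)}"
      have "dist (vs ! j) (vs ! (j + n)) \<le> (\<Sum>i<n. dist (vs ! (j + i)) (vs ! Suc (j + i)))" for n
      proof (induction n)
        case (Suc n)
        then show ?case using dist_triangle[of "vs ! j" "vs ! (j + Suc n)" "vs ! (j + n)"] by simp
      qed simp
      from this[of k] show "\<epsilon> \<le> (\<Sum>i<k. dist (vs ! (j + i)) (vs ! Suc (j + i)))"
        using order_trans[OF far[of j]] j False by simp
    qed
    also have "\<dots> = (\<Sum>i<k. \<Sum>j<Suc (m - k). dist (vs ! (j + i)) (vs ! Suc (j + i)))"
      by (rule sum.swap)
    also have "\<dots> \<le> (\<Sum>i<k. chain dist vs)"
    proof (rule sum_mono)
      fix i assume i: "i \<in> {..<k}"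
      have "(\<Sum>j<Suc (m - k). dist (vs ! (j + i)) (vs ! Suc (j + i)))
          = (\<Sum>l\<in>(\<lambda>j. j + i) ` {..<Suc (m - k)}. dist (vs ! l) (vs ! Suc l))"
        by (subst sum.reindex) auto
      also have "\<dots> \<le> (\<Sum>l<m. dist (vs ! l) (vs ! Suc l))"
        using i False by (intro sum_mono2) auto
      finally show "(\<Sum>j<Suc (m - k). dist (vs ! (j + i)) (vs ! Suc (j + i))) \<le> chain dist vs"
        unfolding chain_conv_sum[OF m] .
    qed
    finally have "real (Suc (m - k)) * \<epsilon> \<le> real k * chain dist vs" by simp
    moreover have "real (Suc (m - k)) = real m - real k + 1" using False by simp
    ultimately show ?thesis using \<epsilon> m by (simp add: algebra_simps)
  qed
qed

text \<open>If a chain from \<open>u\<close> to \<open>w\<close> is at most as expensive as the edge, its length is at most \<open>K \<epsilon>\<close> with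
  \<open>K = m2 / m1\<close>.  Freezing the first argument at \<open>u\<close> along the whole chain therefore costs only
  \<open>C' \<epsilon>\<^sup>2\<close>.  A vertex at distance more than \<open>\<epsilon>\<^sup>\<alpha>\<close> from the segment would cost an extra
  \<open>C (\<epsilon>\<^sup>\<alpha>)\<^sup>\<alpha>\<close>, which is larger for small \<open>\<epsilon>\<close> because \<open>\<alpha>\<^sup>2 < 2\<close>.\<close>
lemma shortcut_window_flat:
  assumes P: "cond_Pythag \<alpha> D f" and \<alpha>: "1 < \<alpha>" "\<alpha> < sqrt 2"
  shows "\<exists>\<epsilon>0>0. \<forall>\<epsilon> u B w x. 0 < \<epsilon> \<and> \<epsilon> < \<epsilon>0 \<and> set (u # B @ [w]) \<subseteq> D \<and> dist u w < \<epsilon> \<and>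
     chain seg_cost (u # B @ [w]) \<le> seg_cost u w \<and> x \<in> set B \<longrightarrow>
     infdist x (closed_segment u w) \<le> \<epsilon> powr \<alpha>"
proof -
  obtain C where C: "0 < C" and pyth: "\<And>r u v w x. \<lbrakk>0 < r; r < 1;
      \<exists>\<eta>'<1. norm (u - w) < \<eta>' \<and> norm (v - w) < \<eta>' \<and> norm (u - v) < \<eta>';
      r \<le> infdist w (closed_segment u v); norm (u - v) \<le> 1 * r powr (1 / \<alpha>); x \<in> D\<rbrakk>
      \<Longrightarrow> f x (v - u) + C * r powr \<alpha> \<le> f x (w - u) + f x (v - w)"
    using P unfolding cond_Pythag_def by (elim allE[of _ 1]) fastforce
  define K where "K = m2 / m1"
  have K: "0 < K" using m1_pos m2_pos by (simp add: K_def)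
  define C' where "C' = c + 3 * c * K\<^sup>2"
  have "\<alpha>\<^sup>2 < (sqrt 2)\<^sup>2" using \<alpha> by (intro power_strict_mono) auto
  then have \<alpha>2: "\<alpha>\<^sup>2 < 2" by simp
  have "((\<lambda>e::real. C' * e powr (2 - \<alpha>\<^sup>2)) \<longlongrightarrow> C' * 0) (at_right 0)"
    using \<alpha>2 by real_asymp
  then have "\<forall>\<^sub>F e in at_right 0. C' * e powr (2 - \<alpha>\<^sup>2) < C"
    using C by (auto dest: order_tendstoD(2))
  then obtain b where b: "b > 0" "\<And>e. 0 < e \<Longrightarrow> e < b \<Longrightarrow> C' * e powr (2 - \<alpha>\<^sup>2) < C"
    unfolding eventually_at_right_field by auto
  \<comment> \<open>The bound \<open>1 / (4 K)\<close> keeps the whole chain within distance \<open>1/4\<close> of \<open>u\<close>, so that all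
    distances are below \<open>1/2\<close>, as the Pythagorean condition requires.\<close>
  show ?thesis
  proof (intro exI[of _ "min b (min (1/4) (1 / (4 * K)))"] conjI allI impI, goal_cases)
    case 1
    then show ?case using b K by simp
  next
    case (2 \<epsilon> u B w x)
    then have \<epsilon>: "0 < \<epsilon>" "\<epsilon> < b" "\<epsilon> < 1/4" "\<epsilon> < 1 / (4 * K)"
      and xsD: "set (u # B @ [w]) \<subseteq> D" and uw: "dist u w < \<epsilon>"
      and short: "chain seg_cost (u # B @ [w]) \<le> seg_cost u w" and x: "x \<in> set B" by auto
    define xs where "xs = u # B @ [w]"
    have D: "u \<in> D" "w \<in> D" "x \<in> D" "set xs \<subseteq> D" using xsD x by (auto simp: xs_def)
    define \<Lambda> where "\<Lambda> = chain dist xs"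
    have \<Lambda>0: "0 \<le> \<Lambda>" unfolding \<Lambda>_def by (rule chain_nonneg) simp
    have "m1 * \<Lambda> \<le> seg_cost u w" using chain_seg_cost_lower[OF D(4)] short by (simp add: \<Lambda>_def xs_def)
    also have "\<dots> \<le> m2 * \<epsilon>"
      using seg_cost_bounds(2)[OF D(1,2)] uw m2_pos by (smt (verit) mult_left_mono)
    finally have \<Lambda>: "\<Lambda> \<le> K * \<epsilon>" using m1_pos by (simp add: K_def field_simps)
    have K\<epsilon>: "K * \<epsilon> < 1/4" using \<epsilon>(4) K by (simp add: field_simps)
    have near: "dist u y \<le> \<Lambda>" if "y \<in> set xs" for y
      using dist_hd_le_chain[OF that] by (simp add: xs_def \<Lambda>_def)
    define e where "e = (\<lambda>y z. f u (z - y))"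
    have "chain e xs \<le> chain (\<lambda>y z. seg_cost y z + 3 * c * \<Lambda> * dist y z) xs"
    proof (rule chain_mono)
      fix y z assume yz: "y \<in> set xs" "z \<in> set xs"
      have "f u (z - y) \<le> seg_cost y z + c * (dist u y + dist y z) * dist y z"
        using seg_cost_frozen[of y z u] yz D by (simp add: subset_iff abs_le_iff)
      also have "c * (dist u y + dist y z) * dist y z \<le> c * (3 * \<Lambda>) * dist y z"
        using near[OF yz(1)] near[OF yz(2)] dist_triangle2[of y z u] c_nonneg
        by (intro mult_right_mono mult_left_mono) (auto simp: dist_commute)
      finally show "e y z \<le> seg_cost y z + 3 * c * \<Lambda> * dist y z" by (simp add: e_def mult_ac)
    qed
    also have "\<dots> = chain seg_cost xs + 3 * c * \<Lambda> * \<Lambda>" by (simp add: chain_add chain_cmult \<Lambda>_def)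
    also have "\<dots> \<le> seg_cost u w + 3 * c * (K * \<epsilon>) * (K * \<epsilon>)"
      using short \<Lambda> \<Lambda>0 c_nonneg K \<epsilon> by (intro add_mono mult_mono mult_left_mono) (auto simp: xs_def)
    also have "seg_cost u w \<le> f u (w - u) + c * \<epsilon> * \<epsilon>"
    proof -
      have "seg_cost u w \<le> f u (w - u) + c * (dist u u + dist u w) * dist u w"
        using seg_cost_frozen[OF D(1,2,1)] by linarith
      also have "c * (dist u u + dist u w) * dist u w \<le> c * \<epsilon> * \<epsilon>"
        using uw c_nonneg \<epsilon> by (intro mult_mono mult_left_mono) auto
      finally show ?thesis by simp
    qed
    finally have up: "chain e xs \<le> f u (w - u) + C' * \<epsilon>\<^sup>2"
      by (simp add: C'_def power2_eq_square algebra_simps)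
    show "infdist x (closed_segment u w) \<le> \<epsilon> powr \<alpha>"
    proof (rule ccontr)
      assume far: "\<not> ?thesis"
      obtain B1 B2 where B: "B = B1 @ x # B2" using x split_list by metis
      have tri: "e p q \<le> e p y + e y q" for p y q
        using f_add[OF D(1), of "y - p" "q - y"] by (simp add: e_def)
      have self: "e p p = 0" for p using D by (simp add: e_def)
      have "e u x + e x w \<le> chain e ((u # B1) @ [x]) + chain e (x # B2 @ [w])"
        using chain_triangle[of "(u # B1) @ [x]" e, OF tri self] chain_triangle[of "x # B2 @ [w]" e, OF tri self]
        by simp
      also have "\<dots> = chain e xs" using chain_append[of e "u # B1" x "B2 @ [w]"] by (simp add: xs_def B)
      finally have "e u x + e x w \<le> f u (w - u) + C' * \<epsilon>\<^sup>2" using up by linarith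
      moreover have "f u (w - u) + C * (\<epsilon> powr \<alpha>) powr \<alpha> \<le> f u (x - u) + f u (w - x)"
      proof (rule pyth)
        show "0 < \<epsilon> powr \<alpha>" using \<epsilon> by simp
        show "\<epsilon> powr \<alpha> < 1" using \<epsilon> \<alpha> powr_less_mono2[of \<alpha> \<epsilon> 1] by simp
        have ux: "dist u x < 1/4" using near[of x] x \<Lambda> K\<epsilon> by (auto simp: xs_def)
        then have "dist w x < 1/2" using dist_triangle3[of w x u] uw \<epsilon> by linarith
        then show "\<exists>\<eta>'<1. norm (u - x) < \<eta>' \<and> norm (w - x) < \<eta>' \<and> norm (u - w) < \<eta>'"
          using ux uw \<epsilon> by (intro exI[of _ "1/2"]) (auto simp: dist_norm)
        show "\<epsilon> powr \<alpha> \<le> infdist x (closed_segment u w)" using far by simp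
        have "(\<epsilon> powr \<alpha>) powr (1 / \<alpha>) = \<epsilon>" using \<alpha> \<epsilon> by (simp add: powr_powr)
        then show "norm (u - w) \<le> 1 * (\<epsilon> powr \<alpha>) powr (1 / \<alpha>)" using uw by (simp add: dist_norm)
      qed (use D in auto)
      ultimately have "C * \<epsilon> powr (\<alpha>\<^sup>2) \<le> C' * \<epsilon>\<^sup>2"
        by (simp add: e_def powr_powr power2_eq_square)
      also have "\<epsilon>\<^sup>2 = \<epsilon> powr (2 - \<alpha>\<^sup>2) * \<epsilon> powr (\<alpha>\<^sup>2)" using \<epsilon> by (simp add: powr_add[symmetric])
      finally have "C \<le> C' * \<epsilon> powr (2 - \<alpha>\<^sup>2)" using \<epsilon> by simp
      then show False using b(2)[OF \<epsilon>(1,2)] by simp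
    qed
  qed
qed

end

section \<open>Nets, balls and tubes in a convex body\<close>
lemma convex_body_facts:
  assumes "convex_body D"
  shows "compact D" "convex D" "D \<noteq> {}" "interior D \<noteq> {}"
proof -
  obtain U where U: "open U" "U \<noteq> {}" "bounded U" "convex U" "D = closure U"
    using assms by (auto simp: convex_body_def)
  show "compact D" using U by (simp add: compact_closure)
  show "convex D" using U by (simp add: convex_closure)
  show "D \<noteq> {}" using U by simp
  have "U \<subseteq> interior D" using U by (simp add: interior_maximal closure_subset)
  then show "interior D \<noteq> {}" using U by auto
qed

text \<open>The balls of radius \<open>r / 2\<close> around the points are disjoint and lie in a ball of radius \<open>R + 1\<close>.\<close>
lemma separated_card_bound:
  fixes S :: "'a::euclidean_space set"
  assumes R: "S \<subseteq> ball 0 R" "0 < R" and r: "0 < r" "r \<le> 1" and S: "finite S"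
    and sep: "\<And>x y. x \<in> S \<Longrightarrow> y \<in> S \<Longrightarrow> x \<noteq> y \<Longrightarrow> r \<le> dist x y"
  shows "real (card S) \<le> (2 * (R + 1)) ^ DIM('a) * (1 / r) ^ DIM('a)"
proof -
  let ?v = "unit_ball_vol (real DIM('a))"
  have vol: "measure lborel (ball x s) = ?v * s ^ DIM('a)" if "0 \<le> s" for x :: 'a and s
    using that by (rule content_ball)
  have "real (card S) * (?v * (r / 2) ^ DIM('a)) = (\<Sum>x\<in>S. measure lborel (ball x (r / 2)))"
    using r by (simp add: vol)
  also have "\<dots> = measure lborel (\<Union>x\<in>S. ball x (r / 2))"
  proof (rule measure_finite_Union[symmetric])
    show "disjoint_family_on (\<lambda>x. ball x (r / 2)) S"
      unfolding disjoint_family_on_def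
    proof (intro ballI impI equals0I)
      fix x y z assume "x \<in> S" "y \<in> S" "x \<noteq> y" "z \<in> ball x (r / 2) \<inter> ball y (r / 2)"
      then show False using sep[of x y] dist_triangle2[of x y z] by (auto simp: dist_commute)
    qed
  qed (use S r in \<open>auto simp: emeasure_ball\<close>)
  also have "\<dots> \<le> measure lborel (ball (0::'a) (R + 1))"
  proof (rule measure_mono_fmeasurable)
    show "(\<Union>x\<in>S. ball x (r / 2)) \<subseteq> ball 0 (R + 1)"
    proof clarify
      fix x z assume "x \<in> S" "z \<in> ball x (r / 2)"
      then show "z \<in> ball 0 (R + 1)"
        using R r dist_triangle[of 0 z x] by (auto simp: subset_iff)
    qed
    show "ball (0::'a) (R + 1) \<in> fmeasurable lborel"
      using R by (intro fmeasurableI) (auto simp: emeasure_ball)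
  qed (intro sets.finite_UN, use S in auto)
  also have "\<dots> = ?v * (R + 1) ^ DIM('a)" using R by (simp add: vol)
  finally have "real (card S) * (r / 2) ^ DIM('a) \<le> (R + 1) ^ DIM('a)"
    by (simp add: mult.left_commute)
  then have "real (card S) * r ^ DIM('a) \<le> (R + 1) ^ DIM('a) * 2 ^ DIM('a)"
    by (simp add: power_divide pos_divide_le_eq)
  also have "\<dots> = (2 * (R + 1)) ^ DIM('a)" by (simp only: power_mult_distrib mult.commute)
  finally show ?thesis using r by (simp add: power_divide pos_le_divide_eq)
qed

text \<open>A separated set of largest cardinality is a net.\<close>
lemma finite_net:
  fixes D :: "'a::euclidean_space set"
  assumes "bounded D"
  obtains C where "0 < C"
    "\<And>r. 0 < r \<Longrightarrow> r \<le> 1 \<Longrightarrow> \<exists>A. finite A \<and> A \<subseteq> D \<and> real (card A) \<le> C * (1 / r) ^ DIM('a) \<and> (\<forall>x\<in>D. \<exists>y\<in>A. dist x y < r)"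
proof -
  obtain R where R: "0 < R" "D \<subseteq> ball 0 R"
    using bounded_subset_ballD[OF assms, of 0] by auto
  define C where "C = (2 * (R + 1)) ^ DIM('a)"
  have "\<exists>A. finite A \<and> A \<subseteq> D \<and> real (card A) \<le> C * (1 / r) ^ DIM('a) \<and> (\<forall>x\<in>D. \<exists>y\<in>A. dist x y < r)"
    if r: "0 < r" "r \<le> 1" for r
  proof -
    define P where "P = (\<lambda>S. finite S \<and> S \<subseteq> D \<and> (\<forall>x\<in>S. \<forall>y\<in>S. x \<noteq> y \<longrightarrow> r \<le> dist x y))"
    have bound: "real (card S) \<le> C * (1 / r) ^ DIM('a)" if "P S" for S
      unfolding C_def using that R(2) by (intro separated_card_bound[OF _ R(1) r]) (auto simp: P_def)
    have "P {}" by (simp add: P_def)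
    moreover have "\<forall>S. P S \<longrightarrow> card S \<le> nat \<lfloor>C * (1 / r) ^ DIM('a)\<rfloor>"
      using bound by (simp add: le_nat_floor)
    ultimately obtain A where A: "P A" "\<And>S. P S \<Longrightarrow> card S \<le> card A"
      using ex_has_greatest_nat[of P "{}" card "Suc (nat \<lfloor>C * (1 / r) ^ DIM('a)\<rfloor>)"]
      by (auto simp: less_Suc_eq_le)
    have "\<exists>y\<in>A. dist x y < r" if x: "x \<in> D" for x
    proof (rule ccontr)
      assume "\<not> ?thesis"
      then have far: "\<And>y. y \<in> A \<Longrightarrow> r \<le> dist x y" by (auto simp: not_less)
      then have "x \<notin> A" using r by force
      moreover have "P (insert x A)" using A(1) x far by (auto simp: P_def dist_commute)
      ultimately show False using A(2)[of "insert x A"] A(1) by (simp add: P_def)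
    qed
    then show ?thesis using A(1) bound[OF A(1)] by (auto simp: P_def)
  qed
  then show thesis using that[of C] R by (simp add: C_def)
qed

text \<open>A ball \<open>ball x0 \<rho> \<subseteq> D\<close>, shrunk towards a point \<open>x \<in> D\<close> by a factor proportional to \<open>s\<close>, stays in
  \<open>D\<close> by convexity and lies in \<open>ball x s\<close>.\<close>
lemma convex_body_ball_volume:
  fixes D :: "'a::euclidean_space set"
  assumes "convex_body D"
  obtains k where "0 < k"
    "\<And>x s. x \<in> D \<Longrightarrow> 0 < s \<Longrightarrow> s \<le> 1 \<Longrightarrow> k * s ^ DIM('a) \<le> measure lborel (D \<inter> ball x s)"
proof -
  note D = convex_body_facts[OF assms]
  obtain x0 \<rho> where x0: "0 < \<rho>" "ball x0 \<rho> \<subseteq> D"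
    using D(4) by (metis ex_in_conv mem_interior)
  obtain R where R: "1 \<le> R" "\<And>x y. x \<in> D \<Longrightarrow> y \<in> D \<Longrightarrow> dist x y \<le> R"
  proof -
    obtain e where e: "\<And>x y. x \<in> D \<Longrightarrow> y \<in> D \<Longrightarrow> dist x y \<le> e"
      using compact_imp_bounded[OF D(1)] unfolding bounded_two_points by blast
    show thesis by (rule that[of "max 1 e"]) (auto intro: order_trans[OF e])
  qed
  let ?v = "unit_ball_vol (real DIM('a))"
  define k where "k = ?v * (\<rho> / (2 * R)) ^ DIM('a)"
  have "k * s ^ DIM('a) \<le> measure lborel (D \<inter> ball x s)" if x: "x \<in> D" and s: "0 < s" "s \<le> 1" for x s
  proof -
    define l where "l = s / (2 * R)"
    have l: "0 < l" "l \<le> 1" "l * R < s" using s R by (auto simp: l_def field_simps)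
    have sub: "ball (x + l *\<^sub>R (x0 - x)) (l * \<rho>) \<subseteq> D \<inter> ball x s"
    proof
      fix z assume z: "z \<in> ball (x + l *\<^sub>R (x0 - x)) (l * \<rho>)"
      define y where "y = x + (1 / l) *\<^sub>R (z - x)"
      have zy: "z = (1 - l) *\<^sub>R x + l *\<^sub>R y" using l by (simp add: y_def algebra_simps)
      have "l *\<^sub>R (x0 - y) = x + l *\<^sub>R (x0 - x) - z" by (simp add: zy algebra_simps)
      then have "l * dist x0 y = dist (x + l *\<^sub>R (x0 - x)) z"
        using l by (metis abs_of_pos dist_norm norm_scaleR)
      then have "l * dist x0 y < l * \<rho>" using z by simp
      then have "dist x0 y < \<rho>" using l by (simp only: mult_less_cancel_left_pos)
      then have y: "y \<in> D" using x0 by auto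
      have "z \<in> D" unfolding zy using convexD_alt[OF D(2) x y] l by simp
      moreover have "dist x z = l * dist x y"
      proof -
        have "x - z = l *\<^sub>R (x - y)" by (simp add: zy algebra_simps)
        then show ?thesis using l by (simp add: dist_norm)
      qed
      moreover have "l * dist x y \<le> l * R" using R(2)[OF x y] l by simp
      ultimately show "z \<in> D \<inter> ball x s" using l(3) by (metis IntI mem_ball order_le_less_trans)
    qed
    have "k * s ^ DIM('a) = measure lborel (ball (x + l *\<^sub>R (x0 - x)) (l * \<rho>))"
      using l x0 R by (simp add: content_ball k_def l_def power_mult_distrib power_divide)
    also have "\<dots> \<le> measure lborel (D \<inter> ball x s)"
    proof (rule measure_mono_fmeasurable[OF sub])
      show "D \<inter> ball x s \<in> fmeasurable lborel"
        using D(1) s by (intro fmeasurableI2[OF _ Int_lower2] fmeasurableI sets.Int)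
          (auto simp: compact_imp_closed emeasure_ball)
    qed auto
    finally show ?thesis .
  qed
  moreover have "0 < k" using x0 R by (simp add: k_def)
  ultimately show thesis using that by blast
qed

lemma segment_tube_closed: "closed {x :: 'a::euclidean_space. infdist x (closed_segment u w) \<le> r}"
  by (intro closed_Collect_le continuous_intros)

text \<open>The tube is covered by \<open>J + 1\<close> balls of radius \<open>2 r\<close> centred on the segment, with spacing at most
  \<open>r\<close>.\<close>
lemma segment_tube_volume:
  fixes u w :: "'a::euclidean_space"
  assumes l: "dist u w \<le> l" "0 < l" and r: "0 < r"
  shows "emeasure lborel {x. infdist x (closed_segment u w) \<le> r}
    \<le> ennreal ((l / r + 2) * (unit_ball_vol (real DIM('a)) * (2 * r) ^ DIM('a)))"
proof -
  let ?v = "unit_ball_vol (real DIM('a)) * (2 * r) ^ DIM('a)"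
  define J where "J = nat \<lceil>l / r\<rceil>"
  have J: "0 < J" "l / r \<le> real J" "real J \<le> l / r + 1"
    using l r by (auto simp: J_def)
  define p where "p = (\<lambda>j. u + (real j / real J) *\<^sub>R (w - u))"
  have "{x. infdist x (closed_segment u w) \<le> r} \<subseteq> (\<Union>j\<in>{..J}. cball (p j) (2 * r))"
  proof clarify
    fix x assume x: "infdist x (closed_segment u w) \<le> r"
    obtain z where z: "z \<in> closed_segment u w" "infdist x (closed_segment u w) = dist x z"
      using infdist_attains_inf[of "closed_segment u w" x] by auto
    obtain t where t: "0 \<le> t" "t \<le> 1" "z = (1 - t) *\<^sub>R u + t *\<^sub>R w"
      using z(1) by (auto simp: closed_segment_def)
    define j where "j = nat \<lfloor>t * J\<rfloor>"
    have j: "real j \<le> t * J" "t * J \<le> real j + 1" using t by (auto simp: j_def)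
    have "t * J \<le> J" using t by (simp add: mult_left_le_one_le)
    then have "real j \<le> real J" using j(1) by linarith
    then have "j \<le> J" by simp
    have "z - p j = (t - real j / real J) *\<^sub>R (w - u)" by (simp add: t p_def algebra_simps)
    then have "dist z (p j) = \<bar>t - real j / real J\<bar> * dist u w" by (simp add: dist_norm norm_minus_commute)
    also have "\<bar>t - real j / real J\<bar> \<le> 1 / J"
    proof -
      have "\<bar>t * J - real j\<bar> \<le> 1" using j by linarith
      then have "\<bar>t * J - real j\<bar> / J \<le> 1 / J" by (intro divide_right_mono) auto
      also have "\<bar>t * J - real j\<bar> / J = \<bar>(t * J - real j) / J\<bar>" using J(1) by (simp add: abs_div)
      also have "(t * J - real j) / J = t - real j / real J" using J(1) by (simp add: diff_divide_distrib)
      finally show ?thesis .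
    qed
    also have "1 / J * dist u w \<le> r"
    proof -
      have "l \<le> real J * r" using J(2) r by (simp add: pos_divide_le_eq)
      then have "dist u w \<le> real J * r" using l by linarith
      then show ?thesis using J(1) by (simp add: pos_divide_le_eq mult.commute)
    qed
    finally have "dist z (p j) \<le> r" by (simp add: mult_right_mono)
    then have "dist x (p j) \<le> 2 * r" using x z dist_triangle[of x "p j" z] by linarith
    then show "x \<in> (\<Union>j\<in>{..J}. cball (p j) (2 * r))" using \<open>j \<le> J\<close> by (auto simp: dist_commute)
  qed
  then have "emeasure lborel {x. infdist x (closed_segment u w) \<le> r} \<le> emeasure lborel (\<Union>j\<in>{..J}. cball (p j) (2 * r))"
    by (intro emeasure_mono) auto
  also have "\<dots> \<le> (\<Sum>j\<in>{..J}. emeasure lborel (cball (p j) (2 * r)))"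
    by (intro emeasure_subadditive_finite) auto
  also have "\<dots> = (\<Sum>j\<in>{..J}. ennreal ?v)" using r by (simp add: emeasure_cball)
  also have "\<dots> = ennreal (real (Suc J) * ?v)"
    using r by (simp add: ennreal_mult'' ennreal_of_nat_eq_real_of_nat)
  also have "\<dots> \<le> ennreal ((l / r + 2) * ?v)"
    using J(3) r by (intro ennreal_leI mult_right_mono) auto
  finally show ?thesis .
qed

text \<open>This lets a finite family of tubes, with end points in a net, stand for all tubes.\<close>
lemma infdist_segment_perturb:
  fixes u w u' w' x :: "'a::euclidean_space"
  assumes "dist u u' \<le> r" "dist w w' \<le> r"
  shows "infdist x (closed_segment u' w') \<le> infdist x (closed_segment u w) + r"
proof -
  obtain z where z: "z \<in> closed_segment u w" "infdist x (closed_segment u w) = dist x z"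
    using infdist_attains_inf[of "closed_segment u w" x] by auto
  obtain t where t: "0 \<le> t" "t \<le> 1" "z = (1 - t) *\<^sub>R u + t *\<^sub>R w"
    using z(1) by (auto simp: closed_segment_def)
  \<comment> \<open>The point of the other segment with the same barycentric coordinates.\<close>
  define z' where "z' = (1 - t) *\<^sub>R u' + t *\<^sub>R w'"
  have "z - z' = (1 - t) *\<^sub>R (u - u') + t *\<^sub>R (w - w')" by (simp add: t z'_def algebra_simps)
  then have "dist z z' \<le> norm ((1 - t) *\<^sub>R (u - u')) + norm (t *\<^sub>R (w - w'))"
    unfolding dist_norm by (metis norm_triangle_ineq)
  also have "\<dots> = (1 - t) * dist u u' + t * dist w w'" using t by (simp add: dist_norm)
  also have "\<dots> \<le> (1 - t) * r + t * r" using t assms by (intro add_mono mult_left_mono) auto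
  finally have "dist z z' \<le> r" by (simp add: algebra_simps)
  moreover have "infdist x (closed_segment u' w') \<le> dist x z'"
    by (rule infdist_le) (use t in \<open>auto simp: closed_segment_def z'_def\<close>)
  ultimately show ?thesis using z dist_triangle[of x z' z] by linarith
qed

section \<open>Almost sure properties of the sample\<close>
locale uniform_sample = prob_space M for M :: "'w measure" +
  fixes D :: "'a::euclidean_space set" and \<rho> :: "'a \<Rightarrow> real" and X :: "nat \<Rightarrow> 'w \<Rightarrow> 'a" and c0 :: real
  assumes body: "convex_body D" and sample: "iid_sample M D \<rho> X"
    and c0_pos: "0 < c0" and density: "\<And>x. x \<in> D \<Longrightarrow> c0 \<le> \<rho> x \<and> \<rho> x \<le> 1 / c0"
begin

lemma D_borel [measurable]: "D \<in> sets borel"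
  using convex_body_facts(1)[OF body] by (simp add: compact_imp_closed)

lemma X_distributed: "1 \<le> i \<Longrightarrow> distributed M lborel (X i) (\<lambda>x. ennreal (\<rho> x) * indicator D x)"
  using sample by (simp add: iid_sample_def)

lemma X_measurable: "1 \<le> i \<Longrightarrow> X i \<in> borel_measurable M"
  using distributed_measurable[OF X_distributed] by simp

lemma X_vimage_sets: "1 \<le> i \<Longrightarrow> B \<in> sets borel \<Longrightarrow> X i -` B \<inter> space M \<in> sets M"
  using X_measurable measurable_sets by blast

lemma prob_independent:
  assumes "J \<noteq> {}" "finite J" "J \<subseteq> {1..}" "\<And>i. i \<in> J \<Longrightarrow> B i \<in> sets borel"
  shows "prob (\<Inter>i\<in>J. X i -` B i \<inter> space M) = (\<Prod>i\<in>J. prob (X i -` B i \<inter> space M))"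
  using sample assms unfolding iid_sample_def by (intro indep_varsD[of "\<lambda>_. borel" X "{1..}"]) auto

lemma AE_sample_in_D: "AE \<omega> in M. \<forall>i\<ge>1. X i \<omega> \<in> D"
  unfolding AE_all_countable
proof
  fix i show "AE \<omega> in M. 1 \<le> i \<longrightarrow> X i \<omega> \<in> D"
  proof (cases "1 \<le> i")
    case True
    have "(AE \<omega> in M. X i \<omega> \<in> D) \<longleftrightarrow> (AE x in lborel. 0 < ennreal (\<rho> x) * indicator D x \<longrightarrow> x \<in> D)"
      by (rule distributed_AE2[OF X_distributed[OF True]]) simp
    then show ?thesis by (auto simp: indicator_def)
  qed simp
qed

lemma prob_sample_lower:
  assumes i: "1 \<le> i" and B: "B \<in> sets borel"
  shows "c0 * measure lborel (D \<inter> B) \<le> prob (X i -` B \<inter> space M)"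
proof -
  have fin: "emeasure lborel (D \<inter> B) < \<infinity>"
    using emeasure_bounded_finite[of "D \<inter> B"] convex_body_facts(1)[OF body]
    by (auto intro: bounded_subset[OF compact_imp_bounded])
  have "ennreal c0 * emeasure lborel (D \<inter> B) = (\<integral>\<^sup>+x. ennreal c0 * indicator (D \<inter> B) x \<partial>lborel)"
    using B by (simp add: nn_integral_cmult_indicator)
  also have "\<dots> \<le> (\<integral>\<^sup>+x. ennreal (\<rho> x) * indicator D x * indicator B x \<partial>lborel)"
    using density by (intro nn_integral_mono) (auto simp: indicator_def intro: ennreal_leI)
  also have "\<dots> = emeasure M (X i -` B \<inter> space M)"
    using distributed_emeasure[OF X_distributed[OF i]] B by simp
  finally have "ennreal (c0 * measure lborel (D \<inter> B)) \<le> ennreal (prob (X i -` B \<inter> space M))"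
    using fin c0_pos by (simp add: emeasure_eq_measure emeasure_eq_ennreal_measure ennreal_mult')
  then show ?thesis by simp
qed

lemma prob_sample_upper:
  assumes i: "1 \<le> i" and B: "B \<in> sets borel" and v: "emeasure lborel B \<le> ennreal v" "0 \<le> v"
  shows "prob (X i -` B \<inter> space M) \<le> v / c0"
proof -
  have "emeasure M (X i -` B \<inter> space M) = (\<integral>\<^sup>+x. ennreal (\<rho> x) * indicator D x * indicator B x \<partial>lborel)"
    using distributed_emeasure[OF X_distributed[OF i]] B by simp
  also have "\<dots> \<le> (\<integral>\<^sup>+x. ennreal (1 / c0) * indicator B x \<partial>lborel)"
    using density by (intro nn_integral_mono) (auto simp: indicator_def intro: ennreal_leI)
  also have "\<dots> = ennreal (1 / c0) * emeasure lborel B" using B by (simp add: nn_integral_cmult_indicator)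
  also have "\<dots> \<le> ennreal (1 / c0) * ennreal v" using v by (intro mult_left_mono) auto
  also have "\<dots> = ennreal (v / c0)" using c0_pos v by (simp add: ennreal_mult[symmetric])
  finally show ?thesis using v c0_pos by (simp add: emeasure_eq_measure)
qed

lemma AE_eventually_not_in:
  assumes "\<And>n. A n \<in> sets M" "\<forall>\<^sub>F n in sequentially. prob (A n) \<le> K * real n powr (-2)"
  shows "AE \<omega> in M. \<forall>\<^sub>F n in sequentially. \<omega> \<notin> A n"
proof -
  have "summable (\<lambda>n. K * real n powr (-2))"
    by (intro summable_mult) (simp add: summable_real_powr_iff)
  then have "summable (\<lambda>n. prob (A n))"
    by (rule summable_comparison_test_ev[rotated]) (use assms(2) in \<open>simp add: measure_nonneg\<close>)
  from borel_cantelli_AE1[OF assms(1) _ this]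
  have "AE \<omega> in M. \<forall>\<^sub>F n in sequentially. \<omega> \<in> space M - A n" by (simp add: less_top[symmetric])
  then show ?thesis by eventually_elim (auto elim: eventually_mono)
qed

text \<open>Let \<open>s = \<kappa> \<epsilon> / 2\<close>.  If every ball of radius \<open>s\<close> around a point of an \<open>s\<close>-net contains a sample point,
  then every point of \<open>D\<close> is within \<open>2 s\<close> of the sample.  The net has \<open>O(\<epsilon>\<^sup>-\<^sup>d) = O(n)\<close> points, and
  each ball is missed with probability at most \<open>exp (- q n \<epsilon>\<^sup>d) \<le> n\<^sup>-\<^sup>3\<close>, since \<open>q n \<epsilon>\<^sup>d\<close> is at
  least \<open>3 ln n\<close>.\<close>
lemma AE_sample_dense:
  assumes \<epsilon>: "\<And>n. 1 \<le> n \<Longrightarrow> 0 < \<epsilon> n" "\<epsilon> \<longlonglongrightarrow> 0"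
    and growth: "(\<lambda>n. ln (real n) powr (1 / real DIM('a)) / real n powr (1 / real DIM('a)) * (1 / \<epsilon> n)) \<longlonglongrightarrow> 0"
    and \<kappa>: "0 < \<kappa>"
  shows "AE \<omega> in M. \<forall>\<^sub>F n in sequentially. \<forall>x\<in>D. \<exists>i\<in>{1..n}. dist x (X i \<omega>) \<le> \<kappa> * \<epsilon> n"
proof -
  let ?d = "DIM('a)"
  obtain C where C: "0 < C"
    "\<And>r. 0 < r \<Longrightarrow> r \<le> 1 \<Longrightarrow> \<exists>A. finite A \<and> A \<subseteq> D \<and> real (card A) \<le> C * (1 / r) ^ ?d \<and> (\<forall>x\<in>D. \<exists>y\<in>A. dist x y < r)"
    using finite_net[of D] compact_imp_bounded[OF convex_body_facts(1)[OF body]] by metis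
  obtain k where k: "0 < k"
    "\<And>x s. x \<in> D \<Longrightarrow> 0 < s \<Longrightarrow> s \<le> 1 \<Longrightarrow> k * s ^ ?d \<le> measure lborel (D \<inter> ball x s)"
    using convex_body_ball_volume[OF body] by metis
  define s where "s = (\<lambda>n. \<kappa> * \<epsilon> n / 2)"
  \<comment> \<open>The volume estimates hold for small radii only, that is, for large \<open>n\<close>.\<close>
  define good where "good = (\<lambda>n. 0 < s n \<and> s n \<le> 1)"
  have "\<forall>n. \<exists>A. finite A \<and> A \<subseteq> D \<and> (good n \<longrightarrow> real (card A) \<le> C * (1 / s n) ^ ?d \<and> (\<forall>x\<in>D. \<exists>y\<in>A. dist x y < s n))"
    using C(2) unfolding good_def by (metis empty_subsetI finite.emptyI)
  then obtain A where A: "\<And>n. finite (A n)" "\<And>n. A n \<subseteq> D"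
    "\<And>n. good n \<Longrightarrow> real (card (A n)) \<le> C * (1 / s n) ^ ?d"
    "\<And>n x. good n \<Longrightarrow> x \<in> D \<Longrightarrow> \<exists>y\<in>A n. dist x y < s n" by metis
  define miss where "miss = (\<lambda>n y. \<Inter>i\<in>{1..n}. X i -` (- ball y (s n)) \<inter> space M)"
  define Bad where "Bad = (\<lambda>n. if n = 0 then {} else (\<Union>y\<in>A n. miss n y))"
  have miss_sets: "miss n y \<in> sets M" if "0 < n" for n y
    unfolding miss_def using that by (intro sets.finite_INT X_vimage_sets) auto
  have Bad_sets: "Bad n \<in> sets M" for n
    unfolding Bad_def using miss_sets A(1) by auto
  define q where "q = c0 * k * (\<kappa> / 2) ^ ?d"
  have q: "0 < q" using c0_pos k \<kappa> by (simp add: q_def)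
  have prob_miss: "prob (miss n y) \<le> exp (- (real n * (q * \<epsilon> n ^ ?d)))" if n: "0 < n" "good n" and y: "y \<in> D" for n y
  proof -
    have one: "prob (X i -` (- ball y (s n)) \<inter> space M) \<le> exp (- (q * \<epsilon> n ^ ?d))" if i: "1 \<le> i" for i
    proof -
      have "X i -` (- ball y (s n)) \<inter> space M = space M - (X i -` ball y (s n) \<inter> space M)" by auto
      then have "prob (X i -` (- ball y (s n)) \<inter> space M) = 1 - prob (X i -` ball y (s n) \<inter> space M)"
        using X_vimage_sets[OF i] by (simp add: prob_compl)
      also have "\<dots> \<le> 1 - c0 * measure lborel (D \<inter> ball y (s n))"
        using prob_sample_lower[OF i, of "ball y (s n)"] by simp
      also have "\<dots> \<le> 1 - c0 * (k * s n ^ ?d)"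
        using k(2)[OF y, of "s n"] n c0_pos by (simp add: good_def)
      also have "c0 * (k * s n ^ ?d) = q * \<epsilon> n ^ ?d" by (simp add: q_def s_def power_mult_distrib power_divide)
      also have "1 - q * \<epsilon> n ^ ?d \<le> exp (- (q * \<epsilon> n ^ ?d))" using exp_ge_add_one_self[of "- (q * \<epsilon> n ^ ?d)"] by simp
      finally show ?thesis .
    qed
    have "prob (miss n y) = (\<Prod>i\<in>{1..n}. prob (X i -` (- ball y (s n)) \<inter> space M))"
      unfolding miss_def using n by (intro prob_independent) auto
    also have "\<dots> \<le> (\<Prod>i\<in>{1..n}. exp (- (q * \<epsilon> n ^ ?d)))"
      using one by (intro prod_mono) auto
    also have "\<dots> = exp (- (real n * (q * \<epsilon> n ^ ?d)))" by (simp add: exp_of_nat_mult[symmetric])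
    finally show ?thesis .
  qed
  have ev_good: "\<forall>\<^sub>F n in sequentially. good n"
  proof -
    have "s \<longlonglongrightarrow> \<kappa> * 0 / 2" unfolding s_def by (intro tendsto_intros \<epsilon>(2)) auto
    then have "\<forall>\<^sub>F n in sequentially. s n < 1" by (intro order_tendstoD(2)) auto
    then show ?thesis using eventually_ge_at_top[of 1]
      by eventually_elim (use \<epsilon>(1) \<kappa> in \<open>simp add: good_def s_def\<close>)
  qed
  \<comment> \<open>The factor \<open>3 / q\<close> gives the bound \<open>n\<^sup>-\<^sup>3\<close> for one ball, the factor \<open>1\<close> bounds the size of the net.\<close>
  define Q where "Q = max 1 (3 / q)"
  have Q: "1 \<le> Q" "3 \<le> q * Q" using q by (auto simp: Q_def max_def field_simps)
  have ev_growth: "\<forall>\<^sub>F n in sequentially. Q * ln (real n) \<le> real n * \<epsilon> n ^ ?d"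
  proof -
    define \<eta> where "\<eta> = (1 / Q) powr (1 / real ?d)"
    have \<eta>: "0 < \<eta>" using Q by (simp add: \<eta>_def)
    have "\<forall>\<^sub>F n in sequentially. ln (real n) powr (1 / real ?d) / real n powr (1 / real ?d) * (1 / \<epsilon> n) < \<eta>"
      by (rule order_tendstoD(2)[OF growth \<eta>])
    then show ?thesis using eventually_ge_at_top[of 3]
    proof eventually_elim
      case (elim n)
      have e: "0 < \<epsilon> n" using \<epsilon>(1) elim by simp
      have ln: "0 < ln (real n)" using elim by simp
      have "(ln (real n) / real n) powr (1 / real ?d) < \<eta> * \<epsilon> n"
        using elim e ln by (simp add: powr_divide field_simps)
      then have "((ln (real n) / real n) powr (1 / real ?d)) powr real ?d \<le> (\<eta> * \<epsilon> n) powr real ?d"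
        by (intro powr_mono2) auto
      also have "((ln (real n) / real n) powr (1 / real ?d)) powr real ?d = ln (real n) / real n"
        using ln by (simp add: powr_powr)
      also have "(\<eta> * \<epsilon> n) powr real ?d = (1 / Q) * \<epsilon> n ^ ?d"
        using \<eta> e Q by (simp add: powr_mult \<eta>_def powr_powr powr_realpow)
      finally show ?case using elim(2) Q by (simp add: field_simps)
    qed
  qed
  define K where "K = C * (2 / \<kappa>) ^ ?d"
  have "\<forall>\<^sub>F n in sequentially. prob (Bad n) \<le> K * real n powr (-2)"
    using ev_good ev_growth eventually_ge_at_top[of 3]
  proof eventually_elim
    case (elim n)
    have e: "0 < \<epsilon> n" using \<epsilon>(1) elim by simp
    have "1 \<le> ln (real n)"
    proof -
      have "exp 1 \<le> real n" using elim(3) e_less_272 by linarith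
      then show ?thesis using elim(3) by (simp add: ln_ge_iff)
    qed
    then have "1 * 1 \<le> Q * ln (real n)" using Q by (intro mult_mono) auto
    then have le1: "1 \<le> real n * \<epsilon> n ^ ?d" using elim(2) by linarith
    have "q * (Q * ln (real n)) \<le> q * (real n * \<epsilon> n ^ ?d)" using elim(2) q by (intro mult_left_mono) auto
    moreover have "3 * ln (real n) \<le> q * Q * ln (real n)" using Q \<open>1 \<le> ln (real n)\<close> by (intro mult_right_mono) auto
    ultimately have le3: "3 * ln (real n) \<le> real n * (q * \<epsilon> n ^ ?d)" by (simp add: mult_ac)
    have "prob (Bad n) \<le> (\<Sum>y\<in>A n. prob (miss n y))"
      unfolding Bad_def using elim A(1) miss_sets by (auto intro!: finite_measure_subadditive_finite)
    also have "\<dots> \<le> (\<Sum>y\<in>A n. real n powr (-3))"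
    proof (rule sum_mono)
      fix y assume "y \<in> A n"
      then have "prob (miss n y) \<le> exp (- (real n * (q * \<epsilon> n ^ ?d)))"
        using A(2) elim by (intro prob_miss) auto
      also have "\<dots> \<le> exp (- (3 * ln (real n)))" using le3 by simp
      also have "\<dots> = real n powr (-3)" using elim by (simp add: powr_def)
      finally show "prob (miss n y) \<le> real n powr (-3)" .
    qed
    also have "\<dots> = real (card (A n)) * real n powr (-3)" by simp
    also have "\<dots> \<le> (K * real n) * real n powr (-3)"
    proof (rule mult_right_mono)
      have "real (card (A n)) \<le> C * (1 / s n) ^ ?d" by (rule A(3)[OF elim(1)])
      also have "\<dots> = K * (1 / \<epsilon> n ^ ?d)" by (simp add: s_def K_def power_mult_distrib power_divide)
      also have "\<dots> \<le> K * real n"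
        using le1 e C(1) \<kappa> by (intro mult_left_mono) (auto simp: K_def divide_le_eq)
      finally show "real (card (A n)) \<le> K * real n" .
    qed simp
    also have "\<dots> = K * real n powr (-2)"
      using elim powr_add[of "real n" 1 "-3"] by simp
    finally show ?case .
  qed
  then have "AE \<omega> in M. \<forall>\<^sub>F n in sequentially. \<omega> \<notin> Bad n"
    by (intro AE_eventually_not_in Bad_sets)
  then show ?thesis
  proof (rule AE_mp, intro AE_I2 impI)
    fix \<omega> assume \<omega>: "\<omega> \<in> space M" "\<forall>\<^sub>F n in sequentially. \<omega> \<notin> Bad n"
    show "\<forall>\<^sub>F n in sequentially. \<forall>x\<in>D. \<exists>i\<in>{1..n}. dist x (X i \<omega>) \<le> \<kappa> * \<epsilon> n"
      using \<omega>(2) ev_good eventually_ge_at_top[of 1]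
    proof eventually_elim
      case (elim n)
      show ?case
      proof
        fix x assume "x \<in> D"
        then obtain y where y: "y \<in> A n" "dist x y < s n" using A(4)[OF elim(2)] by blast
        then have "\<omega> \<notin> miss n y" using elim by (auto simp: Bad_def)
        have "\<exists>i\<in>{1..n}. dist y (X i \<omega>) < s n"
        proof (rule ccontr)
          assume "\<not> ?thesis"
          then have "\<omega> \<in> miss n y" using \<omega>(1) elim(3) unfolding miss_def by auto
          then show False using \<open>\<omega> \<notin> miss n y\<close> by simp
        qed
        then obtain i where i: "i \<in> {1..n}" "dist y (X i \<omega>) < s n" by blast
        then have "dist x (X i \<omega>) \<le> \<kappa> * \<epsilon> n"
          using y dist_triangle[of x "X i \<omega>" y] by (simp add: s_def)
        then show "\<exists>i\<in>{1..n}. dist x (X i \<omega>) \<le> \<kappa> * \<epsilon> n" using i by blast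
      qed
    qed
  qed
qed

text \<open>A sample point falls into a given tube with probability \<open>O(n powr (- \<theta> - 1))\<close>, so by independence
  and a union bound over the sets of \<open>N\<close> indices, some \<open>N\<close> of the first \<open>n\<close> points do so with
  probability \<open>O(n powr (- \<theta> N))\<close>.  The number of tubes with end points in a net grows only polynomially, so a fixed
  large \<open>N\<close> makes the probability that any of them contains \<open>N\<close> points summable.\<close>
lemma AE_tubes_sparse:
  assumes \<alpha>: "1 < \<alpha>" and \<delta>: "0 < \<delta>" "1 < \<delta> * (\<alpha> * (real DIM('a) - 1) + 1)"
    and \<epsilon>: "\<And>n. 1 \<le> n \<Longrightarrow> \<epsilon> n = real n powr (- \<delta>)"
  obtains k where "AE \<omega> in M. \<forall>\<^sub>F n in sequentially. \<forall>u\<in>D. \<forall>w\<in>D. dist u w < \<epsilon> n \<longrightarrow>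
     card {i \<in> {1..n}. infdist (X i \<omega>) (closed_segment u w) \<le> \<epsilon> n powr \<alpha>} \<le> k"
proof -
  let ?d = "DIM('a)"
  define \<theta> where "\<theta> = \<delta> * (\<alpha> * (real ?d - 1) + 1) - 1"
  have \<theta>: "0 < \<theta>" using \<delta> by (simp add: \<theta>_def)
  obtain k where k: "(2 * real ?d * \<alpha> * \<delta> + 2) / \<theta> \<le> real (Suc k)"
    using real_arch_simple[of "(2 * real ?d * \<alpha> * \<delta> + 2) / \<theta>"] by (metis of_nat_Suc le_add_same_cancel1 order_trans zero_le_one add.commute)
  define N where "N = Suc k"
  have N: "2 * real ?d * \<alpha> * \<delta> + 2 \<le> \<theta> * real N" "N \<noteq> 0"
    using k \<theta> by (auto simp: N_def field_simps)
  obtain C where C: "0 < C"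
    "\<And>r. 0 < r \<Longrightarrow> r \<le> 1 \<Longrightarrow> \<exists>A. finite A \<and> A \<subseteq> D \<and> real (card A) \<le> C * (1 / r) ^ ?d \<and> (\<forall>x\<in>D. \<exists>y\<in>A. dist x y < r)"
    using finite_net[of D] compact_imp_bounded[OF convex_body_facts(1)[OF body]] by metis
  define r where "r = (\<lambda>n. real n powr (- \<delta> * \<alpha>))"
  have r_eq: "\<epsilon> n powr \<alpha> = r n" if "1 \<le> n" for n using \<epsilon>[OF that] by (simp add: r_def powr_powr)
  have r01: "0 < r n" "r n \<le> 1" "r n \<le> \<epsilon> n" "0 < \<epsilon> n" if n: "1 \<le> n" for n
  proof -
    show "0 < r n" "0 < \<epsilon> n" using n \<epsilon>[OF n] by (auto simp: r_def)
    have "r n \<le> real n powr 0" unfolding r_def using n \<delta> \<alpha> by (intro powr_mono) auto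
    then show "r n \<le> 1" using n by simp
    show "r n \<le> \<epsilon> n" unfolding r_def \<epsilon>[OF n] using n \<delta> \<alpha> by (intro powr_mono) auto
  qed
  have "\<forall>n. \<exists>A. finite A \<and> A \<subseteq> D \<and> (1 \<le> n \<longrightarrow> real (card A) \<le> C * (1 / r n) ^ ?d \<and> (\<forall>x\<in>D. \<exists>y\<in>A. dist x y < r n))"
    using C(2) r01 by (metis empty_subsetI finite.emptyI)
  then obtain A where A: "\<And>n. finite (A n)" "\<And>n. A n \<subseteq> D"
    "\<And>n. 1 \<le> n \<Longrightarrow> real (card (A n)) \<le> C * (1 / r n) ^ ?d"
    "\<And>n x. 1 \<le> n \<Longrightarrow> x \<in> D \<Longrightarrow> \<exists>y\<in>A n. dist x y < r n" by metis
  define T where "T = (\<lambda>n u w. {x :: 'a. infdist x (closed_segment u w) \<le> 2 * r n})"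
  have T_borel: "T n u w \<in> sets borel" for n u w unfolding T_def using segment_tube_closed by (rule borel_closed)
  define \<S> where "\<S> = (\<lambda>n::nat. {S. S \<subseteq> {1..n} \<and> card S = N})"
  have fin_S: "finite (\<S> n)" for n unfolding \<S>_def by (rule finite_subset[of _ "Pow {1..n}"]) auto
  have \<S>: "S \<noteq> {}" "finite S" "S \<subseteq> {1..}" "card S = N" if "S \<in> \<S> n" for S n
    using that N(2) finite_subset[of S "{1..n}"] by (auto simp: \<S>_def)
  define hit where "hit = (\<lambda>n u w S. \<Inter>i\<in>S. X i -` T n u w \<inter> space M)"
  \<comment> \<open>Moving both ends of a segment shorter than \<open>\<epsilon>\<close> by at most \<open>r \<le> \<epsilon>\<close> gives a length of at most \<open>3 \<epsilon>\<close>.\<close>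
  define P where "P = (\<lambda>n. {(u, w). u \<in> A n \<and> w \<in> A n \<and> dist u w \<le> 3 * \<epsilon> n})"
  have P: "finite (P n)" "card (P n) \<le> card (A n) * card (A n)" for n
  proof -
    have "P n \<subseteq> A n \<times> A n" by (auto simp: P_def)
    moreover have "finite (A n \<times> A n)" using A(1) by simp
    ultimately show "finite (P n)" "card (P n) \<le> card (A n) * card (A n)"
      using card_mono[of "A n \<times> A n" "P n"] by (auto intro: finite_subset simp: card_cartesian_product)
  qed
  define Bad where "Bad = (\<lambda>n. \<Union>(u, w)\<in>P n. \<Union>S\<in>\<S> n. hit n u w S)"
  have hit_sets: "hit n u w S \<in> sets M" if "S \<in> \<S> n" for n u w S
    unfolding hit_def using \<S>[OF that] T_borel by (intro sets.finite_INT X_vimage_sets) auto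
  have cell_sets: "(case x of (u, w) \<Rightarrow> \<Union>S\<in>\<S> n. hit n u w S) \<in> sets M" for n x
    by (cases x) (auto intro!: sets.finite_UN hit_sets fin_S)
  have Bad_sets: "Bad n \<in> sets M" for n
    unfolding Bad_def using P(1) cell_sets by (intro sets.finite_UN)
  define \<beta> where "\<beta> = 4 ^ ?d * 4 * unit_ball_vol (real ?d) / c0"
  have \<beta>: "0 \<le> \<beta>" using c0_pos by (simp add: \<beta>_def)
  have prob_hit: "prob (hit n u w S) \<le> (\<beta> * real n powr (- \<theta> - 1)) ^ N"
    if n: "1 \<le> n" and uw: "(u, w) \<in> P n" and S: "S \<in> \<S> n" for n u w S
  proof -
    have "emeasure lborel (T n u w) \<le> ennreal ((3 * \<epsilon> n / (2 * r n) + 2) * (unit_ball_vol (real ?d) * (2 * (2 * r n)) ^ ?d))"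
      unfolding T_def using r01[OF n] uw by (intro segment_tube_volume) (auto simp: P_def)
    also have "\<dots> \<le> ennreal (c0 * (\<beta> * (\<epsilon> n / r n * r n ^ ?d)))"
    proof (rule ennreal_leI)
      have "1 \<le> \<epsilon> n / r n" using r01[OF n] by simp
      then have "3 * \<epsilon> n / (2 * r n) + 2 \<le> 4 * (\<epsilon> n / r n)" by (simp add: field_simps)
      then have "(3 * \<epsilon> n / (2 * r n) + 2) * (unit_ball_vol (real ?d) * (2 * (2 * r n)) ^ ?d)
          \<le> 4 * (\<epsilon> n / r n) * (unit_ball_vol (real ?d) * (2 * (2 * r n)) ^ ?d)"
        using r01[OF n] by (intro mult_right_mono) auto
      also have "\<dots> = c0 * (\<beta> * (\<epsilon> n / r n * r n ^ ?d))"
        using c0_pos by (simp add: \<beta>_def power_mult_distrib)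
      finally show "(3 * \<epsilon> n / (2 * r n) + 2) * (unit_ball_vol (real ?d) * (2 * (2 * r n)) ^ ?d)
          \<le> c0 * (\<beta> * (\<epsilon> n / r n * r n ^ ?d))" .
    qed
    also have "\<epsilon> n / r n * r n ^ ?d = real n powr (- \<theta> - 1)"
    proof -
      have "\<epsilon> n / r n * r n ^ ?d = real n powr (- \<delta>) / real n powr (- \<delta> * \<alpha>) * real n powr (- \<delta> * \<alpha> * real ?d)"
        using n r01[OF n] by (simp add: \<epsilon>[OF n] r_def powr_realpow[symmetric] powr_powr)
      also have "\<dots> = real n powr (- \<delta> - (- \<delta> * \<alpha>) + - \<delta> * \<alpha> * real ?d)"
        by (simp only: powr_diff powr_add)
      also have "- \<delta> - (- \<delta> * \<alpha>) + - \<delta> * \<alpha> * real ?d = - \<theta> - 1" by (simp add: \<theta>_def algebra_simps)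
      finally show ?thesis .
    qed
    finally have vol: "emeasure lborel (T n u w) \<le> ennreal (c0 * (\<beta> * real n powr (- \<theta> - 1)))" .
    have one: "prob (X i -` T n u w \<inter> space M) \<le> \<beta> * real n powr (- \<theta> - 1)" if "1 \<le> i" for i
      using prob_sample_upper[OF that T_borel vol] c0_pos \<beta> by simp
    have "prob (hit n u w S) = (\<Prod>i\<in>S. prob (X i -` T n u w \<inter> space M))"
      unfolding hit_def using \<S>[OF S] T_borel by (intro prob_independent) auto
    also have "\<dots> \<le> (\<Prod>i\<in>S. \<beta> * real n powr (- \<theta> - 1))"
      using one \<S>[OF S] by (intro prod_mono) (auto simp: subset_iff)
    also have "\<dots> = (\<beta> * real n powr (- \<theta> - 1)) ^ N" using \<S>[OF S] by simp
    finally show ?thesis .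
  qed
  have "\<forall>\<^sub>F n in sequentially. prob (Bad n) \<le> (C\<^sup>2 * \<beta> ^ N) * real n powr (-2)"
    using eventually_ge_at_top[of 1]
  proof eventually_elim
    case (elim n)
    let ?p = "(\<beta> * real n powr (- \<theta> - 1)) ^ N"
    have p0: "0 \<le> ?p" using \<beta> by simp
    have "prob (Bad n) \<le> (\<Sum>x\<in>P n. prob (case x of (u, w) \<Rightarrow> \<Union>S\<in>\<S> n. hit n u w S))"
      unfolding Bad_def using P(1) cell_sets by (intro finite_measure_subadditive_finite) auto
    also have "\<dots> = (\<Sum>(u, w)\<in>P n. prob (\<Union>S\<in>\<S> n. hit n u w S))"
      by (intro sum.cong) auto
    also have "\<dots> \<le> (\<Sum>(u, w)\<in>P n. real (n ^ N) * ?p)"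
    proof (rule sum_mono, clarify)
      fix u w assume uw: "(u, w) \<in> P n"
      have "prob (\<Union>S\<in>\<S> n. hit n u w S) \<le> (\<Sum>S\<in>\<S> n. prob (hit n u w S))"
        using hit_sets fin_S by (intro finite_measure_subadditive_finite) auto
      also have "\<dots> \<le> (\<Sum>S\<in>\<S> n. ?p)" by (intro sum_mono prob_hit[OF elim uw])
      also have "\<dots> = real (card (\<S> n)) * ?p" by simp
      also have "\<dots> \<le> real (n ^ N) * ?p"
      proof (rule mult_right_mono[OF _ p0], rule of_nat_mono)
        have "card (\<S> n) = n choose N" unfolding \<S>_def using n_subsets[of "{1..n}" N] by simp
        then show "card (\<S> n) \<le> n ^ N"
          using binomial_le_pow[of N n] binomial_eq_0[of n N] by (cases "N \<le> n") auto
      qed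
      finally show "prob (\<Union>S\<in>\<S> n. hit n u w S) \<le> real (n ^ N) * ?p" .
    qed
    also have "\<dots> = real (card (P n)) * (real (n ^ N) * ?p)" by (simp add: split_def)
    also have "\<dots> \<le> (C * (1 / r n) ^ ?d)\<^sup>2 * (real (n ^ N) * ?p)"
    proof (rule mult_right_mono)
      have "real (card (P n)) \<le> real (card (A n)) * real (card (A n))"
        using P(2)[of n] by (metis of_nat_mono of_nat_mult)
      also have "\<dots> \<le> (C * (1 / r n) ^ ?d) * (C * (1 / r n) ^ ?d)"
        using A(3)[OF elim] by (intro mult_mono) auto
      finally show "real (card (P n)) \<le> (C * (1 / r n) ^ ?d)\<^sup>2" by (simp add: power2_eq_square)
    qed (use p0 in simp)
    also have "\<dots> = C\<^sup>2 * \<beta> ^ N * real n powr (2 * real ?d * \<alpha> * \<delta> - \<theta> * real N)"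
    proof -
      have 1: "(1 / r n) ^ ?d = real n powr (real ?d * \<alpha> * \<delta>)"
        using elim by (simp add: r_def powr_minus_divide powr_realpow[symmetric] powr_powr mult_ac)
      have 2: "(real n powr (- \<theta> - 1)) ^ N = real n powr ((- \<theta> - 1) * real N)"
        using elim by (simp add: powr_realpow[symmetric] powr_powr)
      have 3: "real (n ^ N) = real n powr real N" using elim by (simp add: powr_realpow)
      have "(C * (1 / r n) ^ ?d)\<^sup>2 * (real (n ^ N) * ?p) =
          C\<^sup>2 * \<beta> ^ N * (real n powr (real ?d * \<alpha> * \<delta>) * real n powr (real ?d * \<alpha> * \<delta>) *
            (real n powr real N * real n powr ((- \<theta> - 1) * real N)))"
        unfolding 1 3 power_mult_distrib 2 by (simp add: power2_eq_square mult_ac)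
      also have "\<dots> = C\<^sup>2 * \<beta> ^ N * real n powr (real ?d * \<alpha> * \<delta> + real ?d * \<alpha> * \<delta> + (real N + (- \<theta> - 1) * real N))"
        by (simp only: powr_add)
      also have "real ?d * \<alpha> * \<delta> + real ?d * \<alpha> * \<delta> + (real N + (- \<theta> - 1) * real N) = 2 * real ?d * \<alpha> * \<delta> - \<theta> * real N"
        by (simp add: algebra_simps)
      finally show ?thesis .
    qed
    also have "\<dots> \<le> (C\<^sup>2 * \<beta> ^ N) * real n powr (-2)"
      using N(1) elim \<beta> by (intro mult_left_mono powr_mono) auto
    finally show ?case .
  qed
  then have "AE \<omega> in M. \<forall>\<^sub>F n in sequentially. \<omega> \<notin> Bad n"
    by (intro AE_eventually_not_in Bad_sets)
  then have "AE \<omega> in M. \<forall>\<^sub>F n in sequentially. \<forall>u\<in>D. \<forall>w\<in>D. dist u w < \<epsilon> n \<longrightarrow>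
     card {i \<in> {1..n}. infdist (X i \<omega>) (closed_segment u w) \<le> \<epsilon> n powr \<alpha>} \<le> k"
  proof (rule AE_mp, intro AE_I2 impI)
    fix \<omega> assume \<omega>: "\<omega> \<in> space M" "\<forall>\<^sub>F n in sequentially. \<omega> \<notin> Bad n"
    show "\<forall>\<^sub>F n in sequentially. \<forall>u\<in>D. \<forall>w\<in>D. dist u w < \<epsilon> n \<longrightarrow>
       card {i \<in> {1..n}. infdist (X i \<omega>) (closed_segment u w) \<le> \<epsilon> n powr \<alpha>} \<le> k"
      using \<omega>(2) eventually_ge_at_top[of 1]
    proof eventually_elim
      case (elim n)
      show ?case
      proof (intro ballI impI, rule ccontr)
        fix u w assume uw: "u \<in> D" "w \<in> D" "dist u w < \<epsilon> n"
          and many: "\<not> card {i \<in> {1..n}. infdist (X i \<omega>) (closed_segment u w) \<le> \<epsilon> n powr \<alpha>} \<le> k"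
        obtain u' w' where u': "u' \<in> A n" "dist u u' < r n" and w': "w' \<in> A n" "dist w w' < r n"
          using A(4)[OF elim(2) uw(1)] A(4)[OF elim(2) uw(2)] by blast
        have "dist u' w' \<le> dist u u' + dist u w + dist w w'"
          by (smt (verit) dist_commute dist_triangle)
        then have "dist u' w' \<le> 3 * \<epsilon> n" using u' w' uw r01[OF elim(2)] by linarith
        then have inP: "(u', w') \<in> P n" using u' w' by (simp add: P_def)
        have "N \<le> card {i \<in> {1..n}. infdist (X i \<omega>) (closed_segment u w) \<le> \<epsilon> n powr \<alpha>}"
          using many by (simp add: N_def)
        then obtain S where S: "S \<subseteq> {i \<in> {1..n}. infdist (X i \<omega>) (closed_segment u w) \<le> \<epsilon> n powr \<alpha>}" "card S = N"
          by (rule obtain_subset_with_card_n)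
        then have "S \<in> \<S> n" by (auto simp: \<S>_def)
        moreover have "\<omega> \<in> hit n u' w' S"
          unfolding hit_def T_def
        proof (intro INT_I, clarsimp simp: \<omega>(1))
          fix i assume "i \<in> S"
          then have "infdist (X i \<omega>) (closed_segment u w) \<le> r n" using S(1) r_eq[OF elim(2)] by auto
          then show "infdist (X i \<omega>) (closed_segment u' w') \<le> 2 * r n"
            using infdist_segment_perturb[of u u' "r n" w w' "X i \<omega>"] u' w' by simp
        qed
        ultimately have "\<omega> \<in> Bad n" unfolding Bad_def using inP by blast
        then show False using elim by simp
      qed
    qed
  qed
  then show thesis by (rule that)
qed

end

section \<open>Convergence of optimal paths\<close>
lemma haus_dist_bounds:
  fixes A B :: "'a::euclidean_space set"
  assumes "A \<noteq> {}" "B \<noteq> {}" "bounded A" "bounded B"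
    and AB: "\<And>x. x \<in> A \<Longrightarrow> \<exists>y\<in>B. dist x y \<le> e" and BA: "\<And>y. y \<in> B \<Longrightarrow> \<exists>x\<in>A. dist x y \<le> e"
  shows "0 \<le> haus_dist A B" "haus_dist A B \<le> e"
proof -
  have up: "(INF y\<in>B. norm (x - y)) \<le> e" if "x \<in> A" for x
  proof -
    obtain y where "y \<in> B" "dist x y \<le> e" using AB[OF \<open>x \<in> A\<close>] by blast
    then show ?thesis by (intro cINF_lower2[of _ _ y] bdd_belowI2[of _ 0]) (auto simp: dist_norm)
  qed
  have up': "(INF x\<in>A. norm (x - y)) \<le> e" if "y \<in> B" for y
  proof -
    obtain x where "x \<in> A" "dist x y \<le> e" using BA[OF \<open>y \<in> B\<close>] by blast
    then show ?thesis by (intro cINF_lower2[of _ _ x] bdd_belowI2[of _ 0]) (auto simp: dist_norm)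
  qed
  show "haus_dist A B \<le> e"
    unfolding haus_dist_def using assms(1,2) up up' by (intro max.boundedI cSUP_least) auto
  obtain a where a: "a \<in> A" using assms by blast
  have "0 \<le> (INF y\<in>B. norm (a - y))" using assms(2) by (intro cINF_greatest) auto
  also have "\<dots> \<le> (SUP x\<in>A. INF y\<in>B. norm (x - y))"
    using up by (intro cSUP_upper[OF a] bdd_aboveI2[of _ _ e]) auto
  finally show "0 \<le> haus_dist A B" unfolding haus_dist_def by simp
qed

lemma haus_dist_linear_path:
  fixes vs :: "'a::euclidean_space list"
  assumes len: "2 \<le> length vs" and step: "\<And>i. Suc i < length vs \<Longrightarrow> dist (vs ! i) (vs ! Suc i) \<le> h"
    and near: "\<And>t. t \<in> {0..1} \<Longrightarrow> dist (linear_path vs t) (\<gamma> t) \<le> e" and h: "0 \<le> h"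
    and bdd: "bounded (path_image \<gamma>)"
  shows "0 \<le> haus_dist (set vs) (path_image \<gamma>)" "haus_dist (set vs) (path_image \<gamma>) \<le> e + h"
proof -
  obtain m where m: "length vs = Suc m" "0 < m" using len by (cases "length vs") auto
  have AB: "\<exists>y\<in>path_image \<gamma>. dist x y \<le> e + h" if "x \<in> set vs" for x
  proof -
    obtain i where "i < length vs" "vs ! i = x" using \<open>x \<in> set vs\<close> unfolding in_set_conv_nth by blast
    then have i: "i \<le> m" "x = vs ! i" using m(1) by auto
    have "real i / real m \<in> {0..1}" using i m by auto
    from near[OF this] have "dist x (\<gamma> (real i / real m)) \<le> e + h"
      using linear_path_node[OF m i(1)] i h by simp
    then show ?thesis using \<open>real i / real m \<in> {0..1}\<close> by (auto simp: path_image_def)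
  qed
  have BA: "\<exists>x\<in>set vs. dist x y \<le> e + h" if "y \<in> path_image \<gamma>" for y
  proof -
    obtain t where t: "0 \<le> t" "t \<le> 1" "y = \<gamma> t" using \<open>y \<in> path_image \<gamma>\<close> by (auto simp: path_image_def)
    obtain i where i: "i < m" "real i / real m \<le> t" "t \<le> real (Suc i) / real m"
      using unit_interval_cell[OF m(2) t(1,2)] .
    have "dist (vs ! i) (linear_path vs t) \<le> dist (vs ! i) (vs ! Suc i)"
      using linear_path_in_segment[OF m(1) i] by (metis dist_commute dist_in_closed_segment)
    then have "dist (vs ! i) y \<le> e + h"
      using step[of i] i m near[of t] t dist_triangle[of "vs ! i" y "linear_path vs t"] by auto
    then show ?thesis using i m by auto
  qed
  have "set vs \<noteq> {}" using m by auto
  then show "0 \<le> haus_dist (set vs) (path_image \<gamma>)" "haus_dist (set vs) (path_image \<gamma>) \<le> e + h"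
    using haus_dist_bounds[OF _ _ _ bdd AB BA] by (auto simp: path_image_def finite_imp_bounded)
qed

lemma reparametrization_image:
  fixes s :: "real \<Rightarrow> real"
  assumes "s ` {0..1} \<subseteq> {0..1}" "C-lipschitz_on {0..1} s" "s 0 = 0" "s 1 = 1"
    and "\<And>t. t \<in> {0..1} \<Longrightarrow> \<beta> t = \<gamma> (s t)"
  shows "path_image \<beta> = path_image \<gamma>"
proof -
  have "{0..1} \<subseteq> s ` {0..1}"
  proof
    fix y :: real assume "y \<in> {0..1}"
    then have "\<exists>x\<ge>0. x \<le> 1 \<and> s x = y"
      using assms(3,4) lipschitz_on_continuous_on[OF assms(2)] by (intro IVT') auto
    then show "y \<in> s ` {0..1}" by auto
  qed
  with assms(1) have "s ` {0..1} = {0..1}" by blast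
  moreover have "\<beta> ` {0..1} = \<gamma> ` (s ` {0..1})" using assms(5) by (simp add: image_image)
  ultimately show ?thesis by (simp add: path_image_def)
qed

context finsler_integrand
begin

text \<open>With \<open>N\<close> about \<open>4 L / \<epsilon>\<close> points on \<open>\<gamma>\<close> the error of \<open>graph_path_near_curve\<close> tends to
  \<open>8 L m2 \<kappa>\<close>, where \<open>\<kappa>\<close> is at our disposal.  Only the countably many values \<open>\<kappa> = 1 / (j + 8)\<close> are used, so
  that the density assumption can hold almost surely for all of them at once.  The auxiliary point
  \<open>z0\<close> serves the case \<open>a = b\<close>.\<close>
lemma graph_paths_nearly_optimal:
  assumes \<gamma>: "\<gamma> \<in> lip_paths D a b" and ab: "a \<in> D" "b \<in> D" and z0: "z0 \<in> D" "z0 \<noteq> a"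
    and \<epsilon>: "\<And>n. 1 \<le> n \<Longrightarrow> 0 < \<epsilon> n" "\<epsilon> \<longlonglongrightarrow> 0"
    and V: "\<And>n. V n \<subseteq> D" "\<And>n. a \<in> V n" "\<And>n. b \<in> V n"
    and dense: "\<And>j::nat. \<forall>\<^sub>F n in sequentially. \<forall>x\<in>D. \<exists>y\<in>V n. dist x y \<le> 1 / real (j + 8) * \<epsilon> n"
    and e: "0 < e"
  shows "\<forall>\<^sub>F n in sequentially. \<exists>vs\<in>graph_paths (V n) (\<epsilon> n) a b. chain seg_cost vs \<le> cost f \<gamma> + e"
proof (cases "a = b")
  case True
  have "(\<lambda>n. 2 * m2 * (1/2 * \<epsilon> n)) \<longlonglongrightarrow> 2 * m2 * (1/2 * 0)" by (intro tendsto_intros \<epsilon>)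
  then have "\<forall>\<^sub>F n in sequentially. 2 * m2 * (1/2 * \<epsilon> n) < e" using e by (auto dest: order_tendstoD(2))
  moreover have "\<forall>\<^sub>F n in sequentially. \<epsilon> n < dist a z0"
    using order_tendstoD(2)[OF \<epsilon>(2)] z0 by simp
  ultimately show ?thesis using dense[of 0] eventually_ge_at_top[of 1]
  proof eventually_elim
    case (elim n)
    have e0: "0 < \<epsilon> n" using \<epsilon>(1) elim by simp
    \<comment> \<open>The auxiliary point \<open>y\<close> is at distance \<open>\<epsilon> / 4\<close> from \<open>a\<close>, so a vertex within \<open>\<epsilon> / 8\<close> of it
      is close to \<open>a\<close> but different from \<open>a\<close>.\<close>
    define s where "s = \<epsilon> n / 4 / dist a z0"
    have d0: "0 < dist a z0" using z0 by auto
    have s: "0 \<le> s" "s \<le> 1" using e0 elim d0 by (auto simp: s_def divide_le_eq)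
    define y where "y = a + s *\<^sub>R (z0 - a)"
    have "y \<in> D" unfolding y_def using segment_point_in_D[OF ab(1) z0(1)] s by simp
    then obtain x where x: "x \<in> V n" "dist y x \<le> 1 / 8 * \<epsilon> n" using elim by auto
    have "dist a y = \<epsilon> n / 4" using s d0 e0 by (simp add: y_def dist_norm norm_minus_commute s_def)
    then have ax: "\<epsilon> n / 8 \<le> dist a x" "dist a x \<le> 1/2 * \<epsilon> n"
      using x dist_triangle[of a x y] dist_triangle2[of a y x] e0 by auto
    then have "x \<noteq> a" "dist a x < \<epsilon> n" using e0 by auto
    then obtain vs where vs: "vs \<in> graph_paths (V n) (\<epsilon> n) a a" "chain seg_cost vs \<le> 2 * m2 * dist a x"
      using graph_loop_near_point[OF V(1,2) x(1)] by blast
    have "2 * m2 * dist a x \<le> 2 * m2 * (1/2 * \<epsilon> n)" using ax m2_pos by (intro mult_left_mono) auto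
    then show ?case using vs elim(1) True cost_nonneg[OF \<gamma>] by (intro bexI[of _ vs]) auto
  qed
next
  case False
  obtain L0 where L0: "L0-lipschitz_on {0..1} \<gamma>" and im: "\<gamma> ` {0..1} \<subseteq> D"
    using \<gamma> by (auto simp: lip_paths_def path_image_def)
  define L where "L = L0 + 1"
  have L: "L-lipschitz_on {0..1} \<gamma>" unfolding L_def by (rule lipschitz_on_mono[OF L0]) auto
  have Lpos: "0 < L" using lipschitz_on_nonneg[OF L0] by (simp add: L_def)
  obtain j :: nat where j: "8 * L * m2 / e < real j" using reals_Archimedean2 by blast
  define \<kappa> where "\<kappa> = 1 / real (j + 8)"
  have \<kappa>: "0 < \<kappa>" "\<kappa> \<le> 1 / 8" by (auto simp: \<kappa>_def field_simps)
  have \<kappa>e: "4 * L * (2 * m2 * \<kappa>) < e"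
  proof -
    have "8 * L * m2 < real j * e" using j e by (simp add: pos_divide_less_eq)
    also have "\<dots> \<le> real (j + 8) * e" using e by (intro mult_right_mono) auto
    finally show ?thesis by (simp add: \<kappa>_def field_simps)
  qed
  define N where "N = (\<lambda>n. nat \<lceil>4 * L / \<epsilon> n\<rceil>)"
  have Nprop: "0 < N n \<and> L / N n \<le> \<epsilon> n / 4 \<and> real (N n) * \<epsilon> n \<le> 4 * L + \<epsilon> n" if "1 \<le> n" for n
  proof -
    have e0: "0 < \<epsilon> n" using \<epsilon>(1) that by simp
    have q: "0 < 4 * L / \<epsilon> n" using e0 Lpos by simp
    then have N: "0 < N n" "4 * L / \<epsilon> n \<le> real (N n)" "real (N n) \<le> 4 * L / \<epsilon> n + 1"
      unfolding N_def by (simp, linarith, linarith)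
    have "4 * L \<le> real (N n) * \<epsilon> n" using N(2) e0 by (simp add: pos_divide_le_eq)
    moreover have "real (N n) * \<epsilon> n \<le> 4 * L + \<epsilon> n"
      using mult_right_mono[OF N(3), of "\<epsilon> n"] e0 by (simp add: algebra_simps)
    ultimately show ?thesis using N(1) by (simp add: pos_divide_le_eq mult.commute)
  qed
  have "filterlim N at_top sequentially"
  proof -
    have "filterlim \<epsilon> (at_right 0) sequentially"
      using \<epsilon> by (intro tendsto_imp_filterlim_at_right) (auto simp: eventually_sequentially)
    then have "filterlim (\<lambda>n. inverse (\<epsilon> n)) at_top sequentially"
      by (rule filterlim_compose[OF filterlim_inverse_at_top_right])
    then have "filterlim (\<lambda>n. (4 * L) * inverse (\<epsilon> n)) at_top sequentially"
      using Lpos by (intro filterlim_tendsto_pos_mult_at_top[OF tendsto_const]) auto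
    then have "filterlim (\<lambda>n. real (N n)) at_top sequentially"
    proof (rule filterlim_at_top_mono, intro always_eventually allI)
      show "4 * L * inverse (\<epsilon> n) \<le> real (N n)" for n
        unfolding N_def divide_inverse[symmetric] by linarith
    qed
    then show ?thesis unfolding filterlim_sequentially_iff_filterlim_real .
  qed
  then have R: "(\<lambda>n. riemann \<gamma> (N n)) \<longlonglongrightarrow> cost f \<gamma>"
    by (rule filterlim_compose[OF riemann_tendsto_cost[OF L im]])
  have "(\<lambda>n. riemann \<gamma> (N n) + (4 * L + \<epsilon> n) * (2 * m2 * \<kappa> + c * \<epsilon> n))
      \<longlonglongrightarrow> cost f \<gamma> + (4 * L + 0) * (2 * m2 * \<kappa> + c * 0)"
    by (intro tendsto_intros R \<epsilon>)
  then have "\<forall>\<^sub>F n in sequentially. riemann \<gamma> (N n) + (4 * L + \<epsilon> n) * (2 * m2 * \<kappa> + c * \<epsilon> n) < cost f \<gamma> + e"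
    using \<kappa>e by (intro order_tendstoD(2)) auto
  then show ?thesis using dense[of j] eventually_ge_at_top[of 1]
  proof eventually_elim
    case (elim n)
    have e0: "0 < \<epsilon> n" using \<epsilon>(1) elim by simp
    have "\<exists>vs\<in>graph_paths (V n) (\<epsilon> n) a b.
        chain seg_cost vs \<le> riemann \<gamma> (N n) + real (N n) * (2 * m2 * \<kappa> * \<epsilon> n + c * (\<epsilon> n)\<^sup>2)"
      using elim(2) Nprop[OF elim(3)] e0 \<kappa>
      by (intro graph_path_near_curve[OF \<gamma> L V _ \<kappa> e0 False]) (auto simp: \<kappa>_def)
    then obtain vs where vs: "vs \<in> graph_paths (V n) (\<epsilon> n) a b"
        "chain seg_cost vs \<le> riemann \<gamma> (N n) + real (N n) * (2 * m2 * \<kappa> * \<epsilon> n + c * (\<epsilon> n)\<^sup>2)" by blast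
    have "real (N n) * (2 * m2 * \<kappa> * \<epsilon> n + c * (\<epsilon> n)\<^sup>2) = (real (N n) * \<epsilon> n) * (2 * m2 * \<kappa> + c * \<epsilon> n)"
      by (simp add: power2_eq_square algebra_simps)
    also have "\<dots> \<le> (4 * L + \<epsilon> n) * (2 * m2 * \<kappa> + c * \<epsilon> n)"
      using Nprop[OF elim(3)] m2_pos \<kappa> c_nonneg e0 by (intro mult_right_mono) auto
    finally show ?case using vs elim(1) by (intro bexI[of _ vs]) auto
  qed
qed

lemma graph_minimum_converges:
  assumes ab: "a \<in> D" "b \<in> D" and z0: "z0 \<in> D" "z0 \<noteq> a"
    and \<epsilon>: "\<And>n. 1 \<le> n \<Longrightarrow> 0 < \<epsilon> n" "\<epsilon> \<longlonglongrightarrow> 0"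
    and V: "\<And>n. V n \<subseteq> D" "\<And>n. a \<in> V n" "\<And>n. b \<in> V n" "\<And>n. finite (V n)"
    and dense: "\<And>j::nat. \<forall>\<^sub>F n in sequentially. \<forall>x\<in>D. \<exists>y\<in>V n. dist x y \<le> 1 / real (j + 8) * \<epsilon> n"
  shows "\<forall>\<^sub>F n in sequentially. argmin_on (cost f) (linear_paths (V n) (\<epsilon> n) a b) \<noteq> {}"
    and "(\<lambda>n. min_on (cost f) (linear_paths (V n) (\<epsilon> n) a b)) \<longlonglongrightarrow> min_on (cost f) (lip_paths D a b)"
proof -
  obtain \<gamma> where \<gamma>: "\<gamma> \<in> argmin_on (cost f) (lip_paths D a b)" using minimizer_exists[OF ab] by blast
  then have \<gamma>': "\<gamma> \<in> lip_paths D a b" "\<And>\<beta>. \<beta> \<in> lip_paths D a b \<Longrightarrow> cost f \<gamma> \<le> cost f \<beta>"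
    by (auto simp: argmin_on_def is_arg_min_linorder)
  have close: "\<forall>\<^sub>F n in sequentially. argmin_on (cost f) (linear_paths (V n) (\<epsilon> n) a b) \<noteq> {} \<and>
      cost f \<gamma> \<le> min_on (cost f) (linear_paths (V n) (\<epsilon> n) a b) \<and>
      min_on (cost f) (linear_paths (V n) (\<epsilon> n) a b) \<le> cost f \<gamma> + e" if e: "0 < e" for e
  proof -
    have "\<forall>\<^sub>F n in sequentially. \<exists>vs\<in>graph_paths (V n) (\<epsilon> n) a b. chain seg_cost vs \<le> cost f \<gamma> + e"
      by (rule graph_paths_nearly_optimal[OF \<gamma>'(1) ab z0 \<epsilon> V(1,2,3) dense e])
    then show ?thesis
    proof eventually_elim
      case (elim n)
      then obtain vs where vs: "vs \<in> graph_paths (V n) (\<epsilon> n) a b" "chain seg_cost vs \<le> cost f \<gamma> + e" by blast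
      then have ne: "argmin_on (cost f) (linear_paths (V n) (\<epsilon> n) a b) \<noteq> {}"
        using graph_minimizer_exists[OF V(4,1)] by blast
      then obtain \<beta> where \<beta>: "\<beta> \<in> argmin_on (cost f) (linear_paths (V n) (\<epsilon> n) a b)" by blast
      then have "\<beta> \<in> linear_paths (V n) (\<epsilon> n) a b" "cost f \<beta> \<le> cost f (linear_path vs)"
        using vs by (auto simp: argmin_on_def is_arg_min_linorder linear_paths_def)
      moreover have "cost f (linear_path vs) = chain seg_cost vs"
        using vs V(1) by (intro cost_linear_path) (auto simp: graph_paths_iff)
      ultimately show ?case
        using ne vs(2) \<gamma>'(2)[of \<beta>] graph_paths_in_lip_paths[OF V(1), of n "\<epsilon> n" a b] min_on_eq[OF \<beta>] by auto
    qed
  qed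
  show "\<forall>\<^sub>F n in sequentially. argmin_on (cost f) (linear_paths (V n) (\<epsilon> n) a b) \<noteq> {}"
    using close[of 1] by (auto elim: eventually_mono)
  show "(\<lambda>n. min_on (cost f) (linear_paths (V n) (\<epsilon> n) a b)) \<longlonglongrightarrow> min_on (cost f) (lip_paths D a b)"
    unfolding min_on_eq[OF \<gamma>]
  proof (rule tendstoI)
    fix e :: real assume "0 < e"
    then have "0 < e / 2" by simp
    from close[OF this] show "\<forall>\<^sub>F n in sequentially. dist (min_on (cost f) (linear_paths (V n) (\<epsilon> n) a b)) (cost f \<gamma>) < e"
      by eventually_elim (use \<open>0 < e\<close> in \<open>auto simp: dist_real_def\<close>)
  qed
qed

text \<open>Each of the \<open>m\<close> steps of length less than \<open>\<epsilon>\<close> is traversed in time \<open>1 / m\<close>, so the Lipschitz constant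
  is at most \<open>m \<epsilon>\<close>, and this is what \<open>hop_bound\<close> controls.\<close>
lemma optimal_paths_uniformly_lipschitz:
  assumes P: "cond_Pythag \<alpha> D f" and \<alpha>: "1 < \<alpha>" "\<alpha> < sqrt 2"
    and \<epsilon>: "\<And>n. 1 \<le> n \<Longrightarrow> 0 < \<epsilon> n" "\<epsilon> \<longlonglongrightarrow> 0"
    and V: "\<And>n. V n \<subseteq> D" "\<And>n. finite (V n)"
    and tube: "\<forall>\<^sub>F n in sequentially. \<forall>u\<in>D. \<forall>w\<in>D. dist u w < \<epsilon> n \<longrightarrow>
       card {x \<in> V n. infdist x (closed_segment u w) \<le> \<epsilon> n powr \<alpha>} \<le> k"
    and conv: "(\<lambda>n. min_on (cost f) (linear_paths (V n) (\<epsilon> n) a b)) \<longlonglongrightarrow> z"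
    and v: "\<forall>\<^sub>F n in sequentially. v n \<in> graph_paths (V n) (\<epsilon> n) a b \<and>
       linear_path (v n) \<in> argmin_on (cost f) (linear_paths (V n) (\<epsilon> n) a b)"
  shows "\<exists>L. \<forall>\<^sub>F n in sequentially. L-lipschitz_on {0..1} (linear_path (v n))"
proof -
  \<comment> \<open>The window length in \<open>hop_bound\<close> must be positive.\<close>
  define K where "K = Suc k"
  define L where "L = real K * ((z + 1) / m1) + real K"
  obtain \<epsilon>0 where \<epsilon>0: "0 < \<epsilon>0" and flat: "\<And>\<epsilon> u B w x. \<lbrakk>0 < \<epsilon>; \<epsilon> < \<epsilon>0; set (u # B @ [w]) \<subseteq> D; dist u w < \<epsilon>;
     chain seg_cost (u # B @ [w]) \<le> seg_cost u w; x \<in> set B\<rbrakk> \<Longrightarrow> infdist x (closed_segment u w) \<le> \<epsilon> powr \<alpha>"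
    using shortcut_window_flat[OF P \<alpha>] by metis
  have "\<forall>\<^sub>F n in sequentially. \<epsilon> n < min \<epsilon>0 1" using \<epsilon>0 by (intro order_tendstoD(2)[OF \<epsilon>(2)]) simp
  moreover have "\<forall>\<^sub>F n in sequentially. min_on (cost f) (linear_paths (V n) (\<epsilon> n) a b) < z + 1"
    using order_tendstoD(2)[OF conv] by simp
  ultimately have "\<forall>\<^sub>F n in sequentially. L-lipschitz_on {0..1} (linear_path (v n))"
    using tube v eventually_ge_at_top[of 1]
  proof eventually_elim
    case (elim n)
    have e: "0 < \<epsilon> n" "\<epsilon> n < \<epsilon>0" "\<epsilon> n < 1" using \<epsilon>(1) elim by auto
    have vs: "v n \<in> graph_paths (V n) (\<epsilon> n) a b" using elim by blast
    then have g: "2 \<le> length (v n)" "set (v n) \<subseteq> V n" "successively (geo_edge (\<epsilon> n)) (v n)"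
      by (auto simp: graph_paths_iff)
    then have gD: "set (v n) \<subseteq> D" using V(1)[of n] by blast
    obtain m where m: "length (v n) = Suc m" "0 < m" using g(1) by (cases "length (v n)") auto
    have hb: "real (length (v n) - 1) * \<epsilon> n \<le> real K * chain dist (v n) + real K * \<epsilon> n"
    proof (rule hop_bound[OF V(2,1) vs e(1)])
      show "chain seg_cost (v n) \<le> chain seg_cost ws" if "ws \<in> graph_paths (V n) (\<epsilon> n) a b" for ws
        using graph_min_optimal[OF V(1) vs _ that] elim by blast
      show "infdist x (closed_segment u w) \<le> \<epsilon> n powr \<alpha>"
        if "set (u # B @ [w]) \<subseteq> D" "dist u w < \<epsilon> n" "chain seg_cost (u # B @ [w]) \<le> seg_cost u w" "x \<in> set B"
        for u B w x using flat[OF e(1,2) that] .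
      show "card {x \<in> V n. infdist x (closed_segment u w) \<le> \<epsilon> n powr \<alpha>} \<le> K"
        if "u \<in> D" "w \<in> D" "dist u w < \<epsilon> n" for u w
        using elim(3) that unfolding K_def by (meson le_SucI)
    qed (auto simp: K_def)
    have "m1 * chain dist (v n) \<le> cost f (linear_path (v n))"
      using chain_seg_cost_lower[OF gD] cost_linear_path[OF g(1) gD] by simp
    also have "\<dots> = min_on (cost f) (linear_paths (V n) (\<epsilon> n) a b)"
      using min_on_eq[of "linear_path (v n)" "cost f"] elim by auto
    finally have "chain dist (v n) \<le> (z + 1) / m1" using elim(2) m1_pos by (simp add: pos_le_divide_eq mult.commute)
    then have "real K * chain dist (v n) \<le> real K * ((z + 1) / m1)" by (intro mult_left_mono) auto
    moreover have "real K * \<epsilon> n \<le> real K * 1" using e by (intro mult_left_mono) auto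
    ultimately have "real m * \<epsilon> n \<le> L" using hb m by (simp add: L_def)
    moreover have "(real m * \<epsilon> n)-lipschitz_on {0..1} (linear_path (v n))"
    proof (rule linear_path_lipschitz[OF m])
      show "dist (v n ! i) (v n ! Suc i) \<le> \<epsilon> n" if "i < m" for i
        using successively_nth[OF g(3), of i] that m by (simp add: geo_edge_def dist_norm)
    qed (use e in auto)
    ultimately show ?case by (rule lipschitz_on_mono[rotated 2]) auto
  qed
  then show ?thesis by blast
qed

text \<open>The costs along the sequence tend to the continuous minimum, so by lower semicontinuity the limit
  of a uniformly convergent subsequence is a minimizer.\<close>
lemma optimal_paths_subsequence:
  assumes ab: "a \<in> D" "b \<in> D"
    and \<epsilon>: "\<And>n. 1 \<le> n \<Longrightarrow> 0 < \<epsilon> n" "\<epsilon> \<longlonglongrightarrow> 0"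
    and V: "\<And>n. V n \<subseteq> D"
    and conv: "(\<lambda>n. min_on (cost f) (linear_paths (V n) (\<epsilon> n) a b)) \<longlonglongrightarrow> min_on (cost f) (lip_paths D a b)"
    and v: "\<forall>\<^sub>F n in sequentially. v n \<in> graph_paths (V n) (\<epsilon> n) a b \<and>
       linear_path (v n) \<in> argmin_on (cost f) (linear_paths (V n) (\<epsilon> n) a b)"
    and lip: "\<forall>\<^sub>F n in sequentially. L-lipschitz_on {0..1} (linear_path (v n))"
    and r: "strict_mono (r :: nat \<Rightarrow> nat)"
  shows "\<exists>(s :: nat \<Rightarrow> nat) \<gamma>. strict_mono s \<and> \<gamma> \<in> argmin_on (cost f) (lip_paths D a b) \<and>
     uniform_limit {0..1} (\<lambda>k. linear_path (v (r (s k)))) \<gamma> sequentially \<and>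
     (\<lambda>k. haus_dist (set (v (r (s k)))) (path_image \<gamma>)) \<longlonglongrightarrow> 0"
proof -
  define z where "z = min_on (cost f) (lip_paths D a b)"
  have "\<forall>\<^sub>F n in sequentially. 1 \<le> n \<and> v n \<in> graph_paths (V n) (\<epsilon> n) a b \<and>
      linear_path (v n) \<in> argmin_on (cost f) (linear_paths (V n) (\<epsilon> n) a b) \<and> L-lipschitz_on {0..1} (linear_path (v n))"
    using v lip eventually_ge_at_top[of 1] by eventually_elim auto
  then obtain N0 where N0: "\<And>n. N0 \<le> n \<Longrightarrow> 1 \<le> n \<and> v n \<in> graph_paths (V n) (\<epsilon> n) a b \<and>
      linear_path (v n) \<in> argmin_on (cost f) (linear_paths (V n) (\<epsilon> n) a b) \<and> L-lipschitz_on {0..1} (linear_path (v n))"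
    by (auto simp: eventually_sequentially)
  \<comment> \<open>A shift of the subsequence discards the finitely many indices without an optimal path.\<close>
  define q where "q = (\<lambda>k. r (k + N0))"
  have q: "strict_mono q" using r by (auto simp: q_def strict_mono_def)
  have qN: "N0 \<le> q k" for k
    unfolding q_def using seq_suble[OF r, of "k + N0"] by linarith
  have "(\<lambda>k. min_on (cost f) (linear_paths (V (q k)) (\<epsilon> (q k)) a b)) \<longlonglongrightarrow> z"
    using LIMSEQ_subseq_LIMSEQ[OF conv q] by (simp add: o_def z_def)
  moreover have "min_on (cost f) (linear_paths (V (q k)) (\<epsilon> (q k)) a b) = cost f (linear_path (v (q k)))" for k
    using N0[OF qN[of k]] by (intro min_on_eq) blast
  ultimately have costs: "(\<lambda>k. cost f (linear_path (v (q k)))) \<longlonglongrightarrow> z" by simp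
  have mem: "linear_path (v (q k)) \<in> lip_paths D a b" for k
    using N0[OF qN[of k]] graph_paths_in_lip_paths[OF V] by (fastforce simp: linear_paths_def)
  have lip': "L-lipschitz_on {0..1} (linear_path (v (q k)))" for k using N0[OF qN[of k]] by blast
  obtain s \<gamma> where s: "strict_mono s" and \<gamma>: "\<gamma> \<in> lip_paths D a b" "cost f \<gamma> \<le> z"
    and ul: "uniform_limit {0..1} (\<lambda>k. linear_path (v (q (s k)))) \<gamma> sequentially"
    using uniform_subsequence[of L "\<lambda>k. linear_path (v (q k))", OF lip' mem costs] by metis
  have "\<gamma> \<in> argmin_on (cost f) (lip_paths D a b)"
  proof -
    obtain \<gamma>0 where \<gamma>0: "\<gamma>0 \<in> argmin_on (cost f) (lip_paths D a b)" using minimizer_exists[OF ab] by blast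
    then have "z = cost f \<gamma>0" unfolding z_def by (rule min_on_eq)
    then show ?thesis using \<gamma>0 \<gamma> by (auto simp: argmin_on_def is_arg_min_linorder intro: order_trans)
  qed
  moreover have "(\<lambda>k. haus_dist (set (v (q (s k)))) (path_image \<gamma>)) \<longlonglongrightarrow> 0"
  proof (rule tendstoI)
    fix e :: real assume e: "0 < e"
    have qs: "strict_mono (\<lambda>k. q (s k))" using q s by (auto simp: strict_mono_def)
    have "(\<lambda>k. \<epsilon> (q (s k))) \<longlonglongrightarrow> 0" using LIMSEQ_subseq_LIMSEQ[OF \<epsilon>(2) qs] by (simp add: o_def)
    then have "\<forall>\<^sub>F k in sequentially. \<epsilon> (q (s k)) < e / 3" using e by (intro order_tendstoD(2)) auto
    moreover have "\<forall>\<^sub>F k in sequentially. \<forall>t\<in>{0..1}. dist (linear_path (v (q (s k))) t) (\<gamma> t) < e / 3"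
      using uniform_limitD[OF ul, of "e / 3"] e by simp
    ultimately show "\<forall>\<^sub>F k in sequentially. dist (haus_dist (set (v (q (s k)))) (path_image \<gamma>)) 0 < e"
    proof eventually_elim
      case (elim k)
      note n = N0[OF qN[of "s k"]]
      have g: "2 \<le> length (v (q (s k)))" "successively (geo_edge (\<epsilon> (q (s k)))) (v (q (s k)))"
        using n by (auto simp: graph_paths_iff)
      have bdd: "bounded (path_image \<gamma>)"
        using \<gamma> compact_imp_bounded[OF compact_D] by (auto simp: lip_paths_def intro: bounded_subset)
      have steps: "dist (v (q (s k)) ! i) (v (q (s k)) ! Suc i) \<le> \<epsilon> (q (s k))" if "Suc i < length (v (q (s k)))" for i
        using successively_nth[OF g(2) that] by (simp add: geo_edge_def dist_norm)
      have near: "dist (linear_path (v (q (s k))) t) (\<gamma> t) \<le> e / 3" if "t \<in> {0..1}" for t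
        using elim(2) that by (simp add: less_imp_le)
      have pos: "0 \<le> \<epsilon> (q (s k))" using \<epsilon>(1) n by (simp add: less_imp_le)
      show ?case
        using haus_dist_linear_path[OF g(1) steps near pos bdd] elim(1) e by (simp add: dist_real_def)
    qed
  qed
  moreover have "strict_mono (\<lambda>k. s k + N0)" using s by (auto simp: strict_mono_def)
  ultimately show ?thesis using ul unfolding q_def
    by (intro exI[of _ "\<lambda>k. s k + N0"] exI[of _ \<gamma>] conjI)
qed

text \<open>All minimizers have the same image, so every subsequence has a further one with the same Hausdorff
  limit.\<close>
lemma unique_minimizer_limit:
  assumes uniq: "unique_minimizer f D a b \<gamma>"
    and sub: "\<And>r :: nat \<Rightarrow> nat. strict_mono r \<Longrightarrow> \<exists>(s :: nat \<Rightarrow> nat) \<beta>. strict_mono s \<and> \<beta> \<in> argmin_on (cost f) (lip_paths D a b) \<and>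
     (\<lambda>k. haus_dist (set (v (r (s k)))) (path_image \<beta>)) \<longlonglongrightarrow> 0"
  shows "(\<lambda>n. haus_dist (set (v n)) (path_image \<gamma>)) \<longlonglongrightarrow> 0"
proof (rule ccontr)
  let ?h = "\<lambda>n. haus_dist (set (v n)) (path_image \<gamma>)"
  assume "\<not> ?h \<longlonglongrightarrow> 0"
  then obtain e where e: "0 < e" "\<not> (\<forall>\<^sub>F n in sequentially. dist (?h n) 0 < e)" unfolding tendsto_iff by blast
  then have "infinite {n. \<not> dist (?h n) 0 < e}"
    unfolding cofinite_eq_sequentially[symmetric] eventually_cofinite by simp
  then obtain r :: "nat \<Rightarrow> nat" where r: "strict_mono r" "\<And>k. \<not> dist (?h (r k)) 0 < e"
    using infinite_enumerate[of "{n. \<not> dist (?h n) 0 < e}"] by auto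
  obtain s \<beta> where s: "\<beta> \<in> argmin_on (cost f) (lip_paths D a b)"
    "(\<lambda>k. haus_dist (set (v (r (s k)))) (path_image \<beta>)) \<longlonglongrightarrow> 0" using sub[OF r(1)] by blast
  have "path_image \<beta> = path_image \<gamma>"
  proof -
    obtain \<sigma> C where "\<sigma> ` {0..1} \<subseteq> {0..1}" "C-lipschitz_on {0..1} \<sigma>" "\<sigma> 0 = 0" "\<sigma> 1 = 1"
      "\<forall>t\<in>{0..1}. \<beta> t = \<gamma> (\<sigma> t)"
      using uniq s(1) unfolding unique_minimizer_def by blast
    then show ?thesis by (intro reparametrization_image[of \<sigma> C]) auto
  qed
  then have "\<forall>\<^sub>F k in sequentially. dist (?h (r (s k))) 0 < e" using tendstoD[OF s(2) e(1)] by simp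
  then show False using r(2) by (auto simp: eventually_sequentially)
qed

end

section \<open>Minima and minimizers on random geometric graphs\<close>
lemma finsler_integrand_exists:
  assumes "convex_body D" "cost_integrand 1 D f" "cond_Lip 1 D f"
  shows "\<exists>m1 m2 c. finsler_integrand D f m1 m2 c"
proof -
  note body = convex_body_facts[OF assms(1)]
  have A0: "continuous_on (D \<times> UNIV) (\<lambda>(x, v). f x v)"
    and A1: "\<And>x. x \<in> D \<Longrightarrow> convex_on UNIV (f x)"
    and A2: "\<And>x s v. x \<in> D \<Longrightarrow> 0 < s \<Longrightarrow> f x (s *\<^sub>R v) = s * f x v"
    using assms(2) by (auto simp: cost_integrand_def cond_A0_def cond_A1_def cond_A2_def)
  obtain m1 m2 where m: "0 < m1" "0 < m2"
    "\<And>x v. x \<in> D \<Longrightarrow> m1 * norm v \<le> f x v" "\<And>x v. x \<in> D \<Longrightarrow> f x v \<le> m2 * norm v"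
    using assms(2) by (auto simp: cost_integrand_def cond_A3_def powr_one)
  obtain c where c: "\<And>x y v. x \<in> D \<Longrightarrow> y \<in> D \<Longrightarrow> \<bar>f x v - f y v\<bar> \<le> c * norm (x - y) * norm v"
    using assms(3) by (auto simp: cond_Lip_def powr_one)
  have "finsler_integrand D f m1 m2 \<bar>c\<bar>"
  proof
    show "f x (u + v) \<le> f x u + f x v" if x: "x \<in> D" for x u v
    proof -
      have "f x (u + v) = 2 * f x ((1 - 1/2) *\<^sub>R u + (1/2) *\<^sub>R v)"
        using A2[OF x, of 2 "(1 - 1/2) *\<^sub>R u + (1/2) *\<^sub>R v"] by (simp add: scaleR_add_right)
      also have "f x ((1 - 1/2) *\<^sub>R u + (1/2) *\<^sub>R v) \<le> (1 - 1/2) * f x u + 1/2 * f x v"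
        by (rule convex_onD[OF A1[OF x]]) auto
      finally show ?thesis by simp
    qed
    show "f x (s *\<^sub>R v) = s * f x v" if "x \<in> D" "0 \<le> s" for x s v
    proof (cases "s = 0")
      case True
      then show ?thesis using m(3)[OF that(1), of 0] m(4)[OF that(1), of 0] by simp
    qed (use A2 that in simp)
    show "\<bar>f x v - f y v\<bar> \<le> \<bar>c\<bar> * norm (x - y) * norm v" if "x \<in> D" "y \<in> D" for x y v
      using c[OF that, of v] by (rule order_trans) (intro mult_right_mono, auto)
  qed (use body A0 m in auto)
  then show ?thesis by blast
qed

lemma limsup_zero_imp_tendsto:
  fixes g :: "nat \<Rightarrow> real"
  assumes "limsup (\<lambda>n. ereal (g n)) = 0" "\<forall>\<^sub>F n in sequentially. 0 \<le> g n"
  shows "g \<longlonglongrightarrow> 0"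
proof -
  have "0 \<le> liminf (\<lambda>n. ereal (g n))" using assms(2) by (intro Liminf_bounded) simp
  moreover have "liminf (\<lambda>n. ereal (g n)) \<le> limsup (\<lambda>n. ereal (g n))" by (rule Liminf_le_Limsup) simp
  ultimately have "(\<lambda>n. ereal (g n)) \<longlonglongrightarrow> 0" using assms(1) by (intro Liminf_eq_Limsup) auto
  then show ?thesis by (simp add: zero_ereal_def)
qed

text \<open>The two extra vertices are the end points \<open>a\<close> and \<open>b\<close>.\<close>
lemma card_vertices_tube:
  assumes "card {i \<in> {1..n}. P (X i \<omega>)} \<le> k"
  shows "card {x \<in> vertices X a b n \<omega>. P x} \<le> k + 2"
proof -
  have "{x \<in> vertices X a b n \<omega>. P x} \<subseteq> (\<lambda>i. X i \<omega>) ` {i \<in> {1..n}. P (X i \<omega>)} \<union> {a, b}"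
    by (auto simp: vertices_def)
  then have "card {x \<in> vertices X a b n \<omega>. P x} \<le> card ((\<lambda>i. X i \<omega>) ` {i \<in> {1..n}. P (X i \<omega>)} \<union> {a, b})"
    by (intro card_mono) auto
  also have "\<dots> \<le> card ((\<lambda>i. X i \<omega>) ` {i \<in> {1..n}. P (X i \<omega>)}) + card {a, b}" by (rule card_Un_le)
  also have "\<dots> \<le> k + 2"
    using assms card_image_le[of "{i \<in> {1..n}. P (X i \<omega>)}" "\<lambda>i. X i \<omega>"] card_insert_le_m1[of 2 "{b}" a]
    by (intro add_mono) auto
  finally show ?thesis .
qed

theorem theorem2p8:
  fixes D :: "'a::euclidean_space set"
    and f :: "'a \<Rightarrow> 'a \<Rightarrow> real"
    and a b :: 'a
    and M :: "'w measure"
    and X :: "nat \<Rightarrow> 'w \<Rightarrow> 'a"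
    and \<rho> :: "'a \<Rightarrow> real"
    and c0 :: real
    and \<epsilon> :: "nat \<Rightarrow> real"
  assumes "DIM('a) \<ge> 2"
    and "convex_body D"
    and "a \<in> D" and "b \<in> D"
    and "cost_integrand 1 D f"
    and "cond_Lip 1 D f"
    and "cond_Hilb D f"
    and "prob_space M"
    and "iid_sample M D \<rho> X"
    and "c0 > 0" and "\<And>x. x \<in> D \<Longrightarrow> c0 \<le> \<rho> x \<and> \<rho> x \<le> 1 / c0"
    and "\<And>n. n \<ge> 1 \<Longrightarrow> \<epsilon> n > 0"
    and "\<epsilon> \<longlonglongrightarrow> 0"
    and "limsup (\<lambda>n. ereal (ln (real n) powr (1 / real DIM('a)) /
            real n powr (1 / real DIM('a)) * (1 / \<epsilon> n))) = 0"
  shows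
    "(argmin_on (cost f) (lip_paths D a b) \<noteq> {} \<and>
      (AE \<omega> in M.
        (\<forall>\<^sub>F n in sequentially.
           argmin_on (cost f) (linear_paths (vertices X a b n \<omega>) (\<epsilon> n) a b) \<noteq> {}) \<and>
        (\<lambda>n. min_on (cost f) (linear_paths (vertices X a b n \<omega>) (\<epsilon> n) a b))
          \<longlonglongrightarrow> min_on (cost f) (lip_paths D a b)))
     \<and>
     (\<forall>\<alpha> \<delta> \<eta> :: real.
        cond_TrIneq D f \<and> 1 < \<alpha> \<and> \<alpha> < sqrt 2 \<and> cond_Pythag \<alpha> D f \<and>
        0 < \<eta> \<and> \<eta> < 1 \<and>
        \<delta> > max (inverse ((2 - \<alpha>\<^sup>2) * \<eta> + real DIM('a)))
                (inverse (\<alpha> * (real DIM('a) - 1) + 1)) \<and>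
        (\<forall>n\<ge>1. \<epsilon> n = real n powr (- \<delta>))
      \<longrightarrow>
        (AE \<omega> in M.
          \<forall>v :: nat \<Rightarrow> 'a list.
            (\<forall>\<^sub>F n in sequentially.
               v n \<in> graph_paths (vertices X a b n \<omega>) (\<epsilon> n) a b \<and>
               linear_path (v n)
                 \<in> argmin_on (cost f) (linear_paths (vertices X a b n \<omega>) (\<epsilon> n) a b))
          \<longrightarrow>
            (\<forall>r :: nat \<Rightarrow> nat. strict_mono r \<longrightarrow>
               (\<exists>(s :: nat \<Rightarrow> nat) \<gamma>. strict_mono s \<and>
                  \<gamma> \<in> argmin_on (cost f) (lip_paths D a b) \<and>
                  uniform_limit {0..1} (\<lambda>k. linear_path (v (r (s k)))) \<gamma> sequentially \<and>
                  (\<lambda>k. haus_dist (set (v (r (s k)))) (path_image \<gamma>)) \<longlonglongrightarrow> 0)) \<and>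
            (\<forall>\<gamma>. unique_minimizer f D a b \<gamma> \<longrightarrow>
               (\<lambda>n. haus_dist (set (v n)) (path_image \<gamma>)) \<longlonglongrightarrow> 0)))"
proof -
  obtain m1 m2 c where "finsler_integrand D f m1 m2 c"
    using finsler_integrand_exists assms(2,5,6) by blast
  then interpret finsler_integrand D f m1 m2 c .
  interpret prob_space M by fact
  interpret uniform_sample M D \<rho> X c0
    using assms(2,9,10,11) by unfold_locales auto
  note ab = \<open>a \<in> D\<close> \<open>b \<in> D\<close>
  have \<epsilon>: "\<And>n. 1 \<le> n \<Longrightarrow> 0 < \<epsilon> n" "\<epsilon> \<longlonglongrightarrow> 0" using assms(12,13) by auto
  have growth: "(\<lambda>n. ln (real n) powr (1 / real DIM('a)) / real n powr (1 / real DIM('a)) * (1 / \<epsilon> n)) \<longlonglongrightarrow> 0"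
    using assms(14)
  proof (rule limsup_zero_imp_tendsto)
    show "\<forall>\<^sub>F n in sequentially. 0 \<le> ln (real n) powr (1 / real DIM('a)) / real n powr (1 / real DIM('a)) * (1 / \<epsilon> n)"
      using eventually_ge_at_top[of 1] by eventually_elim (use \<epsilon>(1) in \<open>simp add: less_imp_le\<close>)
  qed
  obtain z0 where z0: "z0 \<in> D" "z0 \<noteq> a"
  proof -
    have "\<not> D \<subseteq> {a}"
    proof
      assume "D \<subseteq> {a}"
      then have "interior D \<subseteq> interior {a}" by (rule interior_mono)
      then show False using convex_body_facts(4)[OF assms(2)] by simp
    qed
    then show thesis using that by blast
  qed
  have "AE \<omega> in M. \<forall>j::nat. \<forall>\<^sub>F n in sequentially. \<forall>x\<in>D. \<exists>i\<in>{1..n}. dist x (X i \<omega>) \<le> 1 / real (j + 8) * \<epsilon> n"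
    unfolding AE_all_countable by (intro allI AE_sample_dense[OF \<epsilon> growth]) auto
  then have good: "AE \<omega> in M. (\<forall>n. vertices X a b n \<omega> \<subseteq> D) \<and>
      (\<forall>j::nat. \<forall>\<^sub>F n in sequentially. \<forall>x\<in>D. \<exists>y\<in>vertices X a b n \<omega>. dist x y \<le> 1 / real (j + 8) * \<epsilon> n)"
    using AE_sample_in_D
  proof eventually_elim
    case (elim \<omega>)
    have "\<forall>\<^sub>F n in sequentially. \<forall>x\<in>D. \<exists>y\<in>vertices X a b n \<omega>. dist x y \<le> 1 / real (j + 8) * \<epsilon> n" for j
      using elim(1)[rule_format, of j] by eventually_elim (fastforce simp: vertices_def)
    then show ?case using elim(2) ab by (auto simp: vertices_def)
  qed
  have V: "a \<in> vertices X a b n \<omega>" "b \<in> vertices X a b n \<omega>" "finite (vertices X a b n \<omega>)" for n \<omega>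
    by (auto simp: vertices_def)
  show ?thesis
  proof (intro conjI allI impI)
    show "argmin_on (cost f) (lip_paths D a b) \<noteq> {}" by (rule minimizer_exists[OF ab])
    show "AE \<omega> in M. (\<forall>\<^sub>F n in sequentially.
           argmin_on (cost f) (linear_paths (vertices X a b n \<omega>) (\<epsilon> n) a b) \<noteq> {}) \<and>
        (\<lambda>n. min_on (cost f) (linear_paths (vertices X a b n \<omega>) (\<epsilon> n) a b))
          \<longlonglongrightarrow> min_on (cost f) (lip_paths D a b)"
      using good
    proof eventually_elim
      case (elim \<omega>)
      then have VD: "vertices X a b n \<omega> \<subseteq> D"
        and dense: "\<forall>\<^sub>F n in sequentially. \<forall>x\<in>D. \<exists>y\<in>vertices X a b n \<omega>. dist x y \<le> 1 / real (j + 8) * \<epsilon> n"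
        for n and j :: nat by blast+
      show ?case by (intro conjI graph_minimum_converges[OF ab z0 \<epsilon> VD V dense])
    qed
  next
    fix \<alpha> \<delta> \<eta> :: real
    assume A: "cond_TrIneq D f \<and> 1 < \<alpha> \<and> \<alpha> < sqrt 2 \<and> cond_Pythag \<alpha> D f \<and>
        0 < \<eta> \<and> \<eta> < 1 \<and>
        \<delta> > max (inverse ((2 - \<alpha>\<^sup>2) * \<eta> + real DIM('a)))
                (inverse (\<alpha> * (real DIM('a) - 1) + 1)) \<and>
        (\<forall>n\<ge>1. \<epsilon> n = real n powr (- \<delta>))"
    have pos: "0 < \<alpha> * (real DIM('a) - 1) + 1" using A assms(1) by (intro add_nonneg_pos mult_nonneg_nonneg) auto
    have "inverse (\<alpha> * (real DIM('a) - 1) + 1) < \<delta>" using A by auto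
    then have \<delta>: "0 < \<delta>" "1 < \<delta> * (\<alpha> * (real DIM('a) - 1) + 1)"
      using pos by (auto simp: field_simps intro: less_trans[of 0 "inverse (\<alpha> * (real DIM('a) - 1) + 1)"])
    obtain k where tubes: "AE \<omega> in M. \<forall>\<^sub>F n in sequentially. \<forall>u\<in>D. \<forall>w\<in>D. dist u w < \<epsilon> n \<longrightarrow>
        card {i \<in> {1..n}. infdist (X i \<omega>) (closed_segment u w) \<le> \<epsilon> n powr \<alpha>} \<le> k"
      using AE_tubes_sparse[OF _ \<delta>, of \<epsilon>] A by blast
    show "AE \<omega> in M. \<forall>v :: nat \<Rightarrow> 'a list.
            (\<forall>\<^sub>F n in sequentially.
               v n \<in> graph_paths (vertices X a b n \<omega>) (\<epsilon> n) a b \<and>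
               linear_path (v n)
                 \<in> argmin_on (cost f) (linear_paths (vertices X a b n \<omega>) (\<epsilon> n) a b))
          \<longrightarrow>
            (\<forall>r :: nat \<Rightarrow> nat. strict_mono r \<longrightarrow>
               (\<exists>(s :: nat \<Rightarrow> nat) \<gamma>. strict_mono s \<and>
                  \<gamma> \<in> argmin_on (cost f) (lip_paths D a b) \<and>
                  uniform_limit {0..1} (\<lambda>k. linear_path (v (r (s k)))) \<gamma> sequentially \<and>
                  (\<lambda>k. haus_dist (set (v (r (s k)))) (path_image \<gamma>)) \<longlonglongrightarrow> 0)) \<and>
            (\<forall>\<gamma>. unique_minimizer f D a b \<gamma> \<longrightarrow>
               (\<lambda>n. haus_dist (set (v n)) (path_image \<gamma>)) \<longlonglongrightarrow> 0)"
      using good tubes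
    proof eventually_elim
      case (elim \<omega>)
      let ?V = "\<lambda>n. vertices X a b n \<omega>"
      have VD: "?V n \<subseteq> D"
        and dense: "\<forall>\<^sub>F n in sequentially. \<forall>x\<in>D. \<exists>y\<in>?V n. dist x y \<le> 1 / real (j + 8) * \<epsilon> n"
        for n and j :: nat using elim(1) by blast+
      have conv: "(\<lambda>n. min_on (cost f) (linear_paths (?V n) (\<epsilon> n) a b)) \<longlonglongrightarrow> min_on (cost f) (lip_paths D a b)"
        by (rule graph_minimum_converges(2)[OF ab z0 \<epsilon> VD V dense])
      have tube: "\<forall>\<^sub>F n in sequentially. \<forall>u\<in>D. \<forall>w\<in>D. dist u w < \<epsilon> n \<longrightarrow>
          card {x \<in> ?V n. infdist x (closed_segment u w) \<le> \<epsilon> n powr \<alpha>} \<le> k + 2"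
        using elim(2)
      proof eventually_elim
        case (elim n)
        show ?case
        proof (intro ballI impI)
          fix u w assume "u \<in> D" "w \<in> D" "dist u w < \<epsilon> n"
          then show "card {x \<in> ?V n. infdist x (closed_segment u w) \<le> \<epsilon> n powr \<alpha>} \<le> k + 2"
            using elim by (intro card_vertices_tube) blast
        qed
      qed
      show ?case
      proof (intro allI impI)
        fix v :: "nat \<Rightarrow> 'a list"
        assume v: "\<forall>\<^sub>F n in sequentially. v n \<in> graph_paths (?V n) (\<epsilon> n) a b \<and>
               linear_path (v n) \<in> argmin_on (cost f) (linear_paths (?V n) (\<epsilon> n) a b)"
        obtain L where L: "\<forall>\<^sub>F n in sequentially. L-lipschitz_on {0..1} (linear_path (v n))"
          using optimal_paths_uniformly_lipschitz[OF _ _ _ \<epsilon> VD V(3) tube conv v] A by blast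
        have sub: "\<exists>(s :: nat \<Rightarrow> nat) \<gamma>. strict_mono s \<and>
                  \<gamma> \<in> argmin_on (cost f) (lip_paths D a b) \<and>
                  uniform_limit {0..1} (\<lambda>k. linear_path (v (r (s k)))) \<gamma> sequentially \<and>
                  (\<lambda>k. haus_dist (set (v (r (s k)))) (path_image \<gamma>)) \<longlonglongrightarrow> 0"
          if "strict_mono r" for r :: "nat \<Rightarrow> nat"
          by (rule optimal_paths_subsequence[OF ab \<epsilon> VD conv v L that])
        show "(\<forall>r :: nat \<Rightarrow> nat. strict_mono r \<longrightarrow>
               (\<exists>(s :: nat \<Rightarrow> nat) \<gamma>. strict_mono s \<and>
                  \<gamma> \<in> argmin_on (cost f) (lip_paths D a b) \<and>
                  uniform_limit {0..1} (\<lambda>k. linear_path (v (r (s k)))) \<gamma> sequentially \<and>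
                  (\<lambda>k. haus_dist (set (v (r (s k)))) (path_image \<gamma>)) \<longlonglongrightarrow> 0)) \<and>
            (\<forall>\<gamma>. unique_minimizer f D a b \<gamma> \<longrightarrow>
               (\<lambda>n. haus_dist (set (v n)) (path_image \<gamma>)) \<longlonglongrightarrow> 0)"
        proof (intro conjI allI impI)
          fix \<gamma> assume "unique_minimizer f D a b \<gamma>"
          then show "(\<lambda>n. haus_dist (set (v n)) (path_image \<gamma>)) \<longlonglongrightarrow> 0"
            by (rule unique_minimizer_limit) (use sub in blast)
        qed (rule sub)
      qed
    qed
  qed
qed

end
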